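(* Let $\Omega$ be a bounded convex Reinhardt domain in $\mathbb{C}^2$ and $\phi\in C(\overline{\Omega})$. Then $\|H_{\phi}k_z\|^2\to 0$ as $z\to b\Omega$ if and only if $\phi\circ f$ is holomorphic for any holomorphic function $f:\mathbb{D}\to b\Omega$.
   Context: $b\Omega$ denotes the boundary of $\Omega$ and $\mathbb{D}$ the open unit disc in $\mathbb{C}$; a holomorphic function $f:\mathbb{D}\to b\Omega$ is a holomorphic map $f:\mathbb{D}\to\mathbb{C}^2$ with $f(\mathbb{D})\subseteq b\Omega$. A domain $\Omega\subseteq\mathbb{C}^n$ is Reinhardt if $(\xi_1z_1,\ldots,\xi_nz_n)\in\Omega$ whenever $z\in\Omega$ and $|\xi_1|=\cdots=|\xi_n|=1$. $A^2(\Omega)$ is the Bergman space of holomorphic functions on $\Omega$ that are square integrable with respect to Lebesgue measure $dV$; $P:L^2(\Omega)\to A^2(\Omega)$ is the orthogonal (Bergman) projection; $K$ is the Bergman kernel of $\Omega$. For bounded $\phi$, the Hankel operator is $H_\phi:A^2(\Omega)\to L^2(\Omega)$, $H_\phi f=(I-P)(\phi f)$. The normalized Bergman kernel is $k_z(w)=K(w,z)/\sqrt{K(z,z)}$ for $z,w\in\Omega$. $\|\cdot\|$ is the $L^2(\Omega)$-norm. "$z\to b\Omega$" means that the distance from $z\in\Omega$ to $b\Omega$ tends to $0$. *)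

theory Defs
  imports "HOL-Complex_Analysis.Complex_Analysis"
begin

definition reinhardt_domain :: "(complex ^ 'n) set \<Rightarrow> bool" where
  "reinhardt_domain \<Omega> \<longleftrightarrow> open \<Omega> \<and> connected \<Omega> \<and> \<Omega> \<noteq> {} \<and>
     (\<forall>z\<in>\<Omega>. \<forall>\<xi> :: complex ^ 'n. (\<forall>i. norm (\<xi> $ i) = 1) \<longrightarrow> (\<chi> i. \<xi> $ i * z $ i) \<in> \<Omega>)"

text \<open>Holomorphy in several variables on an open set: real differentiability at every point
  with a complex-linear derivative.\<close>

definition scv_holomorphic_on :: "(complex ^ 'n \<Rightarrow> complex) \<Rightarrow> (complex ^ 'n) set \<Rightarrow> bool" where
  "scv_holomorphic_on f \<Omega> \<longleftrightarrow>
     (\<forall>z\<in>\<Omega>. \<exists>f'. (f has_derivative f') (at z) \<and> (\<forall>c v. f' (c *s v) = c * f' v))"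

text \<open>Elements of \<open>L\<^sup>2(\<Omega>)\<close> are represented by functions on the whole space, of which only
  the values on \<open>\<Omega>\<close> matter; all integrals are over \<open>\<Omega>\<close>.\<close>

definition L2_space :: "(complex ^ 'n) set \<Rightarrow> (complex ^ 'n \<Rightarrow> complex) set" where
  "L2_space \<Omega> = {f. f \<in> borel_measurable (lebesgue_on \<Omega>) \<and>
                     integrable (lebesgue_on \<Omega>) (\<lambda>w. (norm (f w))\<^sup>2)}"

definition L2_inner ::
    "(complex ^ 'n) set \<Rightarrow> (complex ^ 'n \<Rightarrow> complex) \<Rightarrow> (complex ^ 'n \<Rightarrow> complex) \<Rightarrow> complex" where
  "L2_inner \<Omega> f g = (LINT w|lebesgue_on \<Omega>. f w * cnj (g w))"

definition L2_norm :: "(complex ^ 'n) set \<Rightarrow> (complex ^ 'n \<Rightarrow> complex) \<Rightarrow> real" where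
  "L2_norm \<Omega> f = sqrt (LINT w|lebesgue_on \<Omega>. (norm (f w))\<^sup>2)"

text \<open>Members of the Bergman space are normalised to vanish outside \<open>\<Omega>\<close>. For open \<open>\<Omega>\<close>, each
  class in \<open>A\<^sup>2(\<Omega>)\<close> then has exactly one representing function, so the definite
  descriptions below are well determined.\<close>

definition bergman_space :: "(complex ^ 'n) set \<Rightarrow> (complex ^ 'n \<Rightarrow> complex) set" where
  "bergman_space \<Omega> = {f. scv_holomorphic_on f \<Omega> \<and> f \<in> L2_space \<Omega> \<and> (\<forall>w. w \<notin> \<Omega> \<longrightarrow> f w = 0)}"

definition bergman_projection ::
    "(complex ^ 'n) set \<Rightarrow> (complex ^ 'n \<Rightarrow> complex) \<Rightarrow> (complex ^ 'n \<Rightarrow> complex)" where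
  "bergman_projection \<Omega> g =
     (THE h. h \<in> bergman_space \<Omega> \<and> (\<forall>f\<in>bergman_space \<Omega>. L2_inner \<Omega> (\<lambda>w. g w - h w) f = 0))"

text \<open>\<open>bergman_kernel \<Omega> w z\<close> is \<open>K(w,z)\<close>: holomorphic in \<open>w\<close>, reproducing the value at \<open>z\<close>.\<close>

definition bergman_kernel :: "(complex ^ 'n) set \<Rightarrow> complex ^ 'n \<Rightarrow> complex ^ 'n \<Rightarrow> complex" where
  "bergman_kernel \<Omega> w z =
     (THE k. k \<in> bergman_space \<Omega> \<and> (\<forall>f\<in>bergman_space \<Omega>. f z = L2_inner \<Omega> f k)) w"

definition normalized_bergman_kernel ::
    "(complex ^ 'n) set \<Rightarrow> complex ^ 'n \<Rightarrow> complex ^ 'n \<Rightarrow> complex" where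
  "normalized_bergman_kernel \<Omega> z w = bergman_kernel \<Omega> w z / csqrt (bergman_kernel \<Omega> z z)"

definition hankel_operator ::
    "(complex ^ 'n) set \<Rightarrow> (complex ^ 'n \<Rightarrow> complex) \<Rightarrow> (complex ^ 'n \<Rightarrow> complex)
      \<Rightarrow> (complex ^ 'n \<Rightarrow> complex)" where
  "hankel_operator \<Omega> \<phi> f = (\<lambda>w. \<phi> w * f w - bergman_projection \<Omega> (\<lambda>v. \<phi> v * f v) w)"

definition to_boundary :: "(complex ^ 'n) set \<Rightarrow> (complex ^ 'n) filter" where
  "to_boundary \<Omega> = inf (filtercomap (\<lambda>z. infdist z (frontier \<Omega>)) (nhds 0)) (principal \<Omega>)"

end

theory Submission
  imports Defs
begin

text \<open>Write \<open>k\<^sub>z\<close> for the normalized kernel. Two facts about it drive the proof. Since \<open>H\<^sub>\<phi> k\<^sub>z\<close> is the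
  component of \<open>\<phi> k\<^sub>z\<close> orthogonal to the Bergman space, its norm is at most that of \<open>(\<phi> - g) k\<^sub>z\<close> for every
  bounded holomorphic \<open>g\<close>. And since \<open>k\<^sub>z\<close> is a multiple of the reproducing kernel at \<open>z\<close>, the
  probability density \<open>|k\<^sub>z|\<^sup>2\<close> integrates a bounded holomorphic function to its value at \<open>z\<close>.

  Suppose that \<open>\<phi>\<close> is holomorphic along boundary discs. Let \<open>Re L\<close> be a functional supporting the domain at a
  boundary point \<open>p\<close>, with maximum \<open>c\<close>. Applied to \<open>c - L\<close>, the second fact says that the integral of
  \<open>(c - Re L) |k\<^sub>z|\<^sup>2\<close> tends to zero as \<open>z\<close> tends to \<open>p\<close>: the mass of \<open>|k\<^sub>z|\<^sup>2\<close> concentrates on the face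
  \<open>Re L = c\<close> (\<open>hankel_norm_le_peak\<close>). By the first fact it suffices to approximate \<open>\<phi>\<close> uniformly on the
  face by holomorphic functions (\<open>face_approximation\<close>). By Reinhardt symmetry the face is either a
  totally real set, a piece of a line, where the Weierstrass theorem applies, or, in suitable order of the
  coordinates, a product of a point \<open>q\<close> and a closed disc, where \<open>\<phi>\<close> belongs to the disc algebra. Compactness
  of the boundary makes the estimates uniform.

  Conversely, suppose that the Hankel norms tend to zero. By the maximum principle a holomorphic disc in the boundary lies in
  one face, so it is constant or runs in a flat face \<open>{q} \<times> D\<close>. Take \<open>z = (x, b)\<close> with \<open>x\<close> approaching \<open>q\<close>
  radially, at distance \<open>d\<close>. The function \<open>\<phi> k\<^sub>z\<close> is close to its projection in norm; averaging over small
  polydiscs, whose first radius is proportional to \<open>d\<close>, gives that \<open>\<phi>(q, \<xi>) A(\<xi>) - B(\<xi>)\<close> is uniformly small near \<open>b\<close>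
  for the holomorphic slices \<open>A(\<xi>) = d k\<^sub>z(x, \<xi>)\<close> and \<open>B(\<xi>) = d P(\<phi> k\<^sub>z)(x, \<xi>)\<close>
  (\<open>polydisc_average_difference\<close>). The functions \<open>A\<close> are bounded, and bounded away from zero at \<open>b\<close> because
  \<open>K(z,z)\<close> grows at least like \<open>d\<^sup>-\<^sup>2\<close> (\<open>inverse_square_norm_le\<close>). So \<open>\<phi>(q, \<cdot>)\<close> is near \<open>b\<close> a uniform limit of the
  holomorphic quotients \<open>B / A\<close> (\<open>holomorphic_quotient_limit\<close>).

  Kernel and projection exist by the Riesz representation theorem on the Bergman space (\<open>bergman_Riesz\<close>). Its
  completeness, like all pointwise estimates above, comes from the mean value property over balanced sets
  (\<open>mean_value_balanced\<close>).\<close>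

no_notation fps_nth (infixl \<open>$\<close> 75)

section \<open>Mean values over balanced sets\<close>

text \<open>An isometry carries balls to balls of the same radius. By Vitali's covering theorem an open
  set is, up to a null set, a countable disjoint union of balls, and the Lipschitz inverse
  keeps the exceptional set null; so the image measure agrees with Lebesgue measure on open sets.\<close>

lemma distr_lborel_isometry:
  fixes f g :: "'a::euclidean_space \<Rightarrow> 'a"
  assumes iso: "\<And>x y. dist (f x) (f y) = dist x y" and fg: "\<And>x. f (g x) = x"
  shows "distr lborel borel f = lborel"
proof (rule lborel_eqI[symmetric])
  have gf: "g (f x) = x" for x
    using iso[of "g (f x)" x] fg[of "f x"] by simp
  have isog: "dist (g x) (g y) = dist x y" for x y
    using iso[of "g x" "g y"] by (simp add: fg)
  have contf: "continuous_on UNIV f"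
    unfolding continuous_on_iff using iso by auto
  have [measurable]: "f \<in> borel_measurable borel"
    by (rule borel_measurable_continuous_onI[OF contf])
  have vim: "f -` S = g ` S" for S
  proof
    show "f -` S \<subseteq> g ` S" using gf by (metis image_eqI subsetI vimageD)
    show "g ` S \<subseteq> f -` S" using fg by auto
  qed
  have vball: "f -` ball x r = ball (g x) r" for x r
    using isog iso fg by (auto simp: vimage_def) (metis isog gf fg iso)+
  have opens: "emeasure lborel (f -` S) = emeasure lborel S" if S: "open S" for S
  proof -
    define K where "K = {p::'a \<times> real. 0 < snd p \<and> ball (fst p) (snd p) \<subseteq> S}"
    have K: "\<exists>i. i \<in> K \<and> x \<in> ball (fst i) (snd i) \<and> snd i < d" if "x \<in> S" "0 < d" for x d
    proof -
      obtain e where e: "e > 0" "ball x e \<subseteq> S" using S \<open>x \<in> S\<close> by (meson open_contains_ball)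
      have "ball x (min e (d/2)) \<subseteq> S" using e by auto
      then show ?thesis using e \<open>0 < d\<close>
        by (intro exI[of _ "(x, min e (d/2))"]) (auto simp: K_def)
    qed
    obtain C where C: "countable C" "C \<subseteq> K"
      and pw: "pairwise (\<lambda>i j. disjnt (ball (fst i) (snd i)) (ball (fst j) (snd j))) C"
      and neg: "negligible (S - (\<Union>i\<in>C. ball (fst i) (snd i)))"
      by (rule Vitali_covering_theorem_balls[of S K fst snd, OF K])
    define B where "B i = ball (fst i) (snd i)" for i :: "'a \<times> real"
    define U where "U = (\<Union>i\<in>C. B i)"
    have US: "U \<subseteq> S" using C(2) unfolding U_def B_def K_def by auto
    have Uo: "open U" unfolding U_def B_def by auto
    have disj1: "disjoint_family_on B C"
      using pw unfolding disjoint_family_on_def pairwise_def B_def disjnt_def by blast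
    then have "disjoint_family_on (\<lambda>i. f -` B i) C"
      unfolding disjoint_family_on_def by blast
    note disj = disj1 this
    have Bo: "open (B i)" for i by (simp add: B_def)
    have emB: "emeasure lborel (f -` B i) = emeasure lborel (B i)" if "i \<in> C" for i
      using that C(2) unfolding B_def vball K_def by (auto simp: emeasure_ball)
    have openf: "open (f -` V)" if "open V" for V
      using contf that by (simp add: open_vimage)
    have "emeasure lborel (f -` U) = emeasure lborel (\<Union>i\<in>C. f -` B i)"
      unfolding U_def by (simp add: vimage_UN)
    also have "\<dots> = (\<integral>\<^sup>+i. emeasure lborel (f -` B i) \<partial>count_space C)"
      by (rule emeasure_UN_countable) (use C(1) disj openf Bo in auto)
    also have "\<dots> = (\<integral>\<^sup>+i. emeasure lborel (B i) \<partial>count_space C)"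
      by (rule nn_integral_cong) (simp add: emB)
    also have "\<dots> = emeasure lborel U"
      unfolding U_def by (rule emeasure_UN_countable[symmetric]) (use C(1) disj Bo in auto)
    finally have eqU: "emeasure lborel (f -` U) = emeasure lborel U" .
    have negU: "negligible (S - U)" using neg unfolding U_def B_def .
    have "negligible (g ` (S - U))"
    proof (rule negligible_locally_Lipschitz_image[OF _ negU])
      fix x assume "x \<in> S - U"
      show "\<exists>T B. open T \<and> x \<in> T \<and> (\<forall>y\<in>(S - U) \<inter> T. norm (g y - g x) \<le> B * norm (y - x))"
        using isog by (intro exI[of _ UNIV] exI[of _ 1]) (auto simp: dist_norm)
    qed simp
    then have negf: "negligible (f -` (S - U))" by (simp add: vim)
    have borS: "S - U \<in> sets borel" "f -` (S - U) \<in> sets borel"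
      using S Uo openf[OF S] openf[OF Uo] by (auto simp: vimage_Diff)
    have z: "emeasure lborel (S - U) = 0" "emeasure lborel (f -` (S - U)) = 0"
      using negU negf borS by (auto simp: negligible_iff_emeasure0 )
    have "emeasure lborel S = emeasure lborel U + emeasure lborel (S - U)"
      using US S Uo by (subst plus_emeasure) (auto simp: Un_absorb1)
    moreover have "emeasure lborel (f -` S) = emeasure lborel (f -` U) + emeasure lborel (f -` (S - U))"
      using US borS openf[OF S] openf[OF Uo] by (subst plus_emeasure) (auto intro!: arg_cong[where f="emeasure lborel"])
    ultimately show ?thesis using z eqU by simp
  qed
  show "emeasure (distr lborel borel f) (box l u) = (\<Prod>b\<in>Basis. (u - l) \<bullet> b)"
    if "\<And>b. b \<in> Basis \<Longrightarrow> l \<bullet> b \<le> u \<bullet> b" for l u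
    using that by (simp add: emeasure_distr opens[OF open_box] emeasure_lborel_box)
qed simp

lemma norm_vector_scalar_mult: "norm (c *s v) = norm c * norm (v :: complex ^ 'n)"
  unfolding norm_vec_def by (simp add: L2_set_def norm_mult power_mult_distrib real_sqrt_mult flip: sum_distrib_left)

lemma bounded_bilinear_vector_scalar_mult: "bounded_bilinear ((*s) :: complex \<Rightarrow> complex ^ 'n \<Rightarrow> _)"
proof
  show "\<exists>K. \<forall>a b. norm (a *s (b :: complex ^ 'n)) \<le> norm a * norm b * K"
    by (intro exI[of _ 1]) (simp add: norm_vector_scalar_mult)
qed (simp_all add: vec_eq_iff algebra_simps)

lemmas has_derivative_vector_scalar_mult [derivative_intros] =
  bounded_bilinear.FDERIV[OF bounded_bilinear_vector_scalar_mult]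
lemmas continuous_on_vector_scalar_mult [continuous_intros] =
  bounded_bilinear.continuous_on[OF bounded_bilinear_vector_scalar_mult]

text \<open>This rotation, the same in all coordinates, is the only change of variables besides
  translation on which the mean value property rests.\<close>

lemma integral_unit_multiple:
  fixes f :: "complex ^ 'n \<Rightarrow> complex"
  assumes c: "norm c = 1" and f: "f \<in> borel_measurable borel"
  shows "(LINT v|lborel. f (c *s v)) = (LINT v|lborel. f v)"
proof -
  have c0: "c \<noteq> 0" using c by auto
  have d: "distr lborel borel (\<lambda>v :: complex ^ 'n. c *s v) = lborel"
  proof (rule distr_lborel_isometry[where g="\<lambda>v. inverse c *s v"])
    show "dist (c *s x) (c *s y) = dist x y" for x y :: "complex ^ 'n"
      using c norm_vector_scalar_mult[of c "x - y"] by (simp add: dist_norm vector_ssub_ldistrib)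
  qed (use c0 in \<open>simp add: vec_eq_iff\<close>)
  have m: "(\<lambda>v :: complex ^ 'n. c *s v) \<in> borel_measurable borel"
    by (intro borel_measurable_continuous_onI continuous_intros)
  have "(LINT v|lborel. f v) = (LINT v|distr lborel borel (\<lambda>v. c *s v). f v)"
    by (simp add: d)
  also have "\<dots> = (LINT v|lborel. f (c *s v))"
    by (rule integral_distr) (use m f in auto)
  finally show ?thesis by simp
qed

lemma scv_holomorphic_imp_continuous:
  "scv_holomorphic_on f \<Omega> \<Longrightarrow> continuous_on \<Omega> f"
  unfolding scv_holomorphic_on_def
  by (meson continuous_at_imp_continuous_on has_derivative_continuous)

lemma scv_slice:
  assumes "scv_holomorphic_on f \<Omega>" and z: "p + z *s v \<in> \<Omega>"
  shows "(\<lambda>\<zeta>. f (p + \<zeta> *s v)) field_differentiable (at z)"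
proof -
  obtain f' where f': "(f has_derivative f') (at (p + z *s v))" and lin: "\<forall>c v. f' (c *s v) = c * f' v"
    using assms unfolding scv_holomorphic_on_def by blast
  have "((\<lambda>\<zeta>. f (p + \<zeta> *s v)) has_derivative (\<lambda>t. f' (t *s v))) (at z)"
    by (rule has_derivative_compose[where f="\<lambda>\<zeta>. p + \<zeta> *s v" and g=f, OF _ f'])
       (auto intro!: derivative_eq_intros)
  then show ?thesis
    unfolding field_differentiable_def has_field_derivative_def using lin
    by (intro exI[of _ "f' v"]) (auto simp: mult.commute elim!: has_derivative_eq_rhs)
qed

lemma scv_slice_holomorphic:
  assumes "scv_holomorphic_on f \<Omega>" and "\<And>z. z \<in> A \<Longrightarrow> p + z *s v \<in> \<Omega>"
  shows "(\<lambda>\<zeta>. f (p + \<zeta> *s v)) holomorphic_on A"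
  using assms scv_slice field_differentiable_at_within unfolding holomorphic_on_def by blast

lemma circle_mean_value:
  assumes "g holomorphic_on cball 0 1"
  shows "(LINT x|lborel. indicator {0..1} x *\<^sub>R g (exp (2 * of_real pi * \<i> * of_real x))) = g 0"
proof -
  let ?h = "\<lambda>x::real. g (exp (2 * of_real pi * \<i> * of_real x))"
  have "((\<lambda>u. g u / (u - 0)) has_contour_integral (2 * of_real pi * \<i> * g 0)) (circlepath 0 1)"
    by (rule Cauchy_integral_circlepath_simple) (use assms in auto)
  then have "((\<lambda>x. 2 * of_real pi * \<i> * ?h x) has_integral 2 * of_real pi * \<i> * g 0) {0..1}"
    unfolding has_contour_integral_def
  proof (rule has_integral_eq[rotated])
    fix x :: real assume "x \<in> {0..1}"
    then show "g (circlepath 0 1 x) / (circlepath 0 1 x - 0)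
        * vector_derivative (circlepath 0 1) (at x within {0..1}) = 2 * of_real pi * \<i> * ?h x"
      by (subst vector_derivative_circlepath01) (auto simp: circlepath)
  qed
  from has_integral_mult_right[OF this, of "inverse (2 * of_real pi * \<i>)"]
  have hi: "(?h has_integral g 0) {0..1}" by (simp add: field_simps)
  have cont: "continuous_on {0..1} ?h"
    by (rule continuous_on_compose2[OF holomorphic_on_imp_continuous_on[OF assms]])
       (auto intro!: continuous_intros)
  have "integrable lborel (\<lambda>x. indicator {0..1} x *\<^sub>R ?h x)"
    by (rule borel_integrable_compact) (use cont in auto)
  from has_integral_integral_lborel[OF this]
  have "((\<lambda>x. if x \<in> {0..1} then ?h x else 0) has_integral
      (LINT x|lborel. indicator {0..1} x *\<^sub>R ?h x)) UNIV"
    by (rule has_integral_eq[rotated]) (simp add: indicator_def)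
  then have "(?h has_integral (LINT x|lborel. indicator {0..1} x *\<^sub>R ?h x)) {0..1}"
    by (simp only: has_integral_restrict_UNIV)
  with hi show ?thesis by (meson has_integral_unique)
qed

text \<open>The set \<open>T\<close> and Lebesgue measure are invariant under \<open>v \<mapsto> e\<^sup>i\<^sup>\<theta> v\<close>, so the integral
  does not change when \<open>v\<close> is replaced by \<open>e\<^sup>i\<^sup>\<theta> v\<close> and the result averaged over \<open>\<theta>\<close>. After
  exchanging the integrals, the inner one is a circular mean of a function of one variable on
  the complex line through \<open>p\<close> in direction \<open>v\<close>, that is, its value at the centre.\<close>

lemma mean_value_balanced:
  fixes f :: "complex ^ 'n \<Rightarrow> complex"
  assumes hol: "scv_holomorphic_on f \<Omega>" and T: "compact T"
    and bal: "\<And>v \<zeta>. v \<in> T \<Longrightarrow> norm \<zeta> \<le> 1 \<Longrightarrow> \<zeta> *s v \<in> T"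
    and sub: "\<And>v. v \<in> T \<Longrightarrow> p + v \<in> \<Omega>"
  shows "(LINT v|lborel. indicator T v *\<^sub>R f (p + v)) = measure lborel T *\<^sub>R f p"
proof -
  define e where "e x = exp (2 * of_real pi * \<i> * of_real x)" for x :: real
  have ne: "norm (e x) = 1" for x by (simp add: e_def norm_exp_eq_Re)
  have conte: "continuous_on A e" for A unfolding e_def by (intro continuous_intros)
  have contf: "continuous_on T (\<lambda>v. f (p + v))"
    by (rule continuous_on_compose2[OF scv_holomorphic_imp_continuous[OF hol]])
       (use sub in \<open>auto intro!: continuous_intros\<close>)
  define F where "F = (\<lambda>(x::real, v). indicator ({0..1} \<times> T) (x, v) *\<^sub>R f (p + e x *s v))"
  have "integrable lborel F"
    unfolding F_def split_def prod.collapse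
  proof (rule borel_integrable_compact)
    show "compact ({0..1::real} \<times> T)" using T by (intro compact_Times) auto
    show "continuous_on ({0..1} \<times> T) (\<lambda>y. f (p + e (fst y) *s snd y))"
      by (rule continuous_on_compose2[OF scv_holomorphic_imp_continuous[OF hol]])
         (use sub bal ne in \<open>auto intro!: continuous_intros continuous_on_compose2[OF conte]\<close>)
  qed
  then have intF: "integrable (lborel \<Otimes>\<^sub>M lborel) F" by (simp add: lborel_prod)
  define I where "I = (LINT v|lborel. indicator T v *\<^sub>R f (p + v))"
  have bm: "(\<lambda>v. indicator T v *\<^sub>R f (p + v)) \<in> borel_measurable borel"
    using borel_integrable_compact[OF T contf] by (simp add: borel_measurable_integrable)
  have indT: "indicator T (e x *s v) = (indicator T v :: real)" for x v
  proof -
    have "inverse (e x) *s (e x *s v) = v" by (simp add: e_def vector_smult_assoc)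
    then have "e x *s v \<in> T \<longleftrightarrow> v \<in> T"
      using bal[of "e x *s v" "inverse (e x)"] bal[of v "e x"] by (auto simp: norm_inverse ne)
    then show ?thesis by (simp add: indicator_def)
  qed
  have 1: "(LINT v|lborel. F (x, v)) = indicator {0..1} x *\<^sub>R I" for x
  proof -
    have "I = (LINT v|lborel. indicator T (e x *s v) *\<^sub>R f (p + e x *s v))"
      unfolding I_def by (rule integral_unit_multiple[OF ne bm, symmetric])
    moreover have "F (x, v) = indicator {0..1} x *\<^sub>R (indicator T (e x *s v) *\<^sub>R f (p + e x *s v))" for v
      unfolding F_def indT by (simp add: indicator_times)
    ultimately show ?thesis by (simp del: scaleR_scaleR)
  qed
  have 2: "(LINT x|lborel. F (x, v)) = indicator T v *\<^sub>R f p" for v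
  proof (cases "v \<in> T")
    case True
    have "(LINT x|lborel. indicator {0..1} x *\<^sub>R f (p + e x *s v)) = f (p + 0 *s v)"
      unfolding e_def
      by (rule circle_mean_value, rule scv_slice_holomorphic[OF hol]) (use True bal sub in auto)
    with True show ?thesis by (simp add: F_def indicator_def cong: if_cong)
  qed (simp add: F_def)
  have "I = (LINT x|lborel. (indicator {0..1} (x::real) :: real) *\<^sub>R I)"
    by (subst integral_scaleR_left) (auto intro!: integrable_real_indicator)
  also have "\<dots> = (LINT x|lborel. LINT v|lborel. F (x, v))" by (simp add: 1)
  also have "\<dots> = (LINT v|lborel. LINT x|lborel. F (x, v))"
    using lborel_pair.Fubini_integral[of "\<lambda>x y. F (x, y)"] intF by (simp add: split_def)
  also have "\<dots> = (LINT v|lborel. (indicator T v :: real) *\<^sub>R f p)" by (simp add: 2)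
  also have "\<dots> = measure lborel T *\<^sub>R f p"
    using emeasure_compact_finite[OF T]
    by (subst integral_scaleR_left) (simp_all add: compact_imp_closed T)
  finally show ?thesis by (simp add: I_def)
qed

lemma lebesgue_integrable_compact:
  fixes f :: "'a::euclidean_space \<Rightarrow> 'b::{banach, second_countable_topology}"
  assumes "compact S" "continuous_on S f"
  shows "integrable (lebesgue_on S) f"
    and "(LINT x|lebesgue_on S. f x) = (LINT x|lborel. indicator S x *\<^sub>R f x)"
proof -
  have S: "S \<inter> space lebesgue \<in> sets lebesgue" using assms(1) by (auto simp: compact_imp_closed)
  have i: "integrable lborel (\<lambda>x. indicator S x *\<^sub>R f x)" by (rule borel_integrable_compact[OF assms])
  then show "integrable (lebesgue_on S) f"
    unfolding integrable_restrict_space[OF S] by (simp add: integrable_completion)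
  show "(LINT x|lebesgue_on S. f x) = (LINT x|lborel. indicator S x *\<^sub>R f x)"
    unfolding integral_restrict_space[OF S] using i by (intro integral_completion) auto
qed

lemma integral_compact_translation:
  fixes f :: "'a::euclidean_space \<Rightarrow> 'b::{banach, second_countable_topology}"
  assumes "compact T" "continuous_on ((+) p ` T) f"
  shows "(LINT x|lebesgue_on ((+) p ` T). f x) = (LINT v|lborel. indicator T v *\<^sub>R f (p + v))"
proof -
  have c: "compact ((+) p ` T)" using assms(1) by (simp add: compact_translation)
  have "(LINT x|lebesgue_on ((+) p ` T). f x) = (LINT x|lborel. indicator ((+) p ` T) x *\<^sub>R f x)"
    by (rule lebesgue_integrable_compact(2)[OF c assms(2)])
  also have "\<dots> = (LINT x|distr lborel borel ((+) p). indicator ((+) p ` T) x *\<^sub>R f x)"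
    by (simp add: lborel_distr_plus)
  also have "\<dots> = (LINT v|lborel. indicator ((+) p ` T) (p + v) *\<^sub>R f (p + v))"
    by (rule integral_distr) (use borel_integrable_compact[OF c assms(2)] in auto)
  also have "\<dots> = (LINT v|lborel. indicator T v *\<^sub>R f (p + v))"
    by (simp add: indicator_def image_iff cong: if_cong)
  finally show ?thesis .
qed

lemma mean_value_translate:
  fixes f :: "complex ^ 'n \<Rightarrow> complex"
  assumes hol: "scv_holomorphic_on f \<Omega>" and T: "compact T"
    and bal: "\<And>v \<zeta>. v \<in> T \<Longrightarrow> norm \<zeta> \<le> 1 \<Longrightarrow> \<zeta> *s v \<in> T"
    and sub: "(+) p ` T \<subseteq> \<Omega>"
  shows "(LINT w|lebesgue_on ((+) p ` T). f w) = measure lebesgue T *\<^sub>R f p"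
proof -
  have "(LINT w|lebesgue_on ((+) p ` T). f w) = (LINT v|lborel. indicator T v *\<^sub>R f (p + v))"
    using scv_holomorphic_imp_continuous[OF hol] sub
    by (intro integral_compact_translation[OF T]) (rule continuous_on_subset)
  also have "\<dots> = measure lborel T *\<^sub>R f p"
    by (rule mean_value_balanced[OF hol T bal]) (use sub in auto)
  also have "measure lborel T = measure lebesgue T"
    using T by (simp add: compact_imp_closed)
  finally show ?thesis .
qed

lemma integral_lebesgue_on_subset_le:
  fixes u :: "'a::euclidean_space \<Rightarrow> real"
  assumes "compact S" "S \<subseteq> \<Omega>" "\<Omega> \<in> sets lebesgue" "integrable (lebesgue_on \<Omega>) u" "\<And>x. 0 \<le> u x"
  shows "(LINT x|lebesgue_on S. u x) \<le> (LINT x|lebesgue_on \<Omega>. u x)"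
proof -
  have S: "S \<inter> space lebesgue \<in> sets lebesgue" using assms(1) by (auto simp: compact_imp_closed)
  have O: "\<Omega> \<inter> space lebesgue \<in> sets lebesgue" using assms by auto
  have i: "integrable lebesgue (\<lambda>x. indicator \<Omega> x *\<^sub>R u x)"
    using assms(4) unfolding integrable_restrict_space[OF O] .
  show ?thesis
    unfolding integral_restrict_space[OF S] integral_restrict_space[OF O]
    by (rule integral_mono'[OF i]) (use assms in \<open>auto simp: indicator_def\<close>)
qed

section \<open>The \<open>L\<^sup>2\<close> pairing\<close>

lemma L2_measurable: "f \<in> L2_space \<Omega> \<Longrightarrow> f \<in> borel_measurable (lebesgue_on \<Omega>)"
  by (simp add: L2_space_def)

lemma L2_integrable: "f \<in> L2_space \<Omega> \<Longrightarrow> integrable (lebesgue_on \<Omega>) (\<lambda>w. (norm (f w))\<^sup>2)"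
  by (simp add: L2_space_def)

lemma L2_pairing_integrable:
  assumes "f \<in> L2_space \<Omega>" "g \<in> L2_space \<Omega>"
  shows "integrable (lebesgue_on \<Omega>) (\<lambda>w. f w * cnj (g w))"
proof (rule Bochner_Integration.integrable_bound)
  show "integrable (lebesgue_on \<Omega>) (\<lambda>w. (norm (f w))\<^sup>2 + (norm (g w))\<^sup>2)"
    using assms by (simp add: L2_integrable)
  have [measurable]: "f \<in> borel_measurable (lebesgue_on \<Omega>)" "g \<in> borel_measurable (lebesgue_on \<Omega>)"
    using assms by (simp_all add: L2_measurable)
  have "cnj \<in> borel_measurable borel" by (intro borel_measurable_continuous_onI continuous_intros)
  then have [measurable]: "(\<lambda>w. cnj (g w)) \<in> borel_measurable (lebesgue_on \<Omega>)" by measurable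
  show "(\<lambda>w. f w * cnj (g w)) \<in> borel_measurable (lebesgue_on \<Omega>)" by measurable
  show "AE w in lebesgue_on \<Omega>. norm (f w * cnj (g w)) \<le> norm ((norm (f w))\<^sup>2 + (norm (g w))\<^sup>2)"
  proof (rule AE_I2)
    fix w
    have "2 * (norm (f w) * norm (g w)) \<le> (norm (f w))\<^sup>2 + (norm (g w))\<^sup>2"
      using sum_squares_bound[of "norm (f w)" "norm (g w)"] by (simp add: mult.assoc)
    moreover have "0 \<le> norm (f w) * norm (g w)" by simp
    ultimately have "norm (f w) * norm (g w) \<le> (norm (f w))\<^sup>2 + (norm (g w))\<^sup>2" by linarith
    then show "norm (f w * cnj (g w)) \<le> norm ((norm (f w))\<^sup>2 + (norm (g w))\<^sup>2)"
      by (simp add: norm_mult)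
  qed
qed

lemma L2_bounded_mult:
  assumes f: "f \<in> L2_space \<Omega>" and m: "\<psi> \<in> borel_measurable (lebesgue_on \<Omega>)"
    and b: "\<And>w. w \<in> \<Omega> \<Longrightarrow> norm (\<psi> w) \<le> B"
  shows "(\<lambda>w. \<psi> w * f w) \<in> L2_space \<Omega>"
  unfolding L2_space_def
proof (intro CollectI conjI)
  have [measurable]: "f \<in> borel_measurable (lebesgue_on \<Omega>)" using f by (rule L2_measurable)
  note m[measurable]
  show "(\<lambda>w. \<psi> w * f w) \<in> borel_measurable (lebesgue_on \<Omega>)" by measurable
  show "integrable (lebesgue_on \<Omega>) (\<lambda>w. (norm (\<psi> w * f w))\<^sup>2)"
  proof (rule Bochner_Integration.integrable_bound)
    show "integrable (lebesgue_on \<Omega>) (\<lambda>w. B\<^sup>2 * (norm (f w))\<^sup>2)" using f by (simp add: L2_integrable)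
    show "AE w in lebesgue_on \<Omega>. norm ((norm (\<psi> w * f w))\<^sup>2) \<le> norm (B\<^sup>2 * (norm (f w))\<^sup>2)"
    proof (rule AE_I2)
      fix w assume "w \<in> space (lebesgue_on \<Omega>)"
      then have "norm (\<psi> w) \<le> B" using b by simp
      then show "norm ((norm (\<psi> w * f w))\<^sup>2) \<le> norm (B\<^sup>2 * (norm (f w))\<^sup>2)"
        by (simp add: norm_mult power_mult_distrib mult_right_mono power_mono)
    qed
  qed measurable
qed

lemma L2_scale: "f \<in> L2_space \<Omega> \<Longrightarrow> (\<lambda>w. c * f w) \<in> L2_space \<Omega>"
  by (rule L2_bounded_mult[where B="norm c"]) auto

lemma L2_add:
  assumes "f \<in> L2_space \<Omega>" "g \<in> L2_space \<Omega>"
  shows "(\<lambda>w. f w + g w) \<in> L2_space \<Omega>"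
  unfolding L2_space_def
proof (intro CollectI conjI)
  have [measurable]: "f \<in> borel_measurable (lebesgue_on \<Omega>)" "g \<in> borel_measurable (lebesgue_on \<Omega>)"
    using assms by (simp_all add: L2_measurable)
  show "(\<lambda>w. f w + g w) \<in> borel_measurable (lebesgue_on \<Omega>)" by measurable
  show "integrable (lebesgue_on \<Omega>) (\<lambda>w. (norm (f w + g w))\<^sup>2)"
  proof (rule Bochner_Integration.integrable_bound)
    show "integrable (lebesgue_on \<Omega>) (\<lambda>w. 2 * (norm (f w))\<^sup>2 + 2 * (norm (g w))\<^sup>2)"
      using assms by (simp add: L2_integrable)
    show "AE w in lebesgue_on \<Omega>. norm ((norm (f w + g w))\<^sup>2) \<le> norm (2 * (norm (f w))\<^sup>2 + 2 * (norm (g w))\<^sup>2)"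
    proof (rule AE_I2)
      fix w
      have "(norm (f w + g w))\<^sup>2 \<le> (norm (f w) + norm (g w))\<^sup>2"
        by (simp add: norm_triangle_ineq power_mono)
      also have "\<dots> \<le> 2 * (norm (f w))\<^sup>2 + 2 * (norm (g w))\<^sup>2"
        using sum_squares_bound[of "norm (f w)" "norm (g w)"] by (simp add: power2_sum)
      finally show "norm ((norm (f w + g w))\<^sup>2) \<le> norm (2 * (norm (f w))\<^sup>2 + 2 * (norm (g w))\<^sup>2)" by simp
    qed
  qed measurable
qed

lemma L2_diff:
  assumes "f \<in> L2_space \<Omega>" "g \<in> L2_space \<Omega>"
  shows "(\<lambda>w. f w - g w) \<in> L2_space \<Omega>"
  using L2_add[OF assms(1) L2_scale[OF assms(2), of "-1"]] by simp

lemma L2_inner_add_left: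
  "\<lbrakk>f \<in> L2_space \<Omega>; g \<in> L2_space \<Omega>; h \<in> L2_space \<Omega>\<rbrakk>
    \<Longrightarrow> L2_inner \<Omega> (\<lambda>w. f w + g w) h = L2_inner \<Omega> f h + L2_inner \<Omega> g h"
  unfolding L2_inner_def by (simp add: distrib_right L2_pairing_integrable)

lemma L2_inner_diff_left:
  "\<lbrakk>f \<in> L2_space \<Omega>; g \<in> L2_space \<Omega>; h \<in> L2_space \<Omega>\<rbrakk>
    \<Longrightarrow> L2_inner \<Omega> (\<lambda>w. f w - g w) h = L2_inner \<Omega> f h - L2_inner \<Omega> g h"
  unfolding L2_inner_def by (simp add: left_diff_distrib L2_pairing_integrable)

lemma L2_inner_scale_left:
  "\<lbrakk>f \<in> L2_space \<Omega>; h \<in> L2_space \<Omega>\<rbrakk> \<Longrightarrow> L2_inner \<Omega> (\<lambda>w. c * f w) h = c * L2_inner \<Omega> f h"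
  unfolding L2_inner_def by (simp add: mult.assoc)

lemma L2_inner_commute: "L2_inner \<Omega> g f = cnj (L2_inner \<Omega> f g)"
proof -
  have "cnj (L2_inner \<Omega> f g) = (LINT w|lebesgue_on \<Omega>. cnj (f w * cnj (g w)))"
    unfolding L2_inner_def by (rule Bochner_Integration.integral_cnj[symmetric])
  then show ?thesis by (simp add: L2_inner_def mult.commute)
qed

lemma L2_norm_nonneg: "0 \<le> L2_norm \<Omega> f"
  by (simp add: L2_norm_def)

lemma L2_norm_square: "(L2_norm \<Omega> f)\<^sup>2 = (LINT w|lebesgue_on \<Omega>. (norm (f w))\<^sup>2)"
  by (simp add: L2_norm_def)

lemma L2_inner_self: "L2_inner \<Omega> f f = of_real ((L2_norm \<Omega> f)\<^sup>2)"
  unfolding L2_inner_def L2_norm_square complex_norm_square[symmetric]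
  by (rule integral_complex_of_real)

lemma L2_norm_scale: "L2_norm \<Omega> (\<lambda>w. c * f w) = norm c * L2_norm \<Omega> f"
  by (simp add: L2_norm_def norm_mult power_mult_distrib real_sqrt_mult)

lemma L2_norm_add_square:
  assumes f: "f \<in> L2_space \<Omega>" and g: "g \<in> L2_space \<Omega>"
  shows "(L2_norm \<Omega> (\<lambda>w. f w + g w))\<^sup>2 = (L2_norm \<Omega> f)\<^sup>2 + 2 * Re (L2_inner \<Omega> f g) + (L2_norm \<Omega> g)\<^sup>2"
proof -
  have "(norm (f w + g w))\<^sup>2 = (norm (f w))\<^sup>2 + 2 * Re (f w * cnj (g w)) + (norm (g w))\<^sup>2" for w
    by (simp add: cmod_power2 power2_sum algebra_simps)
  then have "(L2_norm \<Omega> (\<lambda>w. f w + g w))\<^sup>2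
      = (LINT w|lebesgue_on \<Omega>. (norm (f w))\<^sup>2 + 2 * Re (f w * cnj (g w)) + (norm (g w))\<^sup>2)"
    by (simp only: L2_norm_square)
  also have "\<dots> = (L2_norm \<Omega> f)\<^sup>2 + 2 * (LINT w|lebesgue_on \<Omega>. Re (f w * cnj (g w))) + (L2_norm \<Omega> g)\<^sup>2"
    using L2_integrable[OF f] L2_integrable[OF g] integrable_Re[OF L2_pairing_integrable[OF f g]]
    by (simp add: L2_norm_square del: times_complex.sel)
  also have "(LINT w|lebesgue_on \<Omega>. Re (f w * cnj (g w))) = Re (L2_inner \<Omega> f g)"
    unfolding L2_inner_def by (rule integral_Re[OF L2_pairing_integrable[OF f g]])
  finally show ?thesis .
qed

text \<open>The quadratic form \<open>(t, s) \<mapsto> \<parallel>t c f - s g\<parallel>\<^sup>2\<close> is nonnegative, where the factor \<open>c\<close>, of modulus at most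
  one, makes the pairing of \<open>c f\<close> and \<open>g\<close> real.\<close>

lemma L2_Cauchy_Schwarz:
  assumes f: "f \<in> L2_space \<Omega>" and g: "g \<in> L2_space \<Omega>"
  shows "norm (L2_inner \<Omega> f g) \<le> L2_norm \<Omega> f * L2_norm \<Omega> g"
proof -
  define c where "c = cnj (sgn (L2_inner \<Omega> f g))"
  define a where "a = L2_norm \<Omega> f"
  define b where "b = L2_norm \<Omega> g"
  define r where "r = norm (L2_inner \<Omega> f g)"
  have ab: "0 \<le> a" "0 \<le> b" "0 \<le> r" by (simp_all add: a_def b_def r_def L2_norm_nonneg)
  have cr: "c * L2_inner \<Omega> f g = of_real r"
    unfolding c_def r_def by (cases "L2_inner \<Omega> f g = 0")
      (simp_all add: sgn_eq mult.commute[of "cnj _"] power2_eq_square flip: complex_norm_square)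
  have nc: "norm c \<le> 1" unfolding c_def by (simp add: norm_sgn)
  \<comment> \<open>Only \<open>norm c \<le> 1\<close> is at hand: \<open>c\<close> is zero when the pairing is zero.\<close>
  have key: "0 \<le> t\<^sup>2 * a\<^sup>2 - 2 * t * r * s + s\<^sup>2 * b\<^sup>2" for t s :: real
  proof -
    let ?F = "\<lambda>w. (of_real t * c) * f w" and ?G = "\<lambda>w. of_real (- s) * g w"
    have L: "?F \<in> L2_space \<Omega>" "?G \<in> L2_space \<Omega>" by (intro L2_scale f g)+
    have "L2_inner \<Omega> ?F ?G = of_real t * c * L2_inner \<Omega> f ?G"
      by (rule L2_inner_scale_left[OF f L(2)])
    also have "L2_inner \<Omega> f ?G = cnj (of_real (-s) * L2_inner \<Omega> g f)"
      by (subst L2_inner_commute) (simp only: L2_inner_scale_left[OF g f])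
    also have "\<dots> = of_real (-s) * L2_inner \<Omega> f g"
      using L2_inner_commute[of \<Omega> g f] by simp
    also have "of_real t * c * (of_real (-s) * L2_inner \<Omega> f g) = of_real (- t * s) * (c * L2_inner \<Omega> f g)"
      by simp
    finally have "Re (L2_inner \<Omega> ?F ?G) = - t * s * r" unfolding cr by simp
    then have "0 \<le> (norm (of_real t * c) * a)\<^sup>2 + 2 * (- t * s * r) + (s * b)\<^sup>2"
      using L2_norm_add_square[OF L] L2_norm_scale[of \<Omega> "of_real t * c" f]
        L2_norm_scale[of \<Omega> "of_real (-s)" g] zero_le_power2[of "L2_norm \<Omega> (\<lambda>w. ?F w + ?G w)"]
      by (simp add: a_def b_def power_mult_distrib)
    moreover have "(norm (of_real t * c) * a)\<^sup>2 \<le> t\<^sup>2 * a\<^sup>2"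
      using nc ab by (auto simp: norm_mult power_mult_distrib intro!: mult_right_mono mult_left_le power_le_one)
    ultimately show ?thesis by (simp add: power_mult_distrib algebra_simps)
  qed
  have "r \<le> a * b"
  proof (cases "a = 0 \<or> b = 0")
    case True
    have "r = 0"
    proof (rule ccontr)
      assume "r \<noteq> 0"
      then have "r > 0" using ab by simp
      from True show False
      proof
        assume "a = 0"
        then have "2 \<le> - b\<^sup>2" using key[of "(b\<^sup>2 + 1) / r" 1] \<open>r > 0\<close> by simp
        then show False using zero_le_power2[of b] by linarith
      next
        assume "b = 0"
        then have "2 \<le> - a\<^sup>2" using key[of 1 "(a\<^sup>2 + 1) / r"] \<open>r > 0\<close> by simp
        then show False using zero_le_power2[of a] by linarith
      qed
    qed
    then show ?thesis using ab by simp
  next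
    case False
    then have "a * b > 0" using ab by auto
    have "0 \<le> 2 * (a * b) * (a * b) - 2 * (a * b) * r"
      using key[of b a] by (simp add: power2_eq_square algebra_simps)
    then have "(a * b) * r \<le> (a * b) * (a * b)" by simp
    then show ?thesis using \<open>a * b > 0\<close> by (rule mult_left_le_imp_le)
  qed
  then show ?thesis by (simp add: a_def b_def r_def)
qed

section \<open>Holomorphic functions and the Bergman space\<close>

lemma scv_const: "scv_holomorphic_on (\<lambda>_. c) \<Omega>"
  unfolding scv_holomorphic_on_def by (auto intro!: exI[of _ "\<lambda>_. 0"])

lemma scv_add:
  assumes "scv_holomorphic_on f \<Omega>" "scv_holomorphic_on g \<Omega>"
  shows "scv_holomorphic_on (\<lambda>w. f w + g w) \<Omega>"
  unfolding scv_holomorphic_on_def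
proof
  fix z assume "z \<in> \<Omega>"
  with assms obtain f' g' where "(f has_derivative f') (at z)" "(g has_derivative g') (at z)"
    "\<forall>c v. f' (c *s v) = c * f' v" "\<forall>c v. g' (c *s v) = c * g' v"
    unfolding scv_holomorphic_on_def by blast
  then show "\<exists>D. ((\<lambda>w. f w + g w) has_derivative D) (at z) \<and> (\<forall>c v. D (c *s v) = c * D v)"
    by (intro exI[of _ "\<lambda>v. f' v + g' v"]) (auto intro!: derivative_eq_intros simp: algebra_simps)
qed

lemma scv_mult:
  assumes "scv_holomorphic_on f \<Omega>" "scv_holomorphic_on g \<Omega>"
  shows "scv_holomorphic_on (\<lambda>w. f w * g w) \<Omega>"
  unfolding scv_holomorphic_on_def
proof
  fix z assume "z \<in> \<Omega>"
  with assms obtain f' g' where "(f has_derivative f') (at z)" "(g has_derivative g') (at z)"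
    "\<forall>c v. f' (c *s v) = c * f' v" "\<forall>c v. g' (c *s v) = c * g' v"
    unfolding scv_holomorphic_on_def by blast
  then show "\<exists>D. ((\<lambda>w. f w * g w) has_derivative D) (at z) \<and> (\<forall>c v. D (c *s v) = c * D v)"
    by (intro exI[of _ "\<lambda>v. f z * g' v + f' v * g z"]) (auto intro!: derivative_eq_intros simp: algebra_simps)
qed

lemma scv_coordinate:
  fixes G :: "complex \<Rightarrow> complex" and \<Omega> :: "(complex ^ 'n) set"
  assumes "open U" "G holomorphic_on U" "\<And>w. w \<in> \<Omega> \<Longrightarrow> w $ i \<in> U"
  shows "scv_holomorphic_on (\<lambda>w :: complex ^ 'n. G (w $ i)) \<Omega>"
  unfolding scv_holomorphic_on_def
proof
  fix z :: "complex ^ 'n" assume "z \<in> \<Omega>"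
  then have "(G has_field_derivative deriv G (z $ i)) (at (z $ i))"
    using assms holomorphic_derivI by blast
  then have "(G has_derivative (*) (deriv G (z $ i))) (at (z $ i))"
    by (simp add: has_field_derivative_def)
  from has_derivative_compose[OF bounded_linear_imp_has_derivative[OF bounded_linear_vec_nth] this]
  show "\<exists>D. ((\<lambda>w. G (w $ i)) has_derivative D) (at z) \<and> (\<forall>c v. D (c *s v) = c * D v)"
    by (intro exI[of _ "\<lambda>v. deriv G (z $ i) * v $ i"]) auto
qed

lemma scv_cong:
  assumes "open \<Omega>" "scv_holomorphic_on f \<Omega>" "\<And>w. w \<in> \<Omega> \<Longrightarrow> f w = g w"
  shows "scv_holomorphic_on g \<Omega>"
  using assms unfolding scv_holomorphic_on_def
  by (metis has_derivative_transform_within_open)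

lemma scv_measurable:
  "open \<Omega> \<Longrightarrow> scv_holomorphic_on f \<Omega> \<Longrightarrow> f \<in> borel_measurable (lebesgue_on \<Omega>)"
  by (intro continuous_imp_measurable_on_sets_lebesgue scv_holomorphic_imp_continuous) auto

lemma bergman_L2: "f \<in> bergman_space \<Omega> \<Longrightarrow> f \<in> L2_space \<Omega>"
  by (simp add: bergman_space_def)

lemma bergman_holomorphic: "f \<in> bergman_space \<Omega> \<Longrightarrow> scv_holomorphic_on f \<Omega>"
  by (simp add: bergman_space_def)

lemma bergman_scale: "f \<in> bergman_space \<Omega> \<Longrightarrow> (\<lambda>w. c * f w) \<in> bergman_space \<Omega>"
  by (auto simp: bergman_space_def intro: L2_scale scv_mult scv_const)

lemma bergman_add:
  "f \<in> bergman_space \<Omega> \<Longrightarrow> g \<in> bergman_space \<Omega> \<Longrightarrow> (\<lambda>w. f w + g w) \<in> bergman_space \<Omega>"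
  by (auto simp: bergman_space_def intro: L2_add scv_add)

lemma bergman_diff:
  "f \<in> bergman_space \<Omega> \<Longrightarrow> g \<in> bergman_space \<Omega> \<Longrightarrow> (\<lambda>w. f w - g w) \<in> bergman_space \<Omega>"
  using bergman_add[of f \<Omega> "\<lambda>w. (-1) * g w"] bergman_scale[of g \<Omega> "-1"] by simp

lemma bergman_bounded_mult:
  assumes "open \<Omega>" "f \<in> bergman_space \<Omega>" "scv_holomorphic_on \<psi> \<Omega>" "\<And>w. w \<in> \<Omega> \<Longrightarrow> norm (\<psi> w) \<le> B"
  shows "(\<lambda>w. \<psi> w * f w) \<in> bergman_space \<Omega>"
  using assms by (auto simp: bergman_space_def intro: scv_mult L2_bounded_mult[OF _ scv_measurable])

section \<open>Pointwise bounds by the \<open>L\<^sup>2\<close> norm\<close>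

text \<open>The Cauchy--Schwarz inequality on \<open>S\<close> against the constant function 1.\<close>

lemma norm_integral_le_L2_norm:
  assumes F: "F \<in> L2_space \<Omega>" and \<Omega>: "open \<Omega>" and S: "compact S" "S \<subseteq> \<Omega>"
  shows "norm (LINT w|lebesgue_on S. F w) \<le> sqrt (measure lebesgue S) * L2_norm \<Omega> F"
proof -
  have Ss: "S \<in> sets lebesgue" using S by (simp add: compact_imp_closed)
  have \<Omega>s: "\<Omega> \<in> sets lebesgue" using \<Omega> by simp
  have mS: "F \<in> borel_measurable (lebesgue_on S)"
    using measurable_restrict_mono[OF L2_measurable[OF F] S(2)] .
  have "integrable (lebesgue_on S) (\<lambda>w. (norm (F w))\<^sup>2)"
  proof -
    have i: "integrable lebesgue (\<lambda>x. indicator \<Omega> x *\<^sub>R (norm (F x))\<^sup>2)"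
      using L2_integrable[OF F] \<Omega>s by (simp add: integrable_restrict_space)
    have "integrable lebesgue (\<lambda>x. indicator S x *\<^sub>R (indicator \<Omega> x *\<^sub>R (norm (F x))\<^sup>2))"
      by (rule integrable_mult_indicator[OF Ss i])
    moreover have "indicator S x *\<^sub>R (indicator \<Omega> x *\<^sub>R (norm (F x))\<^sup>2) = indicator S x *\<^sub>R (norm (F x))\<^sup>2" for x
      using S(2) by (auto simp: indicator_def)
    ultimately have "integrable lebesgue (\<lambda>x. indicator S x *\<^sub>R (norm (F x))\<^sup>2)" by (simp only:)
    then show ?thesis using Ss by (simp add: integrable_restrict_space)
  qed
  then have FS: "F \<in> L2_space S" using mS by (simp add: L2_space_def)
  have fin: "emeasure lebesgue S < \<infinity>" using emeasure_compact_finite[OF S(1)] S(1) by (simp add: borel_compact)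
  have "(\<lambda>_. 1) \<in> L2_space S"
    using finite_measure.integrable_const[OF finite_measure_lebesgue_on[OF lmeasurable_compact[OF S(1)]], of "1::real"]
    by (simp add: L2_space_def)
  from L2_Cauchy_Schwarz[OF FS this]
  have "norm (LINT w|lebesgue_on S. F w) \<le> L2_norm S F * L2_norm S (\<lambda>_. 1)"
    by (simp add: L2_inner_def)
  also have "L2_norm S (\<lambda>_. 1) = sqrt (measure lebesgue S)"
    using Ss by (simp add: L2_norm_def measure_restrict_space)
  also have "L2_norm S F \<le> L2_norm \<Omega> F"
    unfolding L2_norm_def
    by (intro real_sqrt_le_mono integral_lebesgue_on_subset_le[OF S \<Omega>s L2_integrable[OF F]]) simp
  finally show "norm (LINT w|lebesgue_on S. F w) \<le> sqrt (measure lebesgue S) * L2_norm \<Omega> F"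
    by (simp add: mult.commute mult_right_mono)
qed

text \<open>The value at \<open>p\<close> is a mean over the translate of \<open>T\<close>, and a mean is controlled by the
  \<open>L\<^sup>2\<close> norm. The set \<open>T\<close> is left free: balls give local bounds on arbitrary domains, while
  polydiscs with unequal radii give the sharp rate near a flat piece of the boundary.\<close>

lemma bergman_value_le:
  fixes f :: "complex ^ 'n \<Rightarrow> complex"
  assumes f: "f \<in> bergman_space \<Omega>" and \<Omega>: "open \<Omega>" and T: "compact T" "measure lebesgue T > 0"
    and bal: "\<And>v \<zeta>. v \<in> T \<Longrightarrow> norm \<zeta> \<le> 1 \<Longrightarrow> \<zeta> *s v \<in> T"
    and sub: "(+) p ` T \<subseteq> \<Omega>"
  shows "norm (f p) \<le> L2_norm \<Omega> f / sqrt (measure lebesgue T)"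
proof -
  define m where "m = measure lebesgue T"
  have m: "m > 0" using T by (simp add: m_def)
  have "norm (m *\<^sub>R f p) = norm (LINT w|lebesgue_on ((+) p ` T). f w)"
    using mean_value_translate[OF bergman_holomorphic[OF f] T(1) bal sub] by (simp add: m_def)
  also have "\<dots> \<le> sqrt (measure lebesgue ((+) p ` T)) * L2_norm \<Omega> f"
    by (rule norm_integral_le_L2_norm[OF bergman_L2[OF f] \<Omega> _ sub]) (simp add: T compact_translation)
  also have "measure lebesgue ((+) p ` T) = m"
    by (simp add: m_def measure_translation)
  finally have "sqrt m * (sqrt m * norm (f p)) \<le> sqrt m * L2_norm \<Omega> f"
    using m by (simp flip: mult.assoc)
  then have "sqrt m * norm (f p) \<le> L2_norm \<Omega> f" using m by simp
  then show ?thesis using m unfolding m_def[symmetric] by (simp add: field_simps)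
qed

lemma bergman_compact_bound:
  fixes \<Omega> :: "(complex ^ 'n) set"
  assumes \<Omega>: "open \<Omega>" and K: "compact K" "K \<subseteq> \<Omega>"
  obtains C where "C > 0" "\<And>f p. f \<in> bergman_space \<Omega> \<Longrightarrow> p \<in> K \<Longrightarrow> norm (f p) \<le> C * L2_norm \<Omega> f"
proof -
  obtain r where r: "r > 0" "(\<Union>x\<in>K. cball x r) \<subseteq> \<Omega>"
    using compact_subset_open_imp_cball_epsilon_subset[OF K(1) \<Omega> K(2)] by blast
  define T where "T = cball (0 :: complex ^ 'n) r"
  have mT: "measure lebesgue T > 0" using r by (simp add: T_def)
  show thesis
  proof (rule that[of "1 / sqrt (measure lebesgue T)"])
    fix f p assume f: "f \<in> bergman_space \<Omega>" and p: "p \<in> K"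
    have "(+) p ` T \<subseteq> \<Omega>" using r p by (auto simp: T_def dist_norm)
    moreover have "\<zeta> *s v \<in> T" if "v \<in> T" "norm \<zeta> \<le> 1" for v \<zeta>
      using that mult_mono[of "norm \<zeta>" 1 "norm v" r] by (simp add: T_def norm_vector_scalar_mult)
    ultimately show "norm (f p) \<le> 1 / sqrt (measure lebesgue T) * L2_norm \<Omega> f"
      using bergman_value_le[OF f \<Omega> _ mT, of p] by (simp add: T_def)
  qed (use mT in simp)
qed

lemma bergman_point_bound:
  fixes \<Omega> :: "(complex ^ 'n) set"
  assumes "open \<Omega>" "p \<in> \<Omega>"
  obtains C where "C > 0" "\<And>f. f \<in> bergman_space \<Omega> \<Longrightarrow> norm (f p) \<le> C * L2_norm \<Omega> f"
proof (rule bergman_compact_bound[OF assms(1), of "{p}"])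
  show "{p} \<subseteq> \<Omega>" using assms by simp
  fix C assume "C > 0" "\<And>f q. f \<in> bergman_space \<Omega> \<Longrightarrow> q \<in> {p} \<Longrightarrow> norm (f q) \<le> C * L2_norm \<Omega> f"
  then show thesis by (intro that[of C]) auto
qed simp

text \<open>Cauchy's inequality on the disc of radius \<open>r\<close> in the complex line through \<open>x\<close> in direction \<open>v\<close>.\<close>

lemma scv_derivative_bound:
  fixes f :: "complex ^ 'n \<Rightarrow> complex"
  assumes hol: "scv_holomorphic_on f \<Omega>" and d: "(f has_derivative f') (at x)"
    and lin: "\<And>c v. f' (c *s v) = c * f' v"
    and r: "r > 0" "cball x r \<subseteq> \<Omega>" and B: "\<And>y. y \<in> cball x r \<Longrightarrow> norm (f y) \<le> B"
  shows "norm (f' v) \<le> B / r * norm v"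
proof (cases "v = 0")
  case True
  then show ?thesis using lin[of 0 0] by simp
next
  case False
  define w where "w = of_real (r / norm v) *s v"
  define g where "g = (\<lambda>\<zeta>. f (x + \<zeta> *s w))"
  have nw: "norm w = r" using r False by (simp add: w_def norm_vector_scalar_mult norm_divide)
  have inb: "x + \<zeta> *s w \<in> cball x r" if "norm \<zeta> \<le> 1" for \<zeta>
    using that r mult_right_mono[of "norm \<zeta>" 1 r] by (simp add: dist_norm norm_vector_scalar_mult nw)
  have gh: "g holomorphic_on cball 0 1"
    unfolding g_def by (rule scv_slice_holomorphic[OF hol]) (use inb r in auto)
  have "(g has_derivative (\<lambda>t. f' (t *s w))) (at 0)"
    unfolding g_def
    by (rule has_derivative_compose[where f="\<lambda>\<zeta>. x + \<zeta> *s w" and g=f]) (use d in \<open>auto intro!: derivative_eq_intros\<close>)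
  then have "(g has_field_derivative f' w) (at 0)"
    by (simp add: has_field_derivative_def lin mult.commute[of _ "f' w"])
  then have dg: "deriv g 0 = f' w" by (rule DERIV_imp_deriv)
  have "norm ((deriv ^^ 1) g 0) \<le> fact 1 * B / 1 ^ 1"
  proof (rule Cauchy_inequality)
    show "g holomorphic_on ball 0 1" using gh by (rule holomorphic_on_subset) auto
    show "continuous_on (cball 0 1) g" using gh by (rule holomorphic_on_imp_continuous_on)
    show "norm (g y) \<le> B" if "norm (0 - y) = 1" for y
      unfolding g_def using inb[of y] B that by simp
  qed simp
  then have "norm (f' w) \<le> B" using dg by simp
  then have "r / norm v * norm (f' v) \<le> B" using r by (simp add: w_def lin norm_mult norm_divide)
  then show ?thesis using False r by (simp add: field_simps)
qed

section \<open>Completeness and representation of functionals\<close>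

text \<open>The pointwise bounds turn the Cauchy condition in norm into a uniform one near each point,
  and the derivative bounds make the derivatives uniformly Cauchy as well; differentiation
  then commutes with the limit, and complex linearity of the derivative is preserved.\<close>

lemma bergman_limit_holomorphic:
  fixes \<Omega> :: "(complex ^ 'n) set"
  assumes \<Omega>: "open \<Omega>" and f: "\<And>n. f n \<in> bergman_space \<Omega>"
    and cauchy: "\<And>e. e > 0 \<Longrightarrow> \<exists>N. \<forall>m\<ge>N. \<forall>n\<ge>N. L2_norm \<Omega> (\<lambda>w. f m w - f n w) < e"
    and lim: "\<And>w. w \<in> \<Omega> \<Longrightarrow> (\<lambda>n. f n w) \<longlonglongrightarrow> h w"
  shows "scv_holomorphic_on h \<Omega>"
  unfolding scv_holomorphic_on_def
proof
  fix p assume p: "p \<in> \<Omega>"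
  define D where "D n x = (SOME D. (f n has_derivative D) (at x) \<and> (\<forall>c v. D (c *s v) = c * D v))" for n x
  have "(f n has_derivative D n x) (at x) \<and> (\<forall>c v. D n x (c *s v) = c * D n x v)" if "x \<in> \<Omega>" for n x
  proof -
    have "\<exists>D. (f n has_derivative D) (at x) \<and> (\<forall>c v. D (c *s v) = c * D v)"
      using bergman_holomorphic[OF f[of n]] that by (simp add: scv_holomorphic_on_def)
    from someI_ex[OF this] show ?thesis unfolding D_def .
  qed
  then have D: "\<And>n x. x \<in> \<Omega> \<Longrightarrow> (f n has_derivative D n x) (at x)"
    and lin: "\<And>n x c v. x \<in> \<Omega> \<Longrightarrow> D n x (c *s v) = c * D n x v"
    by blast+
  obtain s where s: "s > 0" "cball p s \<subseteq> \<Omega>" using \<Omega> p by (meson open_contains_cball)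
  define r where "r = s / 2"
  have r: "r > 0" "r < s" "r + r = s" using s by (auto simp: r_def)
  obtain C where C: "C > 0" "\<And>f q. f \<in> bergman_space \<Omega> \<Longrightarrow> q \<in> cball p s \<Longrightarrow> norm (f q) \<le> C * L2_norm \<Omega> f"
    using bergman_compact_bound[OF \<Omega> compact_cball s(2)] by blast
  have inO: "x \<in> \<Omega>" if "x \<in> ball p r" for x using that s r by (auto simp: subset_iff)
  have db: "norm (D n x v - D m x v) \<le> C * L2_norm \<Omega> (\<lambda>w. f n w - f m w) / r * norm v"
    if x: "x \<in> ball p r" for n m x v
  proof -
    have cb: "cball x r \<subseteq> cball p s"
      using x r by (auto simp: cball_subset_cball_iff dist_commute)
    show ?thesis
    proof (rule scv_derivative_bound[where f="\<lambda>w. f n w - f m w" and \<Omega>=\<Omega> and f'="\<lambda>v. D n x v - D m x v" and x=x and r=r])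
      show "scv_holomorphic_on (\<lambda>w. f n w - f m w) \<Omega>"
        by (rule bergman_holomorphic[OF bergman_diff[OF f f]])
      show "((\<lambda>w. f n w - f m w) has_derivative (\<lambda>v. D n x v - D m x v)) (at x)"
        by (intro derivative_intros D inO x)
      show "cball x r \<subseteq> \<Omega>" using cb s by blast
      show "norm (f n y - f m y) \<le> C * L2_norm \<Omega> (\<lambda>w. f n w - f m w)" if "y \<in> cball x r" for y
        using C(2)[OF bergman_diff[OF f[of n] f[of m]], of y] cb that by blast
    qed (use r lin inO[OF x] in \<open>auto simp: right_diff_distrib\<close>)
  qed
  have unif: "\<exists>N. \<forall>m\<ge>N. \<forall>n\<ge>N. \<forall>x\<in>ball p r. \<forall>v. norm (D n x v - D m x v) \<le> e * norm v" if e: "e > 0" for e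
  proof -
    obtain N where N: "\<forall>m\<ge>N. \<forall>n\<ge>N. L2_norm \<Omega> (\<lambda>w. f m w - f n w) < e * r / C"
      using cauchy[of "e * r / C"] e r C by auto
    have "norm (D n x v - D m x v) \<le> e * norm v" if "m \<ge> N" "n \<ge> N" "x \<in> ball p r" for m n x v
    proof -
      have "C * L2_norm \<Omega> (\<lambda>w. f n w - f m w) / r \<le> e"
        using N that C r by (simp add: field_simps less_imp_le)
      then show ?thesis using db[OF that(3), of n v m] by (meson mult_right_mono norm_ge_zero order_trans)
    qed
    then show ?thesis by blast
  qed
  have cD: "convergent (\<lambda>n. D n x v)" if "x \<in> ball p r" for x v
  proof (rule Cauchy_convergent, rule CauchyI)
    fix e :: real assume e: "e > 0"
    have nv: "0 < norm v + 1" by (simp add: add_nonneg_pos)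
    then have "0 < e / (norm v + 1)" using e by simp
    from unif[OF this] obtain N where N: "\<forall>m\<ge>N. \<forall>n\<ge>N. \<forall>x\<in>ball p r. \<forall>u. norm (D n x u - D m x u) \<le> e / (norm v + 1) * norm u" by blast
    have "e / (norm v + 1) * norm v < e" using e nv by (simp add: field_simps)
    then have "norm (D m x v - D n x v) < e" if "m \<ge> N" "n \<ge> N" for m n
      using N[rule_format, OF that(2,1) \<open>x \<in> ball p r\<close>, of v] by (rule order_le_less_trans[rotated])
    then show "\<exists>M. \<forall>m\<ge>M. \<forall>n\<ge>M. norm (D m x v - D n x v) < e" by blast
  qed
  define D' where "D' x v = lim (\<lambda>n. D n x v)" for x v
  have limD: "(\<lambda>n. D n x v) \<longlonglongrightarrow> D' x v" if "x \<in> ball p r" for x v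
    using cD[OF that] unfolding D'_def by (simp add: convergent_LIMSEQ_iff)
  have "\<exists>g. \<forall>x\<in>ball p r. (\<lambda>n. f n x) \<longlonglongrightarrow> g x \<and> (g has_derivative D' x) (at x within ball p r)"
  proof (rule has_derivative_sequence)
    show "(f n has_derivative D n x) (at x within ball p r)" if "x \<in> ball p r" for n x
      using D[OF inO[OF that]] by (rule has_derivative_at_withinI)
    show "p \<in> ball p r" using r by simp
    show "(\<lambda>n. f n p) \<longlonglongrightarrow> h p" by (rule lim[OF p])
    show "\<forall>\<^sub>F n in sequentially. \<forall>x\<in>ball p r. \<forall>v. norm (D n x v - D' x v) \<le> e * norm v" if e: "e > 0" for e
    proof -
      obtain N where N: "\<forall>m\<ge>N. \<forall>n\<ge>N. \<forall>x\<in>ball p r. \<forall>v. norm (D n x v - D m x v) \<le> e * norm v"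
        using unif[OF e] by blast
      have "norm (D n x v - D' x v) \<le> e * norm v" if "n \<ge> N" "x \<in> ball p r" for n x v
      proof (rule LIMSEQ_le_const2)
        show "(\<lambda>m. norm (D n x v - D m x v)) \<longlonglongrightarrow> norm (D n x v - D' x v)"
          by (intro tendsto_intros limD that)
        show "\<exists>M. \<forall>m\<ge>M. norm (D n x v - D m x v) \<le> e * norm v" using N that by blast
      qed
      then show ?thesis unfolding eventually_sequentially by blast
    qed
  qed simp
  then obtain g where g: "\<And>x. x \<in> ball p r \<Longrightarrow> (\<lambda>n. f n x) \<longlonglongrightarrow> g x"
    "(g has_derivative D' p) (at p within ball p r)" using r by (metis centre_in_ball)
  have "(g has_derivative D' p) (at p)"
    using g(2) r by (simp add: at_within_open[of p "ball p r"])
  then have "(h has_derivative D' p) (at p)"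
  proof (rule has_derivative_transform_within_open)
    show "g x = h x" if "x \<in> ball p r" for x
      using g(1)[OF that] lim[OF inO[OF that]] by (rule LIMSEQ_unique)
  qed (use r in auto)
  moreover have "D' p (c *s v) = c * D' p v" for c v
  proof (rule LIMSEQ_unique)
    show "(\<lambda>n. D n p (c *s v)) \<longlonglongrightarrow> D' p (c *s v)" using r by (intro limD) simp
    show "(\<lambda>n. D n p (c *s v)) \<longlonglongrightarrow> c * D' p v"
      unfolding lin[OF p] using r by (intro tendsto_intros limD) simp
  qed
  ultimately show "\<exists>f'. (h has_derivative f') (at p) \<and> (\<forall>c v. f' (c *s v) = c * f' v)" by blast
qed

text \<open>The limit is the pointwise one. Fatou's lemma, applied with one index fixed, bounds the
  distance of a member of the sequence to the limit and shows the limit to be square integrable.\<close>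

lemma bergman_complete:
  fixes \<Omega> :: "(complex ^ 'n) set"
  assumes \<Omega>: "open \<Omega>" and f: "\<And>n. f n \<in> bergman_space \<Omega>"
    and cauchy: "\<And>e. e > 0 \<Longrightarrow> \<exists>N. \<forall>m\<ge>N. \<forall>n\<ge>N. L2_norm \<Omega> (\<lambda>w. f m w - f n w) < e"
  obtains h where "h \<in> bergman_space \<Omega>" "(\<lambda>n. L2_norm \<Omega> (\<lambda>w. f n w - h w)) \<longlonglongrightarrow> 0"
proof -
  have "convergent (\<lambda>n. f n w)" if w: "w \<in> \<Omega>" for w
  proof (rule Cauchy_convergent, rule CauchyI)
    fix e :: real assume e: "e > 0"
    obtain C where C: "C > 0" "\<And>f. f \<in> bergman_space \<Omega> \<Longrightarrow> norm (f w) \<le> C * L2_norm \<Omega> f"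
      by (rule bergman_point_bound[OF \<Omega> w]) blast
    obtain N where N: "\<forall>m\<ge>N. \<forall>n\<ge>N. L2_norm \<Omega> (\<lambda>w. f m w - f n w) < e / C"
      using cauchy[of "e / C"] e C by auto
    have "norm (f m w - f n w) < e" if "m \<ge> N" "n \<ge> N" for m n
    proof -
      have "C * L2_norm \<Omega> (\<lambda>w. f m w - f n w) < e" using N that C by (simp add: field_simps)
      then show ?thesis using C(2)[OF bergman_diff[OF f[of m] f[of n]]] by simp
    qed
    then show "\<exists>M. \<forall>m\<ge>M. \<forall>n\<ge>M. norm (f m w - f n w) < e" by blast
  qed
  then have lim0: "(\<lambda>n. f n w) \<longlonglongrightarrow> lim (\<lambda>n. f n w)" if "w \<in> \<Omega>" for w
    using that by (simp add: convergent_LIMSEQ_iff)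
  define h where "h w = (if w \<in> \<Omega> then lim (\<lambda>n. f n w) else 0)" for w
  have lim: "(\<lambda>n. f n w) \<longlonglongrightarrow> h w" if "w \<in> \<Omega>" for w
    using lim0 that by (simp add: h_def)
  have hol: "scv_holomorphic_on h \<Omega>"
    by (rule bergman_limit_holomorphic[OF \<Omega> f cauchy lim])
  have mh: "h \<in> borel_measurable (lebesgue_on \<Omega>)" by (rule scv_measurable[OF \<Omega> hol])
  have mf: "f n \<in> borel_measurable (lebesgue_on \<Omega>)" for n by (rule L2_measurable[OF bergman_L2[OF f]])
  note [measurable] = mh mf
  have fatou: "(\<integral>\<^sup>+ w. ennreal ((norm (f n w - h w))\<^sup>2) \<partial>lebesgue_on \<Omega>) \<le> ennreal (e\<^sup>2)"
    if "e > 0" and N: "\<forall>m\<ge>N. L2_norm \<Omega> (\<lambda>w. f n w - f m w) \<le> e" for n N e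
  proof -
    have eq: "ennreal ((norm (f n w - h w))\<^sup>2) = liminf (\<lambda>m. ennreal ((norm (f n w - f m w))\<^sup>2))"
      if "w \<in> \<Omega>" for w
    proof (rule lim_imp_Liminf[symmetric])
      show "(\<lambda>m. ennreal ((norm (f n w - f m w))\<^sup>2)) \<longlonglongrightarrow> ennreal ((norm (f n w - h w))\<^sup>2)"
        by (intro tendsto_ennrealI tendsto_intros lim that)
    qed simp
    have "(\<integral>\<^sup>+ w. ennreal ((norm (f n w - h w))\<^sup>2) \<partial>lebesgue_on \<Omega>)
        = (\<integral>\<^sup>+ w. liminf (\<lambda>m. ennreal ((norm (f n w - f m w))\<^sup>2)) \<partial>lebesgue_on \<Omega>)"
      by (rule nn_integral_cong) (simp add: eq)
    also have "\<dots> \<le> liminf (\<lambda>m. \<integral>\<^sup>+ w. ennreal ((norm (f n w - f m w))\<^sup>2) \<partial>lebesgue_on \<Omega>)"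
      by (rule nn_integral_liminf) measurable
    also have "\<dots> \<le> ennreal (e\<^sup>2)"
    proof -
      have "(\<integral>\<^sup>+ w. ennreal ((norm (f n w - f m w))\<^sup>2) \<partial>lebesgue_on \<Omega>) \<le> ennreal (e\<^sup>2)" if "m \<ge> N" for m
      proof -
        have "(\<integral>\<^sup>+ w. ennreal ((norm (f n w - f m w))\<^sup>2) \<partial>lebesgue_on \<Omega>)
            = ennreal ((L2_norm \<Omega> (\<lambda>w. f n w - f m w))\<^sup>2)"
          unfolding L2_norm_square
          by (rule nn_integral_eq_integral[OF L2_integrable[OF bergman_L2[OF bergman_diff[OF f f]]]]) simp
        also have "\<dots> \<le> ennreal (e\<^sup>2)"
          using N that \<open>e > 0\<close> L2_norm_nonneg by (intro ennreal_leI power_mono) auto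
        finally show ?thesis .
      qed
      then have "\<forall>\<^sub>F m in sequentially.
          (\<integral>\<^sup>+ w. ennreal ((norm (f n w - f m w))\<^sup>2) \<partial>lebesgue_on \<Omega>) \<le> ennreal (e\<^sup>2)"
        by (auto simp: eventually_sequentially)
      then have "limsup (\<lambda>m. \<integral>\<^sup>+ w. ennreal ((norm (f n w - f m w))\<^sup>2) \<partial>lebesgue_on \<Omega>) \<le> ennreal (e\<^sup>2)"
        by (rule Limsup_bounded)
      then show ?thesis using Liminf_le_Limsup order_trans trivial_limit_sequentially by blast
    qed
    finally show ?thesis .
  qed
  have L2d: "(\<lambda>w. f n w - h w) \<in> L2_space \<Omega> \<and> L2_norm \<Omega> (\<lambda>w. f n w - h w) \<le> e"
    if "e > 0" "\<forall>m\<ge>N. L2_norm \<Omega> (\<lambda>w. f n w - f m w) \<le> e" for n N e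
  proof -
    have le: "(\<integral>\<^sup>+ w. ennreal (norm ((norm (f n w - h w))\<^sup>2)) \<partial>lebesgue_on \<Omega>) \<le> ennreal (e\<^sup>2)"
      using fatou[OF that] by simp
    have i: "integrable (lebesgue_on \<Omega>) (\<lambda>w. (norm (f n w - h w))\<^sup>2)"
      by (rule integrableI_bounded) (use le in \<open>auto intro: order_le_less_trans\<close>)
    then have L2: "(\<lambda>w. f n w - h w) \<in> L2_space \<Omega>" by (simp add: L2_space_def)
    have "ennreal ((L2_norm \<Omega> (\<lambda>w. f n w - h w))\<^sup>2) \<le> ennreal (e\<^sup>2)"
      using fatou[OF that] nn_integral_eq_integral[OF i] by (simp add: L2_norm_square)
    then have "(L2_norm \<Omega> (\<lambda>w. f n w - h w))\<^sup>2 \<le> e\<^sup>2" using \<open>e > 0\<close> by simp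
    then show ?thesis using L2 \<open>e > 0\<close> by (meson less_imp_le power2_le_imp_le)
  qed
  have ev: "\<exists>N. \<forall>n\<ge>N. (\<lambda>w. f n w - h w) \<in> L2_space \<Omega> \<and> L2_norm \<Omega> (\<lambda>w. f n w - h w) \<le> e" if "e > 0" for e
    using cauchy[OF that] L2d[OF that] by (meson less_imp_le)
  show thesis
  proof (rule that)
    obtain n where "(\<lambda>w. f n w - h w) \<in> L2_space \<Omega>" using ev[of 1] by auto
    from L2_diff[OF bergman_L2[OF f[of n]] this] have "h \<in> L2_space \<Omega>" by simp
    then show "h \<in> bergman_space \<Omega>" using hol by (simp add: bergman_space_def h_def)
    show "(\<lambda>n. L2_norm \<Omega> (\<lambda>w. f n w - h w)) \<longlonglongrightarrow> 0"
    proof (rule LIMSEQ_I)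
      fix e :: real assume "e > 0"
      then obtain N where "\<forall>n\<ge>N. L2_norm \<Omega> (\<lambda>w. f n w - h w) \<le> e / 2"
        using ev[of "e/2"] by auto
      with \<open>e > 0\<close> show "\<exists>N. \<forall>n\<ge>N. norm (L2_norm \<Omega> (\<lambda>w. f n w - h w) - 0) < e"
        by (intro exI[of _ N]) (force simp: L2_norm_nonneg)
    qed
  qed
qed

lemma quadratic_nonneg_imp_zero:
  fixes A B :: real
  assumes "\<And>t. 0 \<le> t\<^sup>2 * A + 2 * t * B" "A \<ge> 0"
  shows "B = 0"
proof -
  define t where "t = - B / (A + 1)"
  have B: "B = - t * (A + 1)" using assms(2) unfolding t_def by simp
  have "t\<^sup>2 * A + 2 * t * (- t * (A + 1)) = - (t\<^sup>2 * (A + 2))"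
    by (simp add: power2_eq_square algebra_simps)
  with assms(1)[of t] B have "t\<^sup>2 * (A + 2) \<le> 0" by simp
  then have "t = 0" using assms(2) by (auto simp: mult_le_0_iff)
  then show ?thesis using B by simp
qed

text \<open>The representing function minimises \<open>J f = \<parallel>f\<parallel>\<^sup>2 - 2 Re (L f)\<close>. A minimising sequence is Cauchy
  by the parallelogram law. Instead of continuity of \<open>J\<close>, the proof uses that its variation in
  each direction \<open>g\<close> is almost nonnegative along the sequence: passing to the limit in that
  inequality leaves a quadratic polynomial in \<open>t\<close> whose linear coefficient has to vanish.\<close>

lemma bergman_Riesz:
  fixes \<Omega> :: "(complex ^ 'n) set"
  assumes \<Omega>: "open \<Omega>"
    and add: "\<And>f g. f \<in> bergman_space \<Omega> \<Longrightarrow> g \<in> bergman_space \<Omega> \<Longrightarrow> L (\<lambda>w. f w + g w) = L f + L g"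
    and scale: "\<And>f c. f \<in> bergman_space \<Omega> \<Longrightarrow> L (\<lambda>w. c * f w) = c * L f"
    and bdd: "\<And>f. f \<in> bergman_space \<Omega> \<Longrightarrow> norm (L f) \<le> M * L2_norm \<Omega> f"
  obtains h where "h \<in> bergman_space \<Omega>" "\<And>f. f \<in> bergman_space \<Omega> \<Longrightarrow> L f = L2_inner \<Omega> f h"
proof -
  define V where "V = bergman_space \<Omega>"
  define J where "J f = (L2_norm \<Omega> f)\<^sup>2 - 2 * Re (L f)" for f
  define m where "m = Inf (J ` V)"
  have VL: "f \<in> V \<Longrightarrow> f \<in> L2_space \<Omega>" for f by (simp add: V_def bergman_L2)
  have z: "(\<lambda>_. 0) \<in> V" by (simp add: V_def bergman_space_def scv_const L2_space_def)
  have lower: "- (M\<^sup>2) \<le> J f" if "f \<in> V" for f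
  proof -
    have "Re (L f) \<le> M * L2_norm \<Omega> f"
      using bdd that complex_Re_le_cmod[of "L f"] unfolding V_def by (meson order_trans)
    moreover have "0 \<le> (L2_norm \<Omega> f)\<^sup>2 + M\<^sup>2 - 2 * (M * L2_norm \<Omega> f)"
      using zero_le_power2[of "L2_norm \<Omega> f - M"] by (simp add: power2_diff algebra_simps)
    ultimately show ?thesis unfolding J_def by linarith
  qed
  have mle: "m \<le> J f" if "f \<in> V" for f
    unfolding m_def using that lower by (intro cInf_lower bdd_belowI2[where m="- (M\<^sup>2)"]) auto
  have "\<exists>f\<in>V. J f < m + 1 / real (Suc n)" for n
  proof -
    have "Inf (J ` V) < m + 1 / real (Suc n)" by (simp add: m_def)
    then show ?thesis using z by (subst (asm) cInf_less_iff) (auto intro!: bdd_belowI2[where m="- (M\<^sup>2)"] lower)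
  qed
  then obtain f where f: "\<And>n. f n \<in> V" "\<And>n. J (f n) < m + 1 / real (Suc n)" by metis
  \<comment> \<open>The expansion of \<open>J\<close> along a line serves both the parallelogram law (\<open>t = 1/2\<close> and \<open>t = 1\<close>) and the first variation.\<close>
  have expand: "J (\<lambda>w. u w + of_real t * g w) = J u + t\<^sup>2 * (L2_norm \<Omega> g)\<^sup>2 + 2 * t * Re (L2_inner \<Omega> g u - L g)"
    if "u \<in> V" "g \<in> V" for u g t
  proof -
    have gt: "(\<lambda>w. of_real t * g w) \<in> V" using that bergman_scale by (auto simp: V_def)
    have "L2_inner \<Omega> u (\<lambda>w. of_real t * g w) = cnj (of_real t * L2_inner \<Omega> g u)"
      by (subst L2_inner_commute) (simp only: L2_inner_scale_left VL that)
    moreover have "L (\<lambda>w. u w + of_real t * g w) = L u + of_real t * L g"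
      using add[of u "\<lambda>w. of_real t * g w"] scale[of g "of_real t"] gt that by (simp add: V_def)
    ultimately show ?thesis
      unfolding J_def using L2_norm_add_square[OF VL[OF that(1)] VL[OF gt]] L2_norm_scale[of \<Omega> "of_real t" g]
      by (simp add: power_mult_distrib algebra_simps)
  qed
  have par: "(L2_norm \<Omega> (\<lambda>w. u w - g w))\<^sup>2 \<le> 2 * (J u - m) + 2 * (J g - m)" if "u \<in> V" "g \<in> V" for u g
  proof -
    define d where "d = (\<lambda>w. g w - u w)"
    have d: "d \<in> V" using that bergman_diff by (auto simp: V_def d_def)
    have g: "g = (\<lambda>w. u w + of_real 1 * d w)" by (simp add: d_def)
    have mid: "(\<lambda>w. u w + of_real (1/2) * d w) \<in> V"
      unfolding V_def by (intro bergman_add bergman_scale) (use that d in \<open>auto simp: V_def\<close>)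
    have "L2_norm \<Omega> (\<lambda>w. u w - g w) = L2_norm \<Omega> d"
      by (simp add: L2_norm_def d_def norm_minus_commute)
    then show ?thesis
      using mle[OF mid] unfolding expand[OF that(1) d]
      by (subst g) (simp only: expand[OF that(1) d], simp add: power2_eq_square)
  qed
  have cauchy: "\<exists>N. \<forall>i\<ge>N. \<forall>j\<ge>N. L2_norm \<Omega> (\<lambda>w. f i w - f j w) < e" if e: "e > 0" for e
  proof -
    obtain N where N: "1 / real (Suc N) < e\<^sup>2 / 4" using e reals_Archimedean[of "e\<^sup>2/4"] by (auto simp: inverse_eq_divide)
    have "L2_norm \<Omega> (\<lambda>w. f i w - f j w) < e" if "i \<ge> N" "j \<ge> N" for i j
    proof -
      have mono: "1 / real (Suc k) \<le> 1 / real (Suc N)" if "k \<ge> N" for k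
        using that by (intro divide_left_mono) auto
      have "(L2_norm \<Omega> (\<lambda>w. f i w - f j w))\<^sup>2 < e\<^sup>2"
        using par[OF f(1)[of i] f(1)[of j]] order_less_le_trans[OF f(2) add_left_mono[OF mono[OF that(1)]]]
          order_less_le_trans[OF f(2) add_left_mono[OF mono[OF that(2)]]] N by argo
      then show ?thesis using e by (meson less_imp_le power_less_imp_less_base)
    qed
    then show ?thesis by blast
  qed
  obtain h where h: "h \<in> V" "(\<lambda>n. L2_norm \<Omega> (\<lambda>w. f n w - h w)) \<longlonglongrightarrow> 0"
    using bergman_complete[OF \<Omega>, of f] f(1) cauchy unfolding V_def by blast
  have limin: "(\<lambda>n. L2_inner \<Omega> g (f n)) \<longlonglongrightarrow> L2_inner \<Omega> g h" if g: "g \<in> V" for g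
  proof -
    have "norm (L2_inner \<Omega> g (f n) - L2_inner \<Omega> g h) \<le> L2_norm \<Omega> (\<lambda>w. f n w - h w) * L2_norm \<Omega> g" for n
    proof -
      have "L2_inner \<Omega> (\<lambda>w. f n w - h w) g = L2_inner \<Omega> (f n) g - L2_inner \<Omega> h g"
        by (intro L2_inner_diff_left VL f h g)
      then have "L2_inner \<Omega> g (f n) - L2_inner \<Omega> g h = cnj (L2_inner \<Omega> (\<lambda>w. f n w - h w) g)"
        by (simp add: L2_inner_commute[of \<Omega> g "f n"] L2_inner_commute[of \<Omega> g h])
      then show ?thesis
        using L2_Cauchy_Schwarz[OF L2_diff[OF VL[OF f(1)[of n]] VL[OF h(1)]] VL[OF g]] by simp
    qed
    then have "(\<lambda>n. L2_inner \<Omega> g (f n) - L2_inner \<Omega> g h) \<longlonglongrightarrow> 0"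
      by (intro Lim_null_comparison[OF always_eventually[OF allI] tendsto_mult_left_zero[OF h(2)]])
    then show ?thesis by (simp add: LIM_zero_iff)
  qed
  have Re0: "Re (L2_inner \<Omega> g h - L g) = 0" if g: "g \<in> V" for g
  proof (rule quadratic_nonneg_imp_zero)
    fix t :: real
    have "- (1 / real (Suc n)) \<le> t\<^sup>2 * (L2_norm \<Omega> g)\<^sup>2 + 2 * t * Re (L2_inner \<Omega> g (f n) - L g)" for n
    proof -
      have "(\<lambda>w. f n w + of_real t * g w) \<in> V"
        unfolding V_def by (intro bergman_add bergman_scale) (use f g in \<open>auto simp: V_def\<close>)
      from mle[OF this] show ?thesis unfolding expand[OF f(1) g] using f(2)[of n] by linarith
    qed
    moreover have "(\<lambda>n. - (1 / real (Suc n))) \<longlonglongrightarrow> - 0"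
      by (intro tendsto_minus LIMSEQ_Suc[OF lim_1_over_n])
    moreover have "(\<lambda>n. t\<^sup>2 * (L2_norm \<Omega> g)\<^sup>2 + 2 * t * Re (L2_inner \<Omega> g (f n) - L g))
        \<longlonglongrightarrow> t\<^sup>2 * (L2_norm \<Omega> g)\<^sup>2 + 2 * t * Re (L2_inner \<Omega> g h - L g)"
      by (intro tendsto_intros limin g)
    ultimately show "0 \<le> t\<^sup>2 * (L2_norm \<Omega> g)\<^sup>2 + 2 * t * Re (L2_inner \<Omega> g h - L g)"
      using LIMSEQ_le by (metis (no_types, lifting) minus_zero)
  qed simp
  show thesis
  proof (rule that)
    show "h \<in> bergman_space \<Omega>" using h by (simp add: V_def)
    fix g assume "g \<in> bergman_space \<Omega>"
    then have g: "g \<in> V" by (simp add: V_def)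
    then have ig: "(\<lambda>w. \<i> * g w) \<in> V" using bergman_scale by (auto simp: V_def)
    have "L (\<lambda>w. \<i> * g w) = \<i> * L g" using scale g by (simp add: V_def)
    moreover have "L2_inner \<Omega> (\<lambda>w. \<i> * g w) h = \<i> * L2_inner \<Omega> g h"
      by (rule L2_inner_scale_left) (intro VL g h)+
    ultimately show "L g = L2_inner \<Omega> g h"
      using Re0[OF g] Re0[OF ig] by (simp add: complex_eq_iff)
  qed
qed

section \<open>The reproducing kernel and the Bergman projection\<close>

text \<open>A function of norm zero in the Bergman space vanishes at every point, by the pointwise bounds.
  This gives the uniqueness that the definite descriptions of kernel and projection rely on.\<close>

lemma bergman_eqI:
  fixes \<Omega> :: "(complex ^ 'n) set"
  assumes \<Omega>: "open \<Omega>" and h: "h \<in> bergman_space \<Omega>" "h' \<in> bergman_space \<Omega>"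
    and eq: "\<And>f. f \<in> bergman_space \<Omega> \<Longrightarrow> L2_inner \<Omega> h f = L2_inner \<Omega> h' f"
  shows "h = h'"
proof
  fix w
  let ?d = "\<lambda>w. h w - h' w"
  have d: "?d \<in> bergman_space \<Omega>" by (rule bergman_diff[OF h])
  have "L2_inner \<Omega> ?d ?d = 0"
    using L2_inner_diff_left[OF bergman_L2[OF h(1)] bergman_L2[OF h(2)] bergman_L2[OF d]] eq[OF d] by simp
  then have z: "L2_norm \<Omega> ?d = 0" by (simp add: L2_inner_self)
  show "h w = h' w"
  proof (cases "w \<in> \<Omega>")
    case True
    obtain C where "\<And>f. f \<in> bergman_space \<Omega> \<Longrightarrow> norm (f w) \<le> C * L2_norm \<Omega> f"
      by (rule bergman_point_bound[OF \<Omega> True]) blast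
    from this[OF d] z show ?thesis by simp
  qed (use h in \<open>simp add: bergman_space_def\<close>)
qed

lemma bergman_kernel_reproduces:
  fixes \<Omega> :: "(complex ^ 'n) set"
  assumes \<Omega>: "open \<Omega>" and z: "z \<in> \<Omega>"
  shows "(\<lambda>w. bergman_kernel \<Omega> w z) \<in> bergman_space \<Omega>"
    and "f \<in> bergman_space \<Omega> \<Longrightarrow> L2_inner \<Omega> f (\<lambda>w. bergman_kernel \<Omega> w z) = f z"
proof -
  let ?P = "\<lambda>k. k \<in> bergman_space \<Omega> \<and> (\<forall>f\<in>bergman_space \<Omega>. f z = L2_inner \<Omega> f k)"
  obtain C where C: "\<And>f. f \<in> bergman_space \<Omega> \<Longrightarrow> norm (f z) \<le> C * L2_norm \<Omega> f"
    by (rule bergman_point_bound[OF \<Omega> z]) blast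
  obtain k where "k \<in> bergman_space \<Omega>" "\<And>f. f \<in> bergman_space \<Omega> \<Longrightarrow> f z = L2_inner \<Omega> f k"
    by (rule bergman_Riesz[OF \<Omega>, of "\<lambda>f. f z" C]) (use C in blast)+
  then have k: "?P k" by blast
  have "k' = k" if "?P k'" for k'
    using that k by (intro bergman_eqI[OF \<Omega>]) (auto simp: L2_inner_commute[of \<Omega> k] L2_inner_commute[of \<Omega> k'])
  with k have "?P (THE k. ?P k)" by (rule theI)
  then have "?P (\<lambda>w. bergman_kernel \<Omega> w z)" unfolding bergman_kernel_def by simp
  then show "(\<lambda>w. bergman_kernel \<Omega> w z) \<in> bergman_space \<Omega>"
    "f \<in> bergman_space \<Omega> \<Longrightarrow> L2_inner \<Omega> f (\<lambda>w. bergman_kernel \<Omega> w z) = f z" by auto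
qed

lemma bergman_projection_orthogonal:
  fixes \<Omega> :: "(complex ^ 'n) set"
  assumes \<Omega>: "open \<Omega>" and g: "g \<in> L2_space \<Omega>"
  shows "bergman_projection \<Omega> g \<in> bergman_space \<Omega>"
    and "f \<in> bergman_space \<Omega> \<Longrightarrow> L2_inner \<Omega> (\<lambda>w. g w - bergman_projection \<Omega> g w) f = 0"
proof -
  let ?P = "\<lambda>h. h \<in> bergman_space \<Omega> \<and> (\<forall>f\<in>bergman_space \<Omega>. L2_inner \<Omega> (\<lambda>w. g w - h w) f = 0)"
  have iff: "?P h \<longleftrightarrow> h \<in> bergman_space \<Omega> \<and> (\<forall>f\<in>bergman_space \<Omega>. L2_inner \<Omega> g f = L2_inner \<Omega> h f)" for h
    using L2_inner_diff_left[OF g] bergman_L2 by (metis (no_types, lifting) right_minus_eq)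
  obtain h where h: "h \<in> bergman_space \<Omega>" "\<And>f. f \<in> bergman_space \<Omega> \<Longrightarrow> L2_inner \<Omega> f g = L2_inner \<Omega> f h"
  proof (rule bergman_Riesz[OF \<Omega>, of "\<lambda>f. L2_inner \<Omega> f g" "L2_norm \<Omega> g"])
    fix f assume f: "f \<in> bergman_space \<Omega>"
    show "norm (L2_inner \<Omega> f g) \<le> L2_norm \<Omega> g * L2_norm \<Omega> f"
      using L2_Cauchy_Schwarz[OF bergman_L2[OF f] g] by (simp add: mult.commute)
  qed (auto intro: L2_inner_add_left L2_inner_scale_left bergman_L2 g)
  have "?P h" unfolding iff using h by (auto simp: L2_inner_commute[of \<Omega> g] L2_inner_commute[of \<Omega> h])
  moreover have "h' = h" if "?P h'" for h'
    using that \<open>?P h\<close> unfolding iff by (intro bergman_eqI[OF \<Omega>]) auto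
  ultimately have "?P (THE h. ?P h)" by (rule theI)
  then show "bergman_projection \<Omega> g \<in> bergman_space \<Omega>"
    "f \<in> bergman_space \<Omega> \<Longrightarrow> L2_inner \<Omega> (\<lambda>w. g w - bergman_projection \<Omega> g w) f = 0"
    unfolding bergman_projection_def by auto
qed

text \<open>Pythagoras: \<open>g - h\<close> is the orthogonal sum of \<open>g - P g\<close> and \<open>P g - h\<close>.\<close>

lemma L2_norm_projection_le:
  fixes \<Omega> :: "(complex ^ 'n) set"
  assumes \<Omega>: "open \<Omega>" and g: "g \<in> L2_space \<Omega>" and h: "h \<in> bergman_space \<Omega>"
  shows "(L2_norm \<Omega> (\<lambda>w. g w - bergman_projection \<Omega> g w))\<^sup>2 \<le> (L2_norm \<Omega> (\<lambda>w. g w - h w))\<^sup>2"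
proof -
  let ?p = "bergman_projection \<Omega> g"
  note p = bergman_projection_orthogonal[OF \<Omega> g]
  have d: "(\<lambda>w. ?p w - h w) \<in> bergman_space \<Omega>" by (rule bergman_diff[OF p(1) h])
  have "(\<lambda>w. g w - h w) = (\<lambda>w. (g w - ?p w) + (?p w - h w))" by simp
  then have "(L2_norm \<Omega> (\<lambda>w. g w - h w))\<^sup>2
      = (L2_norm \<Omega> (\<lambda>w. g w - ?p w))\<^sup>2 + (L2_norm \<Omega> (\<lambda>w. ?p w - h w))\<^sup>2"
    using L2_norm_add_square[OF L2_diff[OF g bergman_L2[OF p(1)]] bergman_L2[OF d]] p(2)[OF d] by simp
  then show ?thesis by simp
qed

lemma bounded_continuous_L2:
  fixes \<Omega> :: "(complex ^ 'n) set"
  assumes \<Omega>: "open \<Omega>" "bounded \<Omega>" and f: "continuous_on \<Omega> f" "\<And>w. w \<in> \<Omega> \<Longrightarrow> norm (f w) \<le> B"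
  shows "f \<in> L2_space \<Omega>"
proof -
  have "\<Omega> \<in> lmeasurable" using \<Omega> by (simp add: lmeasurable_open)
  then have "integrable (lebesgue_on \<Omega>) (\<lambda>_. 1 :: real)"
    by (intro finite_measure.integrable_const finite_measure_lebesgue_on)
  then have "(\<lambda>_. 1) \<in> L2_space \<Omega>" by (simp add: L2_space_def)
  moreover have "f \<in> borel_measurable (lebesgue_on \<Omega>)"
    using \<Omega> f by (intro continuous_imp_measurable_on_sets_lebesgue) auto
  ultimately show ?thesis using L2_bounded_mult[of "\<lambda>_. 1" \<Omega> f B] f(2) by simp
qed

lemma bounded_holomorphic_bergman:
  fixes \<Omega> :: "(complex ^ 'n) set"
  assumes \<Omega>: "open \<Omega>" "bounded \<Omega>" and f: "scv_holomorphic_on f \<Omega>" "\<And>w. w \<in> \<Omega> \<Longrightarrow> norm (f w) \<le> B"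
  shows "(\<lambda>w. if w \<in> \<Omega> then f w else 0) \<in> bergman_space \<Omega>"
proof -
  let ?f = "\<lambda>w. if w \<in> \<Omega> then f w else 0"
  have h: "scv_holomorphic_on ?f \<Omega>" by (rule scv_cong[OF \<Omega>(1) f(1)]) simp
  have "?f \<in> L2_space \<Omega>"
    by (rule bounded_continuous_L2[OF \<Omega> scv_holomorphic_imp_continuous[OF h], of B]) (simp add: f(2))
  with h show ?thesis by (simp add: bergman_space_def)
qed

text \<open>Constants belong to the Bergman space of a bounded domain, so \<open>K(z,z) > 0\<close> and the
  normalisation makes sense. The third property is the extremal one, by which a test function
  bounds \<open>K(z,z)\<close> from below. By the fourth, the probability density \<open>|k\<^sub>z|\<^sup>2\<close> integrates a
  bounded holomorphic function to its value at \<open>z\<close>.\<close>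

lemma normalized_bergman_kernel_properties:
  fixes \<Omega> :: "(complex ^ 'n) set"
  assumes \<Omega>: "open \<Omega>" "bounded \<Omega>" and z: "z \<in> \<Omega>"
  defines "k \<equiv> normalized_bergman_kernel \<Omega> z"
  shows "k \<in> bergman_space \<Omega>" and "L2_norm \<Omega> k = 1"
    and "f \<in> bergman_space \<Omega> \<Longrightarrow> norm (f z) \<le> L2_norm \<Omega> f * norm (k z)"
    and "\<lbrakk>scv_holomorphic_on \<psi> \<Omega>; \<And>w. w \<in> \<Omega> \<Longrightarrow> norm (\<psi> w) \<le> B\<rbrakk> \<Longrightarrow> L2_inner \<Omega> (\<lambda>w. \<psi> w * k w) k = \<psi> z"
proof -
  define K where "K = (\<lambda>w. bergman_kernel \<Omega> w z)"
  define N where "N = L2_norm \<Omega> K"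
  note K = bergman_kernel_reproduces[OF \<Omega>(1) z, folded K_def]
  have Kz: "K z = of_real (N\<^sup>2)" using K(2)[OF K(1)] L2_inner_self[of \<Omega> K] by (simp add: N_def)
  have "N \<noteq> 0"
  proof
    assume "N = 0"
    have one: "(\<lambda>w. if w \<in> \<Omega> then 1 else 0) \<in> bergman_space \<Omega>"
      using bounded_holomorphic_bergman[OF \<Omega> scv_const, of 1 1] by simp
    show False
      using L2_Cauchy_Schwarz[OF bergman_L2[OF one] bergman_L2[OF K(1)]] K(2)[OF one] z \<open>N = 0\<close>
      by (simp add: N_def)
  qed
  then have N: "N > 0" using L2_norm_nonneg[of \<Omega> K] by (simp add: N_def)
  have sq: "csqrt (K z) = of_real N"
    unfolding Kz using N by (simp add: csqrt_of_real_nonneg)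
  have k: "k = (\<lambda>w. of_real (1 / N) * K w)"
    unfolding k_def normalized_bergman_kernel_def using sq by (simp add: K_def fun_eq_iff)
  show kb: "k \<in> bergman_space \<Omega>" unfolding k by (rule bergman_scale[OF K(1)])
  show "L2_norm \<Omega> k = 1" using N by (simp only: k L2_norm_scale N_def[symmetric]) (simp add: norm_divide)
  have inner: "L2_inner \<Omega> f k = of_real (1 / N) * f z" if "f \<in> bergman_space \<Omega>" for f
  proof -
    have "L2_inner \<Omega> f k = cnj (of_real (1 / N) * L2_inner \<Omega> K f)"
      unfolding k by (subst L2_inner_commute) (simp only: L2_inner_scale_left bergman_L2 K that)
    then show ?thesis using K(2)[OF that] by (simp add: L2_inner_commute[of \<Omega> K f])
  qed
  have kz: "k z = of_real N" using N by (simp add: k Kz power2_eq_square)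
  show "norm (f z) \<le> L2_norm \<Omega> f * norm (k z)" if "f \<in> bergman_space \<Omega>"
    using L2_Cauchy_Schwarz[OF bergman_L2[OF that] bergman_L2[OF kb]] inner[OF that] N \<open>L2_norm \<Omega> k = 1\<close>
    by (simp add: kz norm_divide field_simps)
  show "L2_inner \<Omega> (\<lambda>w. \<psi> w * k w) k = \<psi> z"
    if "scv_holomorphic_on \<psi> \<Omega>" "\<And>w. w \<in> \<Omega> \<Longrightarrow> norm (\<psi> w) \<le> B"
    using inner[OF bergman_bounded_mult[OF \<Omega>(1) kb that]] N by (simp add: kz)
qed

lemma hankel_norm_le:
  fixes \<Omega> :: "(complex ^ 'n) set"
  assumes \<Omega>: "open \<Omega>" and k: "k \<in> bergman_space \<Omega>"
    and \<phi>: "\<phi> \<in> borel_measurable (lebesgue_on \<Omega>)" "\<And>w. w \<in> \<Omega> \<Longrightarrow> norm (\<phi> w) \<le> B"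
    and g: "scv_holomorphic_on g \<Omega>" "\<And>w. w \<in> \<Omega> \<Longrightarrow> norm (g w) \<le> B'"
  shows "(L2_norm \<Omega> (hankel_operator \<Omega> \<phi> k))\<^sup>2 \<le> (LINT w|lebesgue_on \<Omega>. (norm (\<phi> w - g w))\<^sup>2 * (norm (k w))\<^sup>2)"
proof -
  have "(\<lambda>w. \<phi> w * k w) \<in> L2_space \<Omega>"
    by (rule L2_bounded_mult[OF bergman_L2[OF k] \<phi>])
  from L2_norm_projection_le[OF \<Omega> this bergman_bounded_mult[OF \<Omega> k g]]
  show ?thesis
    by (simp add: hankel_operator_def L2_norm_square left_diff_distrib[symmetric] norm_mult power_mult_distrib)
qed

text \<open>The left side is at most the integral of \<open>|\<phi> - g|\<^sup>2 |k\<^sub>z|\<^sup>2\<close>. Once a holomorphic \<open>l\<close> whose real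
  part dominates \<open>|\<phi> - g|\<^sup>2\<close> is found, that integral is evaluated by the mean value property of
  the density \<open>|k\<^sub>z|\<^sup>2\<close>, and no information on the kernel itself is required.\<close>

lemma hankel_norm_le_peak:
  fixes \<Omega> :: "(complex ^ 'n) set"
  assumes \<Omega>: "open \<Omega>" "bounded \<Omega>" and z: "z \<in> \<Omega>"
    and \<phi>: "\<phi> \<in> borel_measurable (lebesgue_on \<Omega>)" "\<And>w. w \<in> \<Omega> \<Longrightarrow> norm (\<phi> w) \<le> B"
    and g: "scv_holomorphic_on g \<Omega>" "\<And>w. w \<in> \<Omega> \<Longrightarrow> norm (g w) \<le> B'"
    and l: "scv_holomorphic_on l \<Omega>" "\<And>w. w \<in> \<Omega> \<Longrightarrow> norm (l w) \<le> B''"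
    and le: "\<And>w. w \<in> \<Omega> \<Longrightarrow> (norm (\<phi> w - g w))\<^sup>2 \<le> Re (l w)"
  shows "(L2_norm \<Omega> (hankel_operator \<Omega> \<phi> (normalized_bergman_kernel \<Omega> z)))\<^sup>2 \<le> Re (l z)"
proof -
  define k where "k = normalized_bergman_kernel \<Omega> z"
  note k = normalized_bergman_kernel_properties[OF \<Omega> z, folded k_def]
  have i: "integrable (lebesgue_on \<Omega>) (\<lambda>w. l w * k w * cnj (k w))"
    by (intro L2_pairing_integrable bergman_L2 bergman_bounded_mult[OF \<Omega>(1) k(1) l] k(1))
  have re: "Re (l w * k w * cnj (k w)) = Re (l w) * (norm (k w))\<^sup>2" for w
    unfolding mult.assoc complex_norm_square[symmetric] by simp
  have "(L2_norm \<Omega> (hankel_operator \<Omega> \<phi> k))\<^sup>2 \<le> (LINT w|lebesgue_on \<Omega>. (norm (\<phi> w - g w))\<^sup>2 * (norm (k w))\<^sup>2)"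
    by (rule hankel_norm_le[OF \<Omega>(1) k(1) \<phi> g])
  also have "\<dots> \<le> (LINT w|lebesgue_on \<Omega>. Re (l w * k w * cnj (k w)))"
  proof (rule integral_mono'[OF integrable_Re[OF i]])
    fix w assume "w \<in> space (lebesgue_on \<Omega>)"
    then have *: "(norm (\<phi> w - g w))\<^sup>2 \<le> Re (l w)" using le by simp
    then show "(norm (\<phi> w - g w))\<^sup>2 * (norm (k w))\<^sup>2 \<le> Re (l w * k w * cnj (k w))"
      unfolding re by (rule mult_right_mono) simp
    show "0 \<le> Re (l w * k w * cnj (k w))"
      unfolding re using order_trans[OF zero_le_power2 *] by (intro mult_nonneg_nonneg) auto
  qed
  also have "\<dots> = Re (L2_inner \<Omega> (\<lambda>w. l w * k w) k)"
    unfolding L2_inner_def by (rule integral_Re[OF i])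
  also have "\<dots> = Re (l z)" using k(4)[OF l] by simp
  finally show ?thesis by (simp add: k_def)
qed

section \<open>Faces of convex Reinhardt domains\<close>

lemma inner_complex_vec: "(a :: complex ^ 'n) \<bullet> (w :: complex ^ 'n) = (\<Sum>i\<in>UNIV. Re (cnj (a $ i) * w $ i))"
  by (simp add: inner_vec_def inner_complex_def)

lemma reinhardt_closure:
  fixes \<Omega> :: "(complex ^ 'n) set" and z :: "complex ^ 'n"
  assumes "reinhardt_domain \<Omega>" "z \<in> closure \<Omega>" "\<And>i. norm (\<xi> i) = 1"
  shows "(\<chi> i. \<xi> i * z $ i) \<in> closure \<Omega>"
proof -
  let ?f = "\<lambda>z :: complex ^ 'n. \<chi> i. \<xi> i * z $ i"
  have "?f z \<in> \<Omega>" if "z \<in> \<Omega>" for z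
  proof -
    have "(\<forall>i. norm ((\<chi> i. \<xi> i) $ i) = 1) \<longrightarrow> (\<chi> i. (\<chi> i. \<xi> i) $ i * z $ i) \<in> \<Omega>"
      using assms(1) that unfolding reinhardt_domain_def by blast
    then show ?thesis using assms(3) by simp
  qed
  then have "?f ` closure \<Omega> \<subseteq> closure \<Omega>"
    using closure_subset by (intro image_closure_subset) (auto intro!: continuous_intros)
  then show ?thesis using assms(2) by blast
qed

text \<open>Multiplying each coordinate of \<open>z\<close> by a suitable unimodular factor makes every term of the
  inner product equal to its modulus.\<close>

lemma reinhardt_inner_moduli:
  fixes \<Omega> :: "(complex ^ 'n) set" and a z :: "complex ^ 'n"
  assumes R: "reinhardt_domain \<Omega>" and le: "\<And>w. w \<in> closure \<Omega> \<Longrightarrow> a \<bullet> w \<le> c" and z: "z \<in> closure \<Omega>"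
  shows "(\<Sum>i\<in>UNIV. norm (a $ i) * norm (z $ i)) \<le> c"
proof -
  define \<xi> where "\<xi> i = (if cnj (a $ i) * z $ i = 0 then 1 else cnj (sgn (cnj (a $ i) * z $ i)))" for i
  have "(\<chi> i. \<xi> i * z $ i) \<in> closure \<Omega>"
    by (rule reinhardt_closure[OF R z]) (simp add: \<xi>_def norm_sgn)
  from le[OF this] have "(\<Sum>i\<in>UNIV. Re (cnj (a $ i) * (\<xi> i * z $ i))) \<le> c"
    by (simp add: inner_complex_vec)
  moreover have "cnj (a $ i) * (\<xi> i * z $ i) = of_real (norm (a $ i) * norm (z $ i))" for i
  proof (cases "cnj (a $ i) * z $ i = 0")
    case False
    define u where "u = cnj (a $ i) * z $ i"
    have "cnj (a $ i) * (\<xi> i * z $ i) = cnj (sgn u) * u" using False by (simp add: \<xi>_def u_def)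
    also have "\<dots> = of_real (norm u)"
      by (simp add: sgn_eq mult.commute[of "cnj u"] power2_eq_square flip: complex_norm_square)
    finally show ?thesis by (simp add: u_def norm_mult)
  qed auto
  ultimately show ?thesis by simp
qed

text \<open>At a point where the functional attains its maximum there is equality in the previous
  estimate, hence in each term. On such a face every \<open>cnj (a $ i) * z $ i\<close> is therefore
  nonnegative, which is what excludes holomorphic discs except in coordinate directions.\<close>

lemma reinhardt_face:
  fixes \<Omega> :: "(complex ^ 'n) set" and a z :: "complex ^ 'n"
  assumes R: "reinhardt_domain \<Omega>" and le: "\<And>w. w \<in> closure \<Omega> \<Longrightarrow> a \<bullet> w \<le> c" and z: "z \<in> closure \<Omega>"
    and eq: "a \<bullet> z = c"
  shows "cnj (a $ i) * z $ i = of_real (norm (a $ i) * norm (z $ i))"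
proof -
  let ?u = "\<lambda>i. cnj (a $ i) * z $ i"
  have "(\<Sum>i\<in>UNIV. norm (?u i) - Re (?u i)) \<le> 0"
    using reinhardt_inner_moduli[OF R le z] eq by (simp add: sum_subtractf inner_complex_vec norm_mult)
  moreover have "0 \<le> norm (?u i) - Re (?u i)" for i using complex_Re_le_cmod[of "?u i"] by simp
  ultimately have "norm (?u i) - Re (?u i) = 0"
    by (metis (no_types, lifting) UNIV_I finite_class.finite_UNIV order_antisym sum_nonneg sum_nonneg_0)
  then have "Re (?u i) = norm (?u i)" by simp
  moreover from this have "Im (?u i) = 0"
    using cmod_power2[of "?u i"] by (simp del: times_complex.sel)
  ultimately have "?u i = of_real (norm (?u i))"
    unfolding complex_eq_iff Re_complex_of_real Im_complex_of_real by simp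
  then show ?thesis by (simp only: norm_mult complex_mod_cnj)
qed

text \<open>A functional separating \<open>w\<close> from the closure would exceed on \<open>w\<close> its supremum over the
  closure, although the latter dominates the sum of the products of moduli at \<open>p\<close>.\<close>

lemma reinhardt_closure_smaller:
  fixes \<Omega> :: "(complex ^ 'n) set" and p w :: "complex ^ 'n"
  assumes R: "reinhardt_domain \<Omega>" and cvx: "convex \<Omega>" and p: "p \<in> closure \<Omega>"
    and le: "\<And>i. norm (w $ i) \<le> norm (p $ i)"
  shows "w \<in> closure \<Omega>"
proof (rule ccontr)
  assume "w \<notin> closure \<Omega>"
  then obtain a b where ab: "a \<bullet> w < b" "\<And>x. x \<in> closure \<Omega> \<Longrightarrow> b < a \<bullet> x"
    using separating_hyperplane_closed_point[of "closure \<Omega>" w] cvx by (auto simp: convex_closure)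
  have "(\<Sum>i\<in>UNIV. norm ((- a) $ i) * norm (p $ i)) \<le> - b"
    by (rule reinhardt_inner_moduli[OF R _ p]) (use ab in \<open>auto simp: less_imp_le\<close>)
  then have "(\<Sum>i\<in>UNIV. norm (a $ i) * norm (p $ i)) \<le> - b" by simp
  moreover have "- (a \<bullet> w) \<le> (\<Sum>i\<in>UNIV. norm (a $ i) * norm (p $ i))"
  proof -
    have "- Re (cnj (a $ i) * w $ i) \<le> norm (a $ i) * norm (p $ i)" for i
    proof -
      have "- Re (cnj (a $ i) * w $ i) \<le> norm (cnj (a $ i) * w $ i)"
        using abs_Re_le_cmod[of "cnj (a $ i) * w $ i"] by linarith
      also have "\<dots> \<le> norm (a $ i) * norm (p $ i)" by (simp add: norm_mult mult_left_mono le)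
      finally show ?thesis .
    qed
    then show ?thesis unfolding inner_complex_vec sum_negf[symmetric] by (rule sum_mono)
  qed
  ultimately show False using ab(1) by linarith
qed

lemma reinhardt_open_polydisc:
  fixes \<Omega> :: "(complex ^ 'n) set" and p w :: "complex ^ 'n"
  assumes R: "reinhardt_domain \<Omega>" and cvx: "convex \<Omega>" and p: "p \<in> closure \<Omega>"
    and less: "\<And>i. norm (w $ i) < norm (p $ i)"
  shows "w \<in> \<Omega>"
proof -
  let ?U = "{w :: complex ^ 'n. \<forall>i. norm (w $ i) < norm (p $ i)}"
  have "open (\<Inter>i. {w :: complex ^ 'n. norm (w $ i) < norm (p $ i)})"
    by (intro open_INT ballI open_Collect_less) (auto intro!: continuous_intros)
  moreover have "(\<Inter>i. {w :: complex ^ 'n. norm (w $ i) < norm (p $ i)}) = ?U" by auto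
  ultimately have "open ?U" by simp
  moreover have "?U \<subseteq> closure \<Omega>"
    using reinhardt_closure_smaller[OF R cvx p] by (auto simp: less_imp_le)
  ultimately have "?U \<subseteq> interior (closure \<Omega>)" by (rule interior_maximal[rotated])
  also have "interior (closure \<Omega>) = \<Omega>"
    using convex_interior_closure[OF cvx] R by (simp add: reinhardt_domain_def interior_open)
  finally show ?thesis using less by blast
qed

lemma supporting_functional:
  fixes \<Omega> :: "'a::euclidean_space set"
  assumes "open \<Omega>" "convex \<Omega>" "\<Omega> \<noteq> {}" "p \<in> frontier \<Omega>"
  obtains a where "a \<noteq> 0" "\<And>w. w \<in> closure \<Omega> \<Longrightarrow> a \<bullet> w \<le> a \<bullet> p" "\<And>w. w \<in> \<Omega> \<Longrightarrow> a \<bullet> w < a \<bullet> p"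
proof -
  have r: "rel_interior \<Omega> = \<Omega>" using assms by (intro rel_interior_open)
  have "p \<in> closure \<Omega>" "p \<notin> \<Omega>" using assms by (auto simp: frontier_def interior_open)
  then obtain a where "a \<noteq> 0" "\<And>w. w \<in> closure \<Omega> \<Longrightarrow> a \<bullet> p \<le> a \<bullet> w" "\<And>w. w \<in> \<Omega> \<Longrightarrow> a \<bullet> p < a \<bullet> w"
    using supporting_hyperplane_relative_frontier[OF assms(2), of p] unfolding r by metis
  then show ?thesis by (intro that[of "- a"]) auto
qed

text \<open>The first argument names the coordinate that holds \<open>x\<close>, so that flat faces in either
  coordinate direction are treated at once.\<close>

definition coord_pair :: "2 \<Rightarrow> complex \<Rightarrow> complex \<Rightarrow> complex ^ 2" where
  "coord_pair i x y = (\<chi> k. if k = i then x else y)"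

lemma coord_pair_nth [simp]:
  "coord_pair i x y $ i = x" "k \<noteq> i \<Longrightarrow> coord_pair i x y $ k = y"
  by (simp_all add: coord_pair_def)

lemma UNIV_two: "i \<noteq> j \<Longrightarrow> (UNIV :: 2 set) = {i, j}"
  using exhaust_2 by (metis UNIV_2 UNIV_eq_I insert_iff)

lemma coord_pair_eqI:
  fixes w :: "complex ^ 2"
  shows
  "i \<noteq> j \<Longrightarrow> w $ i = x \<Longrightarrow> w $ j = y \<Longrightarrow> w = coord_pair i x y"
  using UNIV_two[of i j] by (auto simp: vec_eq_iff coord_pair_def)

lemma continuous_coord_pair [continuous_intros]:
  "continuous_on S f \<Longrightarrow> continuous_on S g \<Longrightarrow> continuous_on S (\<lambda>x. coord_pair i (f x) (g x))"
  unfolding coord_pair_def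
proof (rule continuous_on_vec_lambda)
  fix k show "continuous_on S f \<Longrightarrow> continuous_on S g \<Longrightarrow> continuous_on S (\<lambda>x. if k = i then f x else g x)"
    by (cases "k = i") auto
qed

lemma inner_coord:
  fixes a w :: "complex ^ 2"
  shows "i \<noteq> j \<Longrightarrow> a \<bullet> w = Re (cnj (a $ i) * w $ i) + Re (cnj (a $ j) * w $ j)"
  by (simp add: inner_complex_vec UNIV_two[of i j] del: times_complex.sel)

section \<open>Polynomial approximation on faces\<close>

text \<open>By uniform continuity \<open>\<psi>\<close> is close to its dilate \<open>\<zeta> \<mapsto> \<psi> (r \<zeta>)\<close>, whose Taylor series converges
  uniformly on the closed disc. Approximants on the whole plane are needed because a face
  does not bound the corresponding coordinate on the domain.\<close>

lemma disc_algebra_polynomial_approximation: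
  assumes hol: "\<psi> holomorphic_on ball 0 1" and cont: "continuous_on (cball 0 1) \<psi>" and e: "e > 0"
  obtains P where "P holomorphic_on (UNIV :: complex set)" "\<And>\<zeta>. \<zeta> \<in> cball 0 1 \<Longrightarrow> norm (\<psi> \<zeta> - P \<zeta>) < e"
proof -
  have "uniformly_continuous_on (cball 0 1) \<psi>"
    using cont by (intro compact_uniformly_continuous) auto
  then obtain \<delta> where \<delta>: "\<delta> > 0"
      "\<And>x y. x \<in> cball 0 1 \<Longrightarrow> y \<in> cball 0 1 \<Longrightarrow> dist y x < \<delta> \<Longrightarrow> dist (\<psi> y) (\<psi> x) < e / 2"
    unfolding uniformly_continuous_on_def using e half_gt_zero by metis
  \<comment> \<open>The maximum with 1/2 only serves to keep \<open>r\<close> positive.\<close>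
  define r where "r = max (1/2) (1 - \<delta> / 2)"
  have r: "0 < r" "r < 1" "1 - r < \<delta>" using \<delta>(1) by (auto simp: r_def)
  define a where "a n = (deriv ^^ n) \<psi> 0 / fact n" for n
  have sums: "(\<lambda>n. a n * w ^ n) sums \<psi> w" if "norm w < 1" for w
    using holomorphic_power_series[OF hol, of w] that by (simp add: a_def)
  have nr: "norm (of_real ((1 + r) / 2) :: complex) = (1 + r) / 2" using r by (simp only: norm_of_real) simp
  \<comment> \<open>The series converges at a point of modulus strictly between \<open>r\<close> and 1.\<close>
  have "ereal (norm (of_real ((1 + r) / 2) :: complex)) \<le> conv_radius a"
    using r nr by (intro conv_radius_geI[OF sums_summable[OF sums]]) simp
  then have "ereal r < conv_radius a" using r unfolding nr by (auto intro: less_le_trans[rotated])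
  then have "uniform_limit (cball 0 r) (\<lambda>n x. \<Sum>i<n. a i * (x - 0) ^ i) (\<lambda>x. suminf (\<lambda>i. a i * (x - 0) ^ i)) sequentially"
    by (rule powser_uniform_limit)
  from uniform_limitD[OF this, of "e / 2"] e
  have "\<forall>\<^sub>F n in sequentially. \<forall>x\<in>cball 0 r. dist (\<Sum>i<n. a i * x ^ i) (suminf (\<lambda>i. a i * x ^ i)) < e / 2"
    by simp
  then obtain N where N: "\<And>x. x \<in> cball 0 r \<Longrightarrow> dist (\<Sum>i<N. a i * x ^ i) (suminf (\<lambda>i. a i * x ^ i)) < e / 2"
    unfolding eventually_sequentially by blast
  show thesis
  proof (rule that)
    show "(\<lambda>\<zeta>. \<Sum>i<N. a i * (of_real r * \<zeta>) ^ i) holomorphic_on UNIV" by (intro holomorphic_intros)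
    fix \<zeta> :: complex assume \<zeta>: "\<zeta> \<in> cball 0 1"
    define x where "x = of_real r * \<zeta>"
    have nx: "norm x \<le> r" using \<zeta> r by (simp add: x_def norm_mult)
    have "x - \<zeta> = of_real (r - 1) * \<zeta>" by (simp add: x_def algebra_simps)
    then have "dist x \<zeta> \<le> 1 - r"
      using \<zeta> r mult_left_mono[of "norm \<zeta>" 1 "1 - r"]
      by (simp add: dist_norm norm_mult abs_minus_commute del: of_real_diff)
    then have "dist (\<psi> x) (\<psi> \<zeta>) < e / 2" using \<delta>(2)[of \<zeta> x] \<zeta> r nx by simp
    moreover have "suminf (\<lambda>i. a i * x ^ i) = \<psi> x" using sums[of x] nx r by (auto intro: sums_unique[symmetric])
    then have "dist (\<Sum>i<N. a i * x ^ i) (\<psi> x) < e / 2" using N[of x] nx by simp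
    ultimately have "dist (\<psi> \<zeta>) (\<Sum>i<N. a i * x ^ i) < e"
      using dist_triangle[of "\<psi> \<zeta>" "\<Sum>i<N. a i * x ^ i" "\<psi> x"] dist_commute[of "\<psi> x" "\<psi> \<zeta>"]
        dist_commute[of "\<psi> x" "\<Sum>i<N. a i * x ^ i"] by linarith
    then show "norm (\<psi> \<zeta> - (\<Sum>i<N. a i * (of_real r * \<zeta>) ^ i)) < e" by (simp add: dist_norm x_def)
  qed
qed

text \<open>Real and imaginary part are approximated by real polynomials, which extend to the plane.\<close>

lemma real_compact_polynomial_approximation:
  fixes \<psi> :: "real \<Rightarrow> complex"
  assumes T: "compact T" and cont: "continuous_on T \<psi>" and e: "e > 0"
  obtains P where "P holomorphic_on UNIV" "\<And>t. t \<in> T \<Longrightarrow> norm (\<psi> t - P (of_real t)) < e"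
proof -
  have e2: "e / 2 > 0" using e by simp
  have cr: "continuous_on T (\<lambda>t. Re (\<psi> t))" "continuous_on T (\<lambda>t. Im (\<psi> t))"
    using cont by (auto intro!: continuous_intros)
  obtain f where f: "real_polynomial_function f" "\<And>t. t \<in> T \<Longrightarrow> \<bar>Re (\<psi> t) - f t\<bar> < e / 2"
    using Stone_Weierstrass_real_polynomial_function[OF T cr(1) e2] by blast
  obtain g where g: "real_polynomial_function g" "\<And>t. t \<in> T \<Longrightarrow> \<bar>Im (\<psi> t) - g t\<bar> < e / 2"
    using Stone_Weierstrass_real_polynomial_function[OF T cr(2) e2] by blast
  obtain a m where a: "f = (\<lambda>x. \<Sum>i\<le>m. a i * x ^ i)" using f(1) unfolding real_polynomial_function_iff_sum by blast
  obtain b n where b: "g = (\<lambda>x. \<Sum>i\<le>n. b i * x ^ i)" using g(1) unfolding real_polynomial_function_iff_sum by blast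
  define P where "P = (\<lambda>x :: complex. (\<Sum>i\<le>m. of_real (a i) * x ^ i) + \<i> * (\<Sum>i\<le>n. of_real (b i) * x ^ i))"
  show thesis
  proof (rule that)
    show "P holomorphic_on UNIV" unfolding P_def by (intro holomorphic_intros)
    fix t assume t: "t \<in> T"
    have "P (of_real t) = of_real (f t) + \<i> * of_real (g t)" by (simp add: P_def a b)
    then have "norm (\<psi> t - P (of_real t)) \<le> \<bar>Re (\<psi> t) - f t\<bar> + \<bar>Im (\<psi> t) - g t\<bar>"
      using cmod_le[of "\<psi> t - P (of_real t)"] by simp
    also have "\<dots> < e" using f(2)[OF t] g(2)[OF t] by linarith
    finally show "norm (\<psi> t - P (of_real t)) < e" .
  qed
qed

text \<open>If no coefficient of \<open>a\<close> vanishes, then on the face the two numbers \<open>cnj (a $ k) * w $ k\<close> are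
  real with sum \<open>c\<close>: the face is parametrised by one real variable, and Weierstrass
  approximation applies to every continuous function. Otherwise one coordinate is
  constant on the face, and the face is a closed disc in the other coordinate (possibly a
  point), whose interior is a holomorphic disc in the boundary; there the hypothesis on discs
  puts \<open>\<phi>\<close> into the disc algebra.\<close>

lemma face_approximation:
  fixes \<Omega> :: "(complex ^ 2) set" and \<phi> :: "complex ^ 2 \<Rightarrow> complex" and a :: "complex ^ 2"
  assumes R: "reinhardt_domain \<Omega>" and bdd: "bounded \<Omega>" and cvx: "convex \<Omega>"
    and cont: "continuous_on (closure \<Omega>) \<phi>"
    and discs: "\<And>f :: complex \<Rightarrow> complex ^ 2. (\<And>i. (\<lambda>\<zeta>. f \<zeta> $ i) holomorphic_on ball 0 1) \<Longrightarrow> f ` ball 0 1 \<subseteq> frontier \<Omega>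
        \<Longrightarrow> (\<phi> \<circ> f) holomorphic_on ball 0 1"
    and a: "a \<noteq> 0" "\<And>w. w \<in> closure \<Omega> \<Longrightarrow> a \<bullet> w \<le> c" "\<And>w. w \<in> \<Omega> \<Longrightarrow> a \<bullet> w < c"
    and e: "e > 0"
  obtains G i where "G holomorphic_on UNIV"
    "\<And>w. w \<in> closure \<Omega> \<Longrightarrow> a \<bullet> w = c \<Longrightarrow> norm (\<phi> w - G (w $ i)) < e"
proof -
  define F where "F = {w \<in> closure \<Omega>. a \<bullet> w = c}"
  have cpt: "compact (closure \<Omega>)" using bdd by simp
  have "F = closure \<Omega> \<inter> {w. a \<bullet> w = c}" by (auto simp: F_def)
  then have cF: "compact F" using compact_Int_closed[OF cpt closed_hyperplane] by simp
  have face: "cnj (a $ k) * w $ k = of_real (norm (a $ k) * norm (w $ k))"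
    if "w \<in> closure \<Omega>" "a \<bullet> w = c" for w k
    by (rule reinhardt_face[OF R a(2) that])
  obtain i :: 2 where ai: "a $ i \<noteq> 0" using a(1) by (auto simp: vec_eq_iff)
  obtain j :: 2 where ij: "i \<noteq> j" by (metis exhaust_2 zero_neq_one one_neq_zero)
  show thesis
  proof (cases "a $ j = 0")
    case False
    define t where "t w = Re (cnj (a $ i) * w $ i)" for w :: "complex ^ 2"
    define T where "T = t ` F"
    have cT: "compact T" unfolding T_def t_def
      by (intro compact_continuous_image cF continuous_intros)
    \<comment> \<open>The inverse of \<open>t\<close> on the face.\<close>
    define \<omega> where "\<omega> s = coord_pair i (of_real s / cnj (a $ i)) (of_real (c - s) / cnj (a $ j))" for s
    have \<omega>: "\<omega> (t w) = w" "of_real (t w) = cnj (a $ i) * w $ i" if "w \<in> F" for w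
    proof -
      have w: "w \<in> closure \<Omega>" "a \<bullet> w = c" using that by (auto simp: F_def)
      have re: "cnj (a $ k) * w $ k = of_real (Re (cnj (a $ k) * w $ k))" for k
        by (subst (1 2) face[OF w]) simp
      show 1: "of_real (t w) = cnj (a $ i) * w $ i" unfolding t_def by (rule re[symmetric])
      have "of_real (c - t w) = cnj (a $ j) * w $ j"
        using re[of j] inner_coord[OF ij, of a w] w(2) by (simp add: t_def del: times_complex.sel)
      then show "\<omega> (t w) = w"
        unfolding \<omega>_def 1 using ai False by (intro coord_pair_eqI[OF ij, symmetric]) auto
    qed
    have "continuous_on T (\<lambda>s. \<phi> (\<omega> s))"
    proof (rule continuous_on_compose2[OF cont])
      show "continuous_on T \<omega>" unfolding \<omega>_def by (intro continuous_intros) (use ai False in auto)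
      show "\<omega> ` T \<subseteq> closure \<Omega>" using \<omega>(1) by (auto simp: T_def F_def)
    qed
    then obtain P where P: "P holomorphic_on UNIV" "\<And>s. s \<in> T \<Longrightarrow> norm (\<phi> (\<omega> s) - P (of_real s)) < e"
      using real_compact_polynomial_approximation[OF cT _ e] by metis
    show thesis
    proof (rule that[of "\<lambda>x. P (cnj (a $ i) * x)" i])
      show "(\<lambda>x. P (cnj (a $ i) * x)) holomorphic_on UNIV"
        using holomorphic_on_compose_gen[OF _ P(1), of "\<lambda>x. cnj (a $ i) * x" UNIV]
        by (auto simp: o_def intro: holomorphic_intros)
      fix w assume "w \<in> closure \<Omega>" "a \<bullet> w = c"
      then have w: "w \<in> F" by (simp add: F_def)
      show "norm (\<phi> w - P (cnj (a $ i) * w $ i)) < e"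
        using P(2)[of "t w"] w \<omega>[OF w] by (simp add: T_def)
    qed
  next
    case True
    define q where "q = of_real c / cnj (a $ i)"
    have Fq: "w \<in> F \<longleftrightarrow> w \<in> closure \<Omega> \<and> w $ i = q" for w
    proof
      assume "w \<in> F"
      then have w: "w \<in> closure \<Omega>" "a \<bullet> w = c" by (auto simp: F_def)
      have "cnj (a $ i) * w $ i = of_real c"
        using face[OF w, of i] inner_coord[OF ij, of a w] w(2) True by simp
      then show "w \<in> closure \<Omega> \<and> w $ i = q" using w ai by (auto simp: q_def field_simps)
    next
      assume "w \<in> closure \<Omega> \<and> w $ i = q"
      then show "w \<in> F" using inner_coord[OF ij, of a w] ai True by (simp add: F_def q_def)
    qed
    show thesis
    proof (cases "F = {}")
      case True
      then show thesis by (intro that[of "\<lambda>_. 0" i]) (auto simp: F_def)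
    next
      case False
      have cj: "continuous_on F (\<lambda>w. norm (w $ j))" by (intro continuous_intros)
      obtain p where p: "p \<in> F" "\<And>w. w \<in> F \<Longrightarrow> norm (w $ j) \<le> norm (p $ j)"
        using continuous_attains_sup[OF cF False, of "\<lambda>w. norm (w $ j)", OF cj] by blast
      define s where "s = norm (p $ j)"
      define f where "f \<zeta> = coord_pair i q (of_real s * \<zeta>)" for \<zeta>
      have fF: "f \<zeta> \<in> F" if "\<zeta> \<in> cball 0 1" for \<zeta>
      proof -
        have "norm (f \<zeta> $ k) \<le> norm (p $ k)" for k
        proof (cases "k = i")
          case True
          then show ?thesis using p(1) unfolding Fq by (simp add: f_def)
        next
          case False
          then have "k = j" using UNIV_two[OF ij] by auto
          then show ?thesis using that ij by (simp add: f_def s_def norm_mult mult_left_le)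
        qed
        then have "f \<zeta> \<in> closure \<Omega>"
          using reinhardt_closure_smaller[OF R cvx, of p "f \<zeta>"] p(1) unfolding Fq by blast
        then show ?thesis unfolding Fq by (simp add: f_def)
      qed
      have "(\<phi> \<circ> f) holomorphic_on ball 0 1"
      proof (rule discs)
        show "(\<lambda>\<zeta>. f \<zeta> $ k) holomorphic_on ball 0 1" for k
          unfolding f_def by (cases "k = i") (auto intro: holomorphic_intros)
        have "f \<zeta> \<in> frontier \<Omega>" if "\<zeta> \<in> ball 0 1" for \<zeta>
          using fF[of \<zeta>] a(3)[of "f \<zeta>"] that R
          by (auto simp: F_def frontier_def interior_open reinhardt_domain_def)
        then show "f ` ball 0 1 \<subseteq> frontier \<Omega>" by blast
      qed
      moreover have "continuous_on (cball 0 1) (\<phi> \<circ> f)"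
        unfolding o_def
      proof (rule continuous_on_compose2[OF cont])
        show "continuous_on (cball 0 1) f" unfolding f_def by (intro continuous_intros)
        show "f ` cball 0 1 \<subseteq> closure \<Omega>" using fF by (auto simp: F_def)
      qed
      ultimately obtain P where P: "P holomorphic_on UNIV"
          "\<And>\<zeta>. \<zeta> \<in> cball 0 1 \<Longrightarrow> norm ((\<phi> \<circ> f) \<zeta> - P \<zeta>) < e"
        using disc_algebra_polynomial_approximation[OF _ _ e] by metis
      show thesis
      proof (rule that[of "\<lambda>x. P (x / of_real s)" j])
        have "(\<lambda>x. inverse (of_real s) * x) holomorphic_on UNIV" by (intro holomorphic_intros)
        from holomorphic_on_compose_gen[OF this P(1)]
        show "(\<lambda>x. P (x / of_real s)) holomorphic_on UNIV" by (simp add: o_def divide_inverse mult.commute)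
        fix w assume "w \<in> closure \<Omega>" "a \<bullet> w = c"
        then have w: "w \<in> F" by (simp add: F_def)
        have le: "norm (w $ j) \<le> s" using p(2)[OF w] by (simp add: s_def)
        \<comment> \<open>For \<open>s = 0\<close> the face is one point, and division by zero gives \<open>\<zeta> = 0\<close> as wanted.\<close>
        define \<zeta> where "\<zeta> = w $ j / of_real s"
        have "norm \<zeta> \<le> 1" using le by (simp add: \<zeta>_def norm_divide divide_le_eq_1 s_def)
        moreover have "of_real s * \<zeta> = w $ j" using le by (auto simp: \<zeta>_def)
        then have "f \<zeta> = w" using w unfolding Fq f_def by (intro coord_pair_eqI[OF ij, symmetric]) auto
        ultimately show "norm (\<phi> w - P (w $ j / of_real s)) < e"
          using P(2)[of \<zeta>] by (simp add: \<zeta>_def)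
      qed
    qed
  qed
qed

section \<open>Hankel norms near a boundary point\<close>

lemma scv_linear:
  fixes f :: "complex ^ 'n \<Rightarrow> complex"
  assumes "bounded_linear f" "\<And>c v. f (c *s v) = c * f v"
  shows "scv_holomorphic_on f \<Omega>"
  unfolding scv_holomorphic_on_def
  by (intro ballI exI[of _ f] conjI allI bounded_linear_imp_has_derivative assms)

lemma continuous_closure_bounded:
  fixes f :: "'a::euclidean_space \<Rightarrow> complex"
  assumes "bounded \<Omega>" "continuous_on (closure \<Omega>) f"
  obtains B where "B > 0" "\<And>w. w \<in> closure \<Omega> \<Longrightarrow> norm (f w) \<le> B"
proof -
  have "compact (f ` closure \<Omega>)" using assms by (intro compact_continuous_image) auto
  then have "bounded (f ` closure \<Omega>)" by (rule compact_imp_bounded)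
  then obtain B where "B > 0" "\<forall>x\<in>f ` closure \<Omega>. norm x \<le> B"
    unfolding bounded_pos by (elim exE conjE)
  then show ?thesis by (intro that[of B]) auto
qed

text \<open>The function \<open>g\<close> approximates \<open>\<phi>\<close> on the face exposed by \<open>a\<close>. Off a neighbourhood of that
  face \<open>c - a \<bullet> w\<close> is bounded below, so a large multiple \<open>C\<close> of it absorbs the remaining
  difference. The resulting bound for the Hankel norm at \<open>z\<close> is \<open>\<epsilon>\<^sup>2 + C (c - a \<bullet> z)\<close>, which is
  small near \<open>p\<close>.\<close>

lemma hankel_small_near_boundary_point:
  fixes \<Omega> :: "(complex ^ 2) set" and \<phi> :: "complex ^ 2 \<Rightarrow> complex"
  assumes R: "reinhardt_domain \<Omega>" and bdd: "bounded \<Omega>" and cvx: "convex \<Omega>"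
    and cont: "continuous_on (closure \<Omega>) \<phi>"
    and discs: "\<And>f :: complex \<Rightarrow> complex ^ 2. (\<And>i. (\<lambda>\<zeta>. f \<zeta> $ i) holomorphic_on ball 0 1)
        \<Longrightarrow> f ` ball 0 1 \<subseteq> frontier \<Omega> \<Longrightarrow> (\<phi> \<circ> f) holomorphic_on ball 0 1"
    and p: "p \<in> frontier \<Omega>" and e: "e > 0"
  shows "\<exists>U. open U \<and> p \<in> U \<and> (\<forall>z\<in>U \<inter> \<Omega>.
    (L2_norm \<Omega> (hankel_operator \<Omega> \<phi> (normalized_bergman_kernel \<Omega> z)))\<^sup>2 < e)"
proof -
  have op: "open \<Omega>" and ne: "\<Omega> \<noteq> {}" using R by (auto simp: reinhardt_domain_def)
  have cpt: "compact (closure \<Omega>)" using bdd by simp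
  obtain a where a: "a \<noteq> 0" "\<And>w. w \<in> closure \<Omega> \<Longrightarrow> a \<bullet> w \<le> a \<bullet> p" "\<And>w. w \<in> \<Omega> \<Longrightarrow> a \<bullet> w < a \<bullet> p"
    using supporting_functional[OF op cvx ne p] by metis
  define c where "c = a \<bullet> p"
  note a = a[folded c_def]
  define \<epsilon> where "\<epsilon> = sqrt e / 2"
  have \<epsilon>: "\<epsilon> > 0" "\<epsilon>\<^sup>2 = e / 4" using e by (auto simp: \<epsilon>_def power_divide)
  obtain G i where G: "G holomorphic_on UNIV"
    "\<And>w. w \<in> closure \<Omega> \<Longrightarrow> a \<bullet> w = c \<Longrightarrow> norm (\<phi> w - G (w $ i)) < \<epsilon>"
    using face_approximation[OF R bdd cvx cont discs a \<epsilon>(1)] by metis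
  define g where "g w = G (w $ i)" for w :: "complex ^ 2"
  have hg: "scv_holomorphic_on g S" for S
    unfolding g_def by (rule scv_coordinate[OF open_UNIV G(1)]) simp
  have cg: "continuous_on (closure \<Omega>) g" by (rule scv_holomorphic_imp_continuous[OF hg])
  obtain Bg where Bg: "\<And>w. w \<in> closure \<Omega> \<Longrightarrow> norm (g w) \<le> Bg"
    using continuous_closure_bounded[OF bdd cg] by metis
  obtain B\<phi> where B\<phi>: "\<And>w. w \<in> closure \<Omega> \<Longrightarrow> norm (\<phi> w) \<le> B\<phi>"
    using continuous_closure_bounded[OF bdd cont] by metis
  have cd: "continuous_on (closure \<Omega>) (\<lambda>w. \<phi> w - g w)" by (intro continuous_intros cont cg)
  obtain M where M: "M > 0" "\<And>w. w \<in> closure \<Omega> \<Longrightarrow> norm (\<phi> w - g w) \<le> M"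
    using continuous_closure_bounded[OF bdd cd] by metis
  define S where "S = {w \<in> closure \<Omega>. \<epsilon> \<le> norm (\<phi> w - g w)}"
  have "compact S"
  proof -
    have "closed (closure \<Omega> \<inter> (\<lambda>w. norm (\<phi> w - g w)) -` {\<epsilon>..})"
      by (intro continuous_closed_preimage continuous_intros cont cg) auto
    moreover have "S = closure \<Omega> \<inter> (closure \<Omega> \<inter> (\<lambda>w. norm (\<phi> w - g w)) -` {\<epsilon>..})" by (auto simp: S_def)
    ultimately show ?thesis using compact_Int_closed[OF cpt] by metis
  qed
  have pos: "0 < c - a \<bullet> w" if "w \<in> S" for w
    using that a(2)[of w] G(2)[of w] by (force simp: S_def g_def)
  obtain m where m: "m > 0" "\<And>w. w \<in> S \<Longrightarrow> m \<le> c - a \<bullet> w"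
  proof (cases "S = {}")
    case True then show ?thesis using that[of 1] by auto
  next
    case False
    obtain w0 where "w0 \<in> S" "\<And>w. w \<in> S \<Longrightarrow> c - a \<bullet> w0 \<le> c - a \<bullet> w"
      using continuous_attains_inf[OF \<open>compact S\<close> False, of "\<lambda>w. c - a \<bullet> w"]
      by (force intro!: continuous_intros)
    then show ?thesis using that[of "c - a \<bullet> w0"] pos by auto
  qed
  define C where "C = M\<^sup>2 / m"
  have C: "C > 0" using M m by (simp add: C_def)
  have est: "(norm (\<phi> w - g w))\<^sup>2 \<le> \<epsilon>\<^sup>2 + C * (c - a \<bullet> w)" if w: "w \<in> closure \<Omega>" for w
  proof (cases "w \<in> S")
    case True
    have "(norm (\<phi> w - g w))\<^sup>2 \<le> M\<^sup>2" using M(2)[OF w] by (intro power_mono) auto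
    also have "M\<^sup>2 = C * m" using m by (simp add: C_def)
    also have "\<dots> \<le> C * (c - a \<bullet> w)" using m(2)[OF True] C by (intro mult_left_mono) auto
    finally show ?thesis by (simp add: add_increasing)
  next
    case False
    then have "(norm (\<phi> w - g w))\<^sup>2 \<le> \<epsilon>\<^sup>2" using w by (intro power_mono) (auto simp: S_def)
    moreover have "0 \<le> C * (c - a \<bullet> w)" using C a(2)[OF w] by (intro mult_nonneg_nonneg) auto
    ultimately show ?thesis by simp
  qed
  define L where "L w = (\<Sum>k\<in>UNIV. cnj (a $ k) * w $ k)" for w :: "complex ^ 2"
  have bl: "bounded_linear L" unfolding L_def
    by (intro bounded_linear_sum bounded_linear_const_mult bounded_linear_vec_nth)
  have hL: "scv_holomorphic_on L S" for S
    by (rule scv_linear[OF bl]) (simp add: L_def sum_distrib_left algebra_simps)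
  define l where "l w = of_real (\<epsilon>\<^sup>2 + C * c) + of_real (- C) * L w" for w
  have hl: "scv_holomorphic_on l S" for S unfolding l_def by (intro scv_add scv_mult scv_const hL)
  have Rel: "Re (l w) = \<epsilon>\<^sup>2 + C * (c - a \<bullet> w)" for w
  proof -
    have "Re (L w) = a \<bullet> w" by (simp add: L_def inner_complex_vec del: times_complex.sel)
    then show ?thesis by (simp add: l_def algebra_simps)
  qed
  obtain Bl where Bl: "\<And>w. w \<in> closure \<Omega> \<Longrightarrow> norm (l w) \<le> Bl"
    using continuous_closure_bounded[OF bdd scv_holomorphic_imp_continuous[OF hl]] by metis
  have sub: "w \<in> \<Omega> \<Longrightarrow> w \<in> closure \<Omega>" for w using closure_subset by blast
  have m\<phi>: "\<phi> \<in> borel_measurable (lebesgue_on \<Omega>)"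
    using continuous_on_subset[OF cont closure_subset] op by (intro continuous_imp_measurable_on_sets_lebesgue) auto
  have H: "(L2_norm \<Omega> (hankel_operator \<Omega> \<phi> (normalized_bergman_kernel \<Omega> z)))\<^sup>2 \<le> \<epsilon>\<^sup>2 + C * (c - a \<bullet> z)"
    if "z \<in> \<Omega>" for z
    unfolding Rel[symmetric]
    by (rule hankel_norm_le_peak[OF op bdd that m\<phi> B\<phi> hg Bg hl Bl]) (simp_all add: sub Rel est)
  let ?U = "{z. C * (c - a \<bullet> z) < e / 2}"
  have "open ?U" by (intro open_Collect_less continuous_intros)
  moreover have "p \<in> ?U" using e by (simp add: c_def)
  moreover have "(L2_norm \<Omega> (hankel_operator \<Omega> \<phi> (normalized_bergman_kernel \<Omega> z)))\<^sup>2 < e" if "z \<in> ?U \<inter> \<Omega>" for z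
    using H[of z] that \<epsilon>(2) e by auto
  ultimately show ?thesis by blast
qed

text \<open>The frontier is compact, so any choice of neighbourhoods of its points covers all points
  within some fixed distance of it.\<close>

lemma tendsto_to_boundary_zeroI:
  fixes \<Omega> :: "(complex ^ 'n) set" and H :: "complex ^ 'n \<Rightarrow> real"
  assumes \<Omega>: "bounded \<Omega>" "open \<Omega>" "\<Omega> \<noteq> {}"
    and pos: "\<And>z. 0 \<le> H z"
    and loc: "\<And>p e. p \<in> frontier \<Omega> \<Longrightarrow> e > 0 \<Longrightarrow> \<exists>U. open U \<and> p \<in> U \<and> (\<forall>z\<in>U \<inter> \<Omega>. H z < e)"
  shows "(H \<longlongrightarrow> 0) (to_boundary \<Omega>)"
proof (rule tendstoI)
  fix e :: real assume e: "e > 0"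
  define V where "V = \<Union>{U. open U \<and> (\<forall>z\<in>U \<inter> \<Omega>. H z < e)}"
  have V: "open V" "frontier \<Omega> \<subseteq> V" using loc[OF _ e] by (auto simp: V_def)
  have "frontier \<Omega> \<noteq> {}"
    using \<Omega> not_bounded_UNIV[where 'a="complex ^ 'n"] by (auto simp: frontier_eq_empty)
  then obtain d where d: "d > 0" "{x. infdist x (frontier \<Omega>) \<le> d} \<subseteq> V"
    using compact_in_open_separated[OF _ compact_frontier_bounded[OF \<Omega>(1)] V] by blast
  have "\<forall>\<^sub>F t in nhds 0. \<bar>t :: real\<bar> < d"
    using d(1) by (auto simp: eventually_nhds_metric dist_norm)
  moreover have "dist (H x) 0 < e" if "\<bar>infdist x (frontier \<Omega>)\<bar> < d" "x \<in> \<Omega>" for x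
    using that d(2) pos[of x] by (force simp: V_def)
  ultimately show "\<forall>\<^sub>F x in to_boundary \<Omega>. dist (H x) 0 < e"
    unfolding to_boundary_def eventually_inf_principal eventually_filtercomap by blast
qed

section \<open>Averages over polydiscs\<close>

lemma Basis_complex_2:
  assumes "i \<noteq> j"
  shows "(Basis :: (complex ^ 2) set) = {axis i 1, axis i \<i>, axis j 1, axis j \<i>}"
  unfolding Basis_vec_def Basis_complex_def UNIV_two[OF assms] by auto

lemma measure_coord_box:
  fixes m :: "complex ^ 2"
  assumes ij: "i \<noteq> j" and "\<alpha> \<ge> 0" "\<beta> \<ge> 0"
  defines "M \<equiv> coord_pair i (of_real \<alpha> * (1 + \<i>)) (of_real \<beta> * (1 + \<i>))"
  shows "measure lborel (cbox (m - M) (m + M)) = 16 * \<alpha>\<^sup>2 * \<beta>\<^sup>2"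
    and "w \<in> cbox (m - M) (m + M) \<longleftrightarrow> \<bar>Re (w $ i - m $ i)\<bar> \<le> \<alpha> \<and> \<bar>Im (w $ i - m $ i)\<bar> \<le> \<alpha> \<and>
        \<bar>Re (w $ j - m $ j)\<bar> \<le> \<beta> \<and> \<bar>Im (w $ j - m $ j)\<bar> \<le> \<beta>"
proof -
  note B = Basis_complex_2[OF ij]
  have in1: "(v :: complex ^ 2) \<bullet> axis k 1 = Re (v $ k)" "v \<bullet> axis k \<i> = Im (v $ k)" for v k
    by (simp_all add: inner_axis inner_complex_def)
  have Mi: "M $ i = of_real \<alpha> * (1 + \<i>)" "M $ j = of_real \<beta> * (1 + \<i>)" using ij by (simp_all add: M_def)
  show "w \<in> cbox (m - M) (m + M) \<longleftrightarrow> \<bar>Re (w $ i - m $ i)\<bar> \<le> \<alpha> \<and> \<bar>Im (w $ i - m $ i)\<bar> \<le> \<alpha> \<and>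
        \<bar>Re (w $ j - m $ j)\<bar> \<le> \<beta> \<and> \<bar>Im (w $ j - m $ j)\<bar> \<le> \<beta>"
    unfolding mem_box B by (simp add: in1 Mi abs_le_iff) argo
  have ne: "axis i 1 \<noteq> (axis i \<i> :: complex ^ 2)" "axis i 1 \<noteq> (axis j 1 :: complex ^ 2)"
    "axis i 1 \<noteq> (axis j \<i> :: complex ^ 2)" "axis i \<i> \<noteq> (axis j 1 :: complex ^ 2)"
    "axis i \<i> \<noteq> (axis j \<i> :: complex ^ 2)" "axis j 1 \<noteq> (axis j \<i> :: complex ^ 2)"
    using ij by (auto simp: axis_eq_axis complex_eq_iff)
  have "measure lborel (cbox (m - M) (m + M)) = (\<Prod>e\<in>Basis. (m + M) \<bullet> e - (m - M) \<bullet> e)"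
    by (rule content_cbox) (use assms in \<open>auto simp: B in1 Mi\<close>)
  also have "\<dots> = (2 * \<alpha>) * (2 * \<alpha>) * (2 * \<beta>) * (2 * \<beta>)"
    unfolding B using ne by (simp add: in1 Mi)
  finally show "measure lborel (cbox (m - M) (m + M)) = 16 * \<alpha>\<^sup>2 * \<beta>\<^sup>2"
    by (simp add: power2_eq_square)
qed

definition polydisc :: "2 \<Rightarrow> real \<Rightarrow> real \<Rightarrow> (complex ^ 2) set" where
  "polydisc i \<alpha> \<beta> = {v. norm (v $ i) \<le> \<alpha> \<and> (\<forall>k. k \<noteq> i \<longrightarrow> norm (v $ k) \<le> \<beta>)}"

lemma mem_polydisc: "i \<noteq> j \<Longrightarrow> v \<in> polydisc i \<alpha> \<beta> \<longleftrightarrow> norm (v $ i) \<le> \<alpha> \<and> norm (v $ j) \<le> \<beta>"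
  using UNIV_two[of i j] by (auto simp: polydisc_def)

lemma norm_pair_le:
  fixes v :: "complex ^ 2"
  shows "i \<noteq> j \<Longrightarrow> norm v \<le> norm (v $ i) + norm (v $ j)"
  using L2_set_le_sum[of UNIV "\<lambda>k. norm (v $ k)"] by (simp add: norm_vec_def UNIV_two[of i j])

lemma polydisc_compact: "compact (polydisc i \<alpha> \<beta>)"
proof -
  obtain j where ij: "i \<noteq> j" by (metis exhaust_2 zero_neq_one one_neq_zero)
  have eq: "polydisc i \<alpha> \<beta> = {v. norm (v $ i) \<le> \<alpha>} \<inter> {v. norm (v $ j) \<le> \<beta>}"
    using mem_polydisc[OF ij] by auto
  have "closed (polydisc i \<alpha> \<beta>)"
    unfolding eq by (intro closed_Int closed_Collect_le continuous_intros)
  moreover have "bounded (polydisc i \<alpha> \<beta>)"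
  proof (rule boundedI)
    fix v assume "v \<in> polydisc i \<alpha> \<beta>"
    then show "norm v \<le> \<alpha> + \<beta>" using norm_pair_le[OF ij, of v] mem_polydisc[OF ij] by fastforce
  qed
  ultimately show ?thesis by (simp add: compact_eq_bounded_closed)
qed

lemma polydisc_balanced: "v \<in> polydisc i \<alpha> \<beta> \<Longrightarrow> norm \<zeta> \<le> 1 \<Longrightarrow> \<zeta> *s v \<in> polydisc i \<alpha> \<beta>"
  by (auto simp: polydisc_def norm_mult intro: order_trans[OF mult_left_le_one_le])

lemma polydisc_measure_ge:
  assumes "\<alpha> \<ge> 0" "\<beta> \<ge> 0"
  shows "(\<alpha> * \<beta>)\<^sup>2 \<le> measure lebesgue (polydisc i \<alpha> \<beta>)"
proof -
  obtain j where ij: "i \<noteq> j" by (metis exhaust_2 zero_neq_one one_neq_zero)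
  \<comment> \<open>The modulus is at most the sum of real and imaginary part, so a box of half the size fits.\<close>
  define M where "M = coord_pair i (of_real (\<alpha>/2) * (1 + \<i>)) (of_real (\<beta>/2) * (1 + \<i>))"
  have "\<alpha>/2 \<ge> 0" "\<beta>/2 \<ge> 0" using assms by auto
  note box = measure_coord_box[OF ij this, where m=0, folded M_def]
  have "cbox (0 - M) (0 + M) \<subseteq> polydisc i \<alpha> \<beta>"
  proof
    fix v assume "v \<in> cbox (0 - M) (0 + M)"
    then have "\<bar>Re (v $ i)\<bar> \<le> \<alpha>/2" "\<bar>Im (v $ i)\<bar> \<le> \<alpha>/2" "\<bar>Re (v $ j)\<bar> \<le> \<beta>/2" "\<bar>Im (v $ j)\<bar> \<le> \<beta>/2"
      unfolding box(2) by auto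
    then show "v \<in> polydisc i \<alpha> \<beta>"
      unfolding mem_polydisc[OF ij] using cmod_le[of "v $ i"] cmod_le[of "v $ j"] by linarith
  qed
  then have "measure lebesgue (cbox (0 - M) (0 + M)) \<le> measure lebesgue (polydisc i \<alpha> \<beta>)"
    by (rule measure_mono_fmeasurable) (auto intro: lmeasurable_compact polydisc_compact)
  then show ?thesis using box(1) assms by (simp add: power_mult_distrib power_divide)
qed

lemma bergman_value_le_polydisc:
  fixes \<Omega> :: "(complex ^ 2) set"
  assumes f: "f \<in> bergman_space \<Omega>" and \<Omega>: "open \<Omega>" and ab: "\<alpha> > 0" "\<beta> > 0"
    and sub: "(+) p ` polydisc i \<alpha> \<beta> \<subseteq> \<Omega>"
  shows "norm (f p) \<le> L2_norm \<Omega> f / (\<alpha> * \<beta>)"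
proof -
  have le: "(\<alpha> * \<beta>)\<^sup>2 \<le> measure lebesgue (polydisc i \<alpha> \<beta>)" using ab by (intro polydisc_measure_ge) auto
  moreover have "0 < (\<alpha> * \<beta>)\<^sup>2" using ab by simp
  ultimately have m: "0 < measure lebesgue (polydisc i \<alpha> \<beta>)" by linarith
  have "norm (f p) \<le> L2_norm \<Omega> f / sqrt (measure lebesgue (polydisc i \<alpha> \<beta>))"
    by (rule bergman_value_le[OF f \<Omega> polydisc_compact m polydisc_balanced sub])
  also have "\<dots> \<le> L2_norm \<Omega> f / (\<alpha> * \<beta>)"
    using ab real_le_rsqrt[OF le] by (intro divide_left_mono) (auto simp: L2_norm_nonneg m)
  finally show ?thesis .
qed

text \<open>Averaging over the polydisc reproduces \<open>k p\<close> and \<open>h p\<close>. With \<open>\<phi>\<close> replaced by the constant \<open>c\<close> at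
  the cost of its oscillation, what is left is the average of \<open>\<phi> k - h\<close>, bounded through its
  \<open>L\<^sup>2\<close> norm. The oscillation is multiplied by a supremum of \<open>k\<close>, not by its norm, so that
  it may be made small by shrinking the polydisc.\<close>

lemma polydisc_average_difference:
  fixes \<Omega> :: "(complex ^ 2) set" and \<phi> :: "complex ^ 2 \<Rightarrow> complex"
  assumes \<Omega>: "open \<Omega>" and k: "k \<in> bergman_space \<Omega>" and h: "h \<in> bergman_space \<Omega>"
    and \<phi>: "continuous_on \<Omega> \<phi>" "(\<lambda>w. \<phi> w * k w - h w) \<in> L2_space \<Omega>"
    and ab: "\<alpha> > 0" "\<beta> > 0" and sub: "(+) p ` polydisc i \<alpha> \<beta> \<subseteq> \<Omega>"
    and o: "\<And>w. w \<in> (+) p ` polydisc i \<alpha> \<beta> \<Longrightarrow> norm (\<phi> w - c) \<le> \<epsilon>"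
    and B: "\<And>w. w \<in> (+) p ` polydisc i \<alpha> \<beta> \<Longrightarrow> norm (k w) \<le> B"
  shows "norm (c * k p - h p) \<le> \<epsilon> * B + L2_norm \<Omega> (\<lambda>w. \<phi> w * k w - h w) / (\<alpha> * \<beta>)"
proof -
  define S where "S = (+) p ` polydisc i \<alpha> \<beta>"
  define m where "m = measure lebesgue (polydisc i \<alpha> \<beta>)"
  define N where "N = L2_norm \<Omega> (\<lambda>w. \<phi> w * k w - h w)"
  have le: "(\<alpha> * \<beta>)\<^sup>2 \<le> m" unfolding m_def using ab by (intro polydisc_measure_ge) auto
  have "0 < (\<alpha> * \<beta>)\<^sup>2" using ab by simp
  then have m: "m > 0" using le by linarith
  have S: "compact S" "S \<subseteq> \<Omega>" using sub by (auto simp: S_def compact_translation polydisc_compact)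
  have mS: "measure lebesgue S = m" by (simp add: S_def m_def measure_translation)
  have ck: "continuous_on S k" "continuous_on S h" "continuous_on S \<phi>"
    using S \<phi> scv_holomorphic_imp_continuous[OF bergman_holomorphic[OF k]]
      scv_holomorphic_imp_continuous[OF bergman_holomorphic[OF h]] by (auto intro: continuous_on_subset)
  have i1: "integrable (lebesgue_on S) (\<lambda>w. (c - \<phi> w) * k w)"
    and i2: "integrable (lebesgue_on S) (\<lambda>w. \<phi> w * k w - h w)"
    and ik: "integrable (lebesgue_on S) (\<lambda>w. c * k w)" and ih: "integrable (lebesgue_on S) h"
    by (intro lebesgue_integrable_compact S continuous_intros ck)+
  have "of_real m * (c * k p - h p) = c * (LINT w|lebesgue_on S. k w) - (LINT w|lebesgue_on S. h w)"
    unfolding S_def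
    using mean_value_translate[OF bergman_holomorphic[OF k] polydisc_compact polydisc_balanced sub]
      mean_value_translate[OF bergman_holomorphic[OF h] polydisc_compact polydisc_balanced sub]
    by (simp add: m_def scaleR_conv_of_real algebra_simps)
  also have "\<dots> = (LINT w|lebesgue_on S. c * k w - h w)" using ik ih by simp
  also have "\<dots> = (LINT w|lebesgue_on S. (c - \<phi> w) * k w + (\<phi> w * k w - h w))"
    by (rule arg_cong[where f="integral\<^sup>L (lebesgue_on S)"]) (auto simp: algebra_simps)
  also have "\<dots> = (LINT w|lebesgue_on S. (c - \<phi> w) * k w) + (LINT w|lebesgue_on S. \<phi> w * k w - h w)"
    by (rule Bochner_Integration.integral_add[OF i1 i2])
  finally have "norm (of_real m * (c * k p - h p))
      \<le> norm (LINT w|lebesgue_on S. (c - \<phi> w) * k w) + norm (LINT w|lebesgue_on S. \<phi> w * k w - h w)"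
    by (simp add: norm_triangle_ineq)
  moreover have "norm (LINT w|lebesgue_on S. (c - \<phi> w) * k w) \<le> \<epsilon> * B * m"
  proof -
    have "norm (LINT w|lebesgue_on S. (c - \<phi> w) * k w) \<le> (LINT w|lebesgue_on S. norm ((c - \<phi> w) * k w))"
      by (rule integral_norm_bound)
    also have "\<dots> \<le> (LINT w|lebesgue_on S. \<epsilon> * B)"
    proof (rule integral_mono)
      show "integrable (lebesgue_on S) (\<lambda>w. norm ((c - \<phi> w) * k w))" using i1 by (rule integrable_norm)
      show "integrable (lebesgue_on S) (\<lambda>w. \<epsilon> * B)"
        by (intro lebesgue_integrable_compact S continuous_intros)
      fix w assume "w \<in> space (lebesgue_on S)"
      then have w: "w \<in> (+) p ` polydisc i \<alpha> \<beta>" by (simp add: S_def)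
      show "norm ((c - \<phi> w) * k w) \<le> \<epsilon> * B"
        unfolding norm_mult using o[OF w] B[OF w] order_trans[OF norm_ge_zero o[OF w]]
        by (intro mult_mono) (auto simp: norm_minus_commute)
    qed
    also have "\<dots> = \<epsilon> * B * m" using S mS by (simp add: measure_restrict_space compact_imp_closed)
    finally show ?thesis .
  qed
  moreover have "norm (LINT w|lebesgue_on S. \<phi> w * k w - h w) \<le> sqrt m * N"
    using norm_integral_le_L2_norm[OF \<phi>(2) \<Omega> S] by (simp add: mS N_def)
  ultimately have "m * norm (c * k p - h p) \<le> \<epsilon> * B * m + sqrt m * N"
    using m by (simp add: norm_mult)
  then have "norm (c * k p - h p) \<le> \<epsilon> * B + sqrt m * N / m"
    using m by (simp add: field_simps)
  also have "sqrt m * N / m = N / sqrt m" using m real_sqrt_mult_self[of m] by (simp add: field_simps)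
  also have "N / sqrt m \<le> N / (\<alpha> * \<beta>)"
    using ab real_le_rsqrt[OF le] m by (intro divide_left_mono) (auto simp: L2_norm_nonneg N_def)
  finally show ?thesis by (simp add: N_def)
qed

section \<open>A test function for the growth of the kernel\<close>

lemma measure_strip_le:
  fixes \<Omega> :: "(complex ^ 2) set"
  assumes \<Omega>: "open \<Omega>" "\<Omega> \<subseteq> cball 0 R" and R: "R \<ge> 0" and t: "t \<ge> 0"
  shows "emeasure (lebesgue_on \<Omega>) {w \<in> \<Omega>. norm (w $ i - q) \<le> t} \<le> ennreal (16 * R\<^sup>2 * t\<^sup>2)"
proof -
  obtain j where ij: "i \<noteq> j" by (metis exhaust_2 zero_neq_one one_neq_zero)
  define M where "M = coord_pair i (of_real t * (1 + \<i>)) (of_real R * (1 + \<i>))"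
  let ?m = "coord_pair i q 0"
  note box = measure_coord_box[OF ij t R, where m="?m", folded M_def]
  let ?S = "{w \<in> \<Omega>. norm (w $ i - q) \<le> t}"
  have sub: "?S \<subseteq> cbox (?m - M) (?m + M)"
  proof
    fix w assume w: "w \<in> ?S"
    then have "norm (w $ j) \<le> R" using \<Omega>(2) order_trans[OF Finite_Cartesian_Product.norm_nth_le[of w j]] by auto
    then show "w \<in> cbox (?m - M) (?m + M)"
      unfolding box(2) using w ij
      by (auto intro: order_trans[OF abs_Re_le_cmod[of "w $ i - q", simplified]]
          order_trans[OF abs_Im_le_cmod[of "w $ i - q", simplified]]
          order_trans[OF abs_Re_le_cmod] order_trans[OF abs_Im_le_cmod])
  qed
  have "emeasure (lebesgue_on \<Omega>) ?S = emeasure lebesgue ?S"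
    using \<Omega> by (intro emeasure_restrict_space) auto
  also have "\<dots> \<le> emeasure lebesgue (cbox (?m - M) (?m + M))" using sub by (intro emeasure_mono) auto
  also have "\<dots> = ennreal (measure lborel (cbox (?m - M) (?m + M)))"
    using emeasure_eq_ennreal_measure[of lborel "cbox (?m - M) (?m + M)"] emeasure_lborel_cbox_finite[of "?m - M" "?m + M"]
    by (simp add: less_top[symmetric])
  finally show ?thesis unfolding box(1) by (simp add: mult_ac)
qed

lemma dyadic_bracket:
  fixes x d :: real
  assumes "0 < d" "d \<le> x"
  obtains k :: nat where "2 ^ k * d \<le> x" "x < 2 ^ Suc k * d"
proof -
  obtain n :: nat where "x / d < 2 ^ n" using real_arch_pow[of 2 "x / d"] by auto
  then have n: "x < 2 ^ n * d" using assms by (simp add: field_simps)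
  define l where "l = (LEAST n :: nat. x < 2 ^ n * d)"
  have l: "x < 2 ^ l * d" unfolding l_def using n by (rule LeastI)
  then have "l \<noteq> 0" using assms by (intro notI) simp
  then obtain k where k: "l = Suc k" by (cases l) auto
  have "\<not> x < 2 ^ k * d" using not_less_Least[of k "\<lambda>n. x < 2 ^ n * d"] k by (simp add: l_def)
  then show thesis using that[of k] l k by auto
qed

text \<open>The integral of \<open>|w $ i - q|\<^sup>-\<^sup>4\<close> is split over the dyadic annuli \<open>2\<^sup>n d \<le> |w $ i - q| < 2\<^sup>n\<^sup>+\<^sup>1 d\<close>: the
  integrand is of order \<open>16\<^sup>-\<^sup>n d\<^sup>-\<^sup>4\<close> there and the measure of order \<open>4\<^sup>n d\<^sup>2\<close>, which leaves a geometric series.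
  At points of distance about \<open>d\<close> from \<open>q\<close> the function has size \<open>d\<^sup>-\<^sup>2\<close> and norm of order \<open>d\<^sup>-\<^sup>1\<close>, so it forces
  \<open>K(z,z)\<close> to grow at least like \<open>d\<^sup>-\<^sup>2\<close>.\<close>

lemma inverse_square_norm_le:
  fixes \<Omega> :: "(complex ^ 2) set"
  assumes \<Omega>: "open \<Omega>" "\<Omega> \<subseteq> cball 0 R" and R: "R > 0" and d: "d > 0"
    and far: "\<And>w. w \<in> \<Omega> \<Longrightarrow> d \<le> norm (w $ i - q)"
  defines "f \<equiv> \<lambda>w. if w \<in> \<Omega> then inverse ((w $ i - q)\<^sup>2) else 0"
  shows "f \<in> bergman_space \<Omega>" and "L2_norm \<Omega> f \<le> 10 * R / d"
proof -
  have bdd: "bounded \<Omega>" using bounded_subset[OF bounded_cball \<Omega>(2)] .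
  have hol: "scv_holomorphic_on (\<lambda>w. (\<lambda>x. inverse ((x - q)\<^sup>2)) (w $ i)) \<Omega>"
  proof (rule scv_coordinate)
    show "open (- {q})" by auto
    show "(\<lambda>x. inverse ((x - q)\<^sup>2)) holomorphic_on - {q}" by (intro holomorphic_intros) auto
    show "w $ i \<in> - {q}" if "w \<in> \<Omega>" for w using far[OF that] d by auto
  qed
  have nf: "norm (inverse ((w $ i - q)\<^sup>2)) = inverse ((norm (w $ i - q))\<^sup>2)" for w
    by (simp add: norm_inverse norm_power)
  show fb: "f \<in> bergman_space \<Omega>"
    unfolding f_def
  proof (rule bounded_holomorphic_bergman[OF \<Omega>(1) bdd hol])
    show "norm (inverse ((w $ i - q)\<^sup>2)) \<le> inverse (d\<^sup>2)" if "w \<in> \<Omega>" for w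
      unfolding nf using far[OF that] d by (intro le_imp_inverse_le power_mono) auto
  qed
  \<comment> \<open>Discs in place of annuli: the larger sets are as good for an upper bound.\<close>
  define S where "S n = {w \<in> \<Omega>. norm (w $ i - q) \<le> 2 ^ Suc n * d}" for n
  define a where "a n = inverse ((2 ^ n * d) ^ 4)" for n :: nat
  have Sm: "S n \<in> sets (lebesgue_on \<Omega>)" for n
  proof -
    have "closed {w :: complex ^ 2. norm (w $ i - q) \<le> 2 ^ Suc n * d}"
      by (intro closed_Collect_le continuous_intros)
    moreover have "S n = {w. norm (w $ i - q) \<le> 2 ^ Suc n * d} \<inter> \<Omega>" by (auto simp: S_def)
    ultimately show ?thesis using \<Omega> by (auto simp: sets_restrict_space)
  qed
  have pt: "ennreal ((norm (f w))\<^sup>2) \<le> (\<Sum>n. ennreal (a n) * indicator (S n) w)" if w: "w \<in> \<Omega>" for w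
  proof -
    obtain n where n: "2 ^ n * d \<le> norm (w $ i - q)" "norm (w $ i - q) < 2 ^ Suc n * d"
      using dyadic_bracket[OF d far[OF w]] by metis
    have "(norm (f w))\<^sup>2 = inverse (norm (w $ i - q) ^ 4)"
      using w by (simp add: f_def nf power_inverse flip: power_mult)
    also have "\<dots> \<le> a n" unfolding a_def using n d by (intro le_imp_inverse_le power_mono) auto
    finally have "ennreal ((norm (f w))\<^sup>2) \<le> ennreal (a n) * indicator (S n) w"
      using n w by (simp add: S_def ennreal_leI)
    also have "\<dots> \<le> (\<Sum>n. ennreal (a n) * indicator (S n) w)"
    proof -
      have "g n \<le> suminf g" for g :: "nat \<Rightarrow> ennreal" using sum_le_suminf[of g "{n}"] by simp
      then show ?thesis .
    qed
    finally show ?thesis .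
  qed
  have summand: "ennreal (a n) * emeasure (lebesgue_on \<Omega>) (S n) \<le> ennreal (64 * R\<^sup>2 / d\<^sup>2 * (1 / 4) ^ n)" for n
  proof -
    have "ennreal (a n) * emeasure (lebesgue_on \<Omega>) (S n) \<le> ennreal (a n) * ennreal (16 * R\<^sup>2 * (2 ^ Suc n * d)\<^sup>2)"
      unfolding S_def using R d by (intro mult_left_mono measure_strip_le \<Omega>) auto
    also have "\<dots> = ennreal (a n * (16 * R\<^sup>2 * (2 ^ Suc n * d)\<^sup>2))"
      using d by (intro ennreal_mult[symmetric]) (auto simp: a_def)
    also have "a n * (16 * R\<^sup>2 * (2 ^ Suc n * d)\<^sup>2) = 64 * R\<^sup>2 / d\<^sup>2 * (1 / 4) ^ n"
    proof -
      have "(4 :: real) ^ n = (2 ^ n)\<^sup>2" by (simp add: power2_eq_square flip: power_mult_distrib)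
      then show ?thesis using d unfolding a_def
        by (simp add: field_simps power_divide power2_eq_square eval_nat_numeral)
    qed
    finally show ?thesis .
  qed
  have "(\<integral>\<^sup>+ w. ennreal ((norm (f w))\<^sup>2) \<partial>lebesgue_on \<Omega>)
      \<le> (\<integral>\<^sup>+ w. (\<Sum>n. ennreal (a n) * indicator (S n) w) \<partial>lebesgue_on \<Omega>)"
    by (rule nn_integral_mono) (use pt in simp)
  also have "\<dots> = (\<Sum>n. \<integral>\<^sup>+ w. ennreal (a n) * indicator (S n) w \<partial>lebesgue_on \<Omega>)"
    by (rule nn_integral_suminf) (use Sm in measurable)
  also have "\<dots> = (\<Sum>n. ennreal (a n) * emeasure (lebesgue_on \<Omega>) (S n))"
    using Sm by (simp add: nn_integral_cmult_indicator)
  also have "\<dots> \<le> (\<Sum>n. ennreal (64 * R\<^sup>2 / d\<^sup>2 * (1 / 4) ^ n))"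
    by (intro suminf_le summand) auto
  also have "\<dots> = ennreal (64 * R\<^sup>2 / d\<^sup>2 * (1 / (1 - 1 / 4)))"
    by (intro suminf_ennreal_eq sums_mult geometric_sums) auto
  \<comment> \<open>The series sums to \<open>4/3\<close>, and \<open>64 * 4/3 < 100\<close>.\<close>
  also have "\<dots> \<le> ennreal ((10 * R / d)\<^sup>2)"
    using d by (intro ennreal_leI) (simp add: power_divide power_mult_distrib field_simps)
  finally have "ennreal ((L2_norm \<Omega> f)\<^sup>2) \<le> ennreal ((10 * R / d)\<^sup>2)"
    unfolding L2_norm_square using nn_integral_eq_integral[OF L2_integrable[OF bergman_L2[OF fb]]] by simp
  then have "(L2_norm \<Omega> f)\<^sup>2 \<le> (10 * R / d)\<^sup>2" by simp
  then show "L2_norm \<Omega> f \<le> 10 * R / d" by (rule power2_le_imp_le) (use R d in simp)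
qed

section \<open>Holomorphy along boundary discs\<close>

lemma filterlim_to_boundary:
  assumes "\<And>n. z n \<in> \<Omega>" and p: "p \<in> frontier \<Omega>" and lim: "z \<longlonglongrightarrow> p"
  shows "filterlim z (to_boundary \<Omega>) sequentially"
  unfolding to_boundary_def filterlim_inf filterlim_principal filterlim_filtercomap_iff o_def
proof
  have "(\<lambda>n. infdist (z n) (frontier \<Omega>)) \<longlonglongrightarrow> infdist p (frontier \<Omega>)"
    using lim by (rule tendsto_infdist)
  then show "(\<lambda>n. infdist (z n) (frontier \<Omega>)) \<longlonglongrightarrow> 0" using p by simp
qed (use assms in simp)

lemma scv_coord_slice_holomorphic:
  fixes \<Omega> :: "(complex ^ 2) set"
  assumes "scv_holomorphic_on f \<Omega>" "\<And>\<xi>. \<xi> \<in> A \<Longrightarrow> coord_pair i x \<xi> \<in> \<Omega>"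
  shows "(\<lambda>\<xi>. f (coord_pair i x \<xi>)) holomorphic_on A"
proof -
  have eq: "coord_pair i x \<xi> = coord_pair i x 0 + \<xi> *s coord_pair i 0 1" for \<xi>
    by (simp add: vec_eq_iff coord_pair_def)
  have "(\<lambda>\<xi>. f (coord_pair i x 0 + \<xi> *s coord_pair i 0 1)) holomorphic_on A"
    by (rule scv_slice_holomorphic[OF assms(1)]) (use assms(2) in \<open>simp only: eq[symmetric]\<close>)
  then show ?thesis by (simp only: eq[symmetric])
qed

text \<open>The uniform bound makes the \<open>A n\<close> equally Lipschitz, so they stay away from zero on a common
  disc around \<open>b\<close>. On it the quotients \<open>B n / A n\<close> are holomorphic and converge uniformly to \<open>g\<close>.\<close>

lemma holomorphic_quotient_limit:
  fixes A B :: "nat \<Rightarrow> complex \<Rightarrow> complex"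
  assumes \<rho>: "\<rho> > 0" and hol: "\<And>n. A n holomorphic_on ball b (2 * \<rho>)" "\<And>n. B n holomorphic_on ball b (2 * \<rho>)"
    and bd: "\<And>n \<xi>. \<xi> \<in> ball b (2 * \<rho>) \<Longrightarrow> norm (A n \<xi>) \<le> M" and lower: "\<And>n. c \<le> norm (A n b)" and c: "c > 0"
    and lim: "\<And>e. e > 0 \<Longrightarrow> \<forall>\<^sub>F n in sequentially. \<forall>\<xi>\<in>cball b \<rho>. norm (g \<xi> * A n \<xi> - B n \<xi>) \<le> e"
  obtains \<eta> where "\<eta> > 0" "g holomorphic_on ball b \<eta>"
proof -
  have "c \<le> M" using bd[of b 0] lower[of 0] \<rho> by simp
  then have M: "M > 0" using c by simp
  have lip: "norm (A n \<xi> - A n b) \<le> M / \<rho> * norm (\<xi> - b)" if \<xi>: "\<xi> \<in> ball b \<rho>" for n \<xi>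
  proof (rule field_differentiable_bound[where S="ball b \<rho>" and f'="deriv (A n)"])
    fix x assume x: "x \<in> ball b \<rho>"
    have sub: "cball x r \<subseteq> ball b (2 * \<rho>)" if "r \<le> \<rho>" for r
    proof
      fix y assume "y \<in> cball x r"
      then show "y \<in> ball b (2 * \<rho>)" using x that dist_triangle[of b y x] by simp
    qed
    have "x \<in> ball b (2 * \<rho>)" using sub[of 0] \<rho> by simp
    then show "(A n has_field_derivative deriv (A n) x) (at x within ball b \<rho>)"
      by (rule holomorphic_derivI[OF hol(1) open_ball])
    have "norm ((deriv ^^ 1) (A n) x) \<le> fact 1 * M / \<rho> ^ 1"
    proof (rule Cauchy_inequality)
      show "A n holomorphic_on ball x \<rho>"
        using holomorphic_on_subset[OF hol(1)] sub[OF order_refl] ball_subset_cball by blast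
      show "continuous_on (cball x \<rho>) (A n)"
        using holomorphic_on_subset[OF hol(1) sub[OF order_refl]] by (rule holomorphic_on_imp_continuous_on)
      show "norm (A n y) \<le> M" if "norm (x - y) = \<rho>" for y
        using bd[of y n] sub[OF order_refl] that by (auto simp: dist_norm)
    qed (rule \<rho>)
    then show "norm (deriv (A n) x) \<le> M / \<rho>" by simp
  qed (use \<xi> \<rho> in auto)
  \<comment> \<open>On this disc the Lipschitz bound keeps \<open>A n\<close> within \<open>c / 2\<close> of its value at \<open>b\<close>.\<close>
  define \<eta> where "\<eta> = min (\<rho> / 2) (c * \<rho> / (2 * M))"
  have \<eta>: "\<eta> > 0" "\<eta> < \<rho>" "M / \<rho> * \<eta> \<le> c / 2"
  proof -
    show "\<eta> > 0" "\<eta> < \<rho>" using \<rho> c M by (auto simp: \<eta>_def min_less_iff_disj)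
    have "M / \<rho> * \<eta> \<le> M / \<rho> * (c * \<rho> / (2 * M))" using M \<rho> by (intro mult_left_mono) (auto simp: \<eta>_def)
    then show "M / \<rho> * \<eta> \<le> c / 2" using M \<rho> by simp
  qed
  have low: "c / 2 \<le> norm (A n \<xi>)" if "\<xi> \<in> cball b \<eta>" for n \<xi>
  proof -
    have "norm (A n \<xi> - A n b) \<le> M / \<rho> * norm (\<xi> - b)" by (rule lip) (use that \<eta> in auto)
    also have "\<dots> \<le> M / \<rho> * \<eta>"
      using that M \<rho> by (intro mult_left_mono) (auto simp: dist_norm norm_minus_commute)
    finally show ?thesis using \<eta>(3) lower[of n] norm_triangle_ineq2[of "A n b" "A n \<xi>"]
      norm_minus_commute[of "A n b" "A n \<xi>"] by linarith
  qed
  have sub2: "cball b \<eta> \<subseteq> ball b (2 * \<rho>)" using \<eta> \<rho> by auto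
  have nz: "A n \<xi> \<noteq> 0" if "\<xi> \<in> cball b \<eta>" for n \<xi> using low[OF that, of n] c by auto
  have hq: "(\<lambda>\<xi>. B n \<xi> / A n \<xi>) holomorphic_on cball b \<eta>" for n
    by (intro holomorphic_on_divide holomorphic_on_subset[OF hol(1) sub2] holomorphic_on_subset[OF hol(2) sub2] nz)
  have ul: "uniform_limit (cball b \<eta>) (\<lambda>n \<xi>. B n \<xi> / A n \<xi>) g sequentially"
  proof (rule uniform_limitI)
    fix e :: real assume e: "e > 0"
    have "\<forall>\<^sub>F n in sequentially. \<forall>\<xi>\<in>cball b \<rho>. norm (g \<xi> * A n \<xi> - B n \<xi>) \<le> e * c / 4"
      by (rule lim) (use e c in simp)
    then show "\<forall>\<^sub>F n in sequentially. \<forall>\<xi>\<in>cball b \<eta>. dist (B n \<xi> / A n \<xi>) (g \<xi>) < e"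
    proof (rule eventually_mono, intro ballI)
      fix n \<xi> assume *: "\<forall>\<xi>\<in>cball b \<rho>. norm (g \<xi> * A n \<xi> - B n \<xi>) \<le> e * c / 4" and \<xi>: "\<xi> \<in> cball b \<eta>"
      have "dist (B n \<xi> / A n \<xi>) (g \<xi>) = norm (g \<xi> * A n \<xi> - B n \<xi>) / norm (A n \<xi>)"
        using nz[OF \<xi>, of n] unfolding dist_norm norm_divide[symmetric] norm_minus_commute[of "B n \<xi> / A n \<xi>"]
        by (simp add: field_simps)
      also have "\<dots> \<le> (e * c / 4) / (c / 2)"
        using * \<xi> \<eta> low[OF \<xi>, of n] c e by (intro frac_le) auto
      also have "\<dots> < e" using e c by simp
      finally show "dist (B n \<xi> / A n \<xi>) (g \<xi>) < e" .
    qed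
  qed
  have "g holomorphic_on ball b \<eta>"
    by (rule holomorphic_uniform_limit[OF _ ul])
       (use hq in \<open>auto intro!: always_eventually holomorphic_on_imp_continuous_on intro: holomorphic_on_subset[OF _ ball_subset_cball]\<close>)
  then show thesis using that \<eta>(1) by blast
qed

text \<open>The points \<open>z n\<close> approach \<open>(q, b)\<close> inside the domain with \<open>i\<close>-th coordinate at distance \<open>d n\<close> from
  \<open>q\<close>. The kernel \<open>k n\<close> and the projection \<open>h n\<close> of \<open>\<phi> k n\<close> have size \<open>1 / d n\<close> near \<open>z n\<close>; after
  multiplication by \<open>d n\<close> their slices in the \<open>j\<close>-th coordinate are the \<open>A n\<close> and \<open>B n\<close> of the previous
  lemma. The hypothesis on the Hankel operator says that \<open>\<phi> k n - h n\<close> tends to zero in norm, and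
  averages over polydiscs of radii \<open>d n / 4\<close> and \<open>\<tau>\<close> turn this into uniform convergence of
  \<open>\<phi>(q, \<xi>) A n \<xi> - B n \<xi>\<close> to zero.\<close>

lemma hankel_zero_imp_holomorphic_slice:
  fixes \<Omega> :: "(complex ^ 2) set" and \<phi> :: "complex ^ 2 \<Rightarrow> complex" and p :: "complex ^ 2"
  assumes R: "reinhardt_domain \<Omega>" and bdd: "bounded \<Omega>" and cvx: "convex \<Omega>"
    and cont: "continuous_on (closure \<Omega>) \<phi>"
    and H0: "((\<lambda>z. (L2_norm \<Omega> (hankel_operator \<Omega> \<phi> (normalized_bergman_kernel \<Omega> z)))\<^sup>2) \<longlongrightarrow> 0) (to_boundary \<Omega>)"
    and ij: "i \<noteq> j" and p: "p \<in> closure \<Omega>" "p $ i = q" and q: "q \<noteq> 0"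
    and half: "\<And>w. w \<in> \<Omega> \<Longrightarrow> Re (cnj q * w $ i) < (norm q)\<^sup>2" and b: "norm b < norm (p $ j)"
  obtains \<eta> where "\<eta> > 0" "(\<lambda>\<xi>. \<phi> (coord_pair i q \<xi>)) holomorphic_on ball b \<eta>"
proof -
  have op: "open \<Omega>" using R by (simp add: reinhardt_domain_def)
  obtain K where K: "K > 0" "\<Omega> \<subseteq> cball 0 K"
    using bdd bounded_pos[of \<Omega>] by (auto simp: subset_iff)
  define r where "r = norm q"
  \<comment> \<open>Room for three nested discs around \<open>b\<close>: slices on radius \<open>\<rho>\<close>, kernel bounds on \<open>2 \<rho>\<close>, averages reaching \<open>3 \<rho>\<close>.\<close>
  define \<rho> where "\<rho> = (norm (p $ j) - norm b) / 4"
  have r: "r > 0" and \<rho>: "\<rho> > 0" using q b by (auto simp: r_def \<rho>_def)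
  define d where "d n = r / real (n + 2)" for n
  have d: "0 < d n" "d n < r" for n using r by (simp_all add: d_def field_simps add_pos_nonneg)
  have dlim: "d \<longlonglongrightarrow> 0" unfolding d_def by (rule LIMSEQ_ignore_initial_segment[OF lim_const_over_n])
  define x where "x n = of_real (1 - d n / r) * q" for n
  have xq: "norm (x n - q) = d n" "norm (x n) = r - d n" for n
  proof -
    have "x n - q = of_real (- (d n / r)) * q" by (simp add: x_def algebra_simps)
    then show "norm (x n - q) = d n" using d[of n] r by (simp only: norm_mult norm_of_real) (simp add: r_def)
    have "0 \<le> 1 - d n / r" using d[of n] r by simp
    then show "norm (x n) = r - d n" using r by (simp only: x_def norm_mult norm_of_real) (simp add: r_def field_simps)
  qed
  have in\<Omega>: "w \<in> \<Omega>" if "norm (w $ i) < r" "norm (w $ j) < norm (p $ j)" for w :: "complex ^ 2"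
  proof (rule reinhardt_open_polydisc[OF R cvx p(1)])
    show "norm (w $ k) < norm (p $ k)" for k
      using that p(2) UNIV_two[OF ij] by (cases "k = i") (auto simp: r_def)
  qed
  have near: "w \<in> \<Omega>" if "norm (w $ i - x n) < d n" "norm (w $ j - b) < 4 * \<rho>" for w :: "complex ^ 2" and n
  proof (rule in\<Omega>)
    show "norm (w $ i) < r" using that(1) xq(2)[of n] norm_triangle_ineq2[of "w $ i" "x n"] by linarith
    show "norm (w $ j) < norm (p $ j)"
      using that(2) norm_triangle_ineq2[of "w $ j" b] by (simp add: \<rho>_def)
  qed
  have polyw: "\<exists>v. w = u + v \<and> norm (v $ i) \<le> \<alpha> \<and> norm (v $ j) \<le> \<beta>" if "w \<in> (+) u ` polydisc i \<alpha> \<beta>" for w u \<alpha> \<beta>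
    using that mem_polydisc[OF ij] by blast
  have psub: "(+) u ` polydisc i (d n / 4) \<beta> \<subseteq> \<Omega>"
    if u: "norm (u $ i - x n) \<le> d n / 4" "norm (u $ j - b) \<le> 2 * \<rho>" and \<beta>: "\<beta> \<le> \<rho>" for u n \<beta>
  proof
    fix w assume "w \<in> (+) u ` polydisc i (d n / 4) \<beta>"
    then obtain v where v: "w = u + v" "norm (v $ i) \<le> d n / 4" "norm (v $ j) \<le> \<beta>" using polyw by blast
    show "w \<in> \<Omega>"
    proof (rule near)
      show "norm (w $ i - x n) < d n"
        using norm_triangle_ineq[of "u $ i - x n" "v $ i"] u v d[of n] by (simp add: algebra_simps)
      show "norm (w $ j - b) < 4 * \<rho>"
        using norm_triangle_ineq[of "u $ j - b" "v $ j"] u v \<beta> \<rho> by (simp add: algebra_simps)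
    qed
  qed
  define z where "z n = coord_pair i (x n) b" for n
  have z\<Omega>: "z n \<in> \<Omega>" for n by (rule near[of _ n]) (use ij d \<rho> in \<open>simp_all add: z_def\<close>)
  have pq: "coord_pair i q \<xi> \<in> closure \<Omega>" if "norm \<xi> \<le> norm (p $ j)" for \<xi>
  proof (rule reinhardt_closure_smaller[OF R cvx p(1)])
    show "norm (coord_pair i q \<xi> $ k) \<le> norm (p $ k)" for k
      using that p(2) ij UNIV_two[OF ij] by (cases "k = i") auto
  qed
  have "coord_pair i q b \<notin> \<Omega>"
    using half[of "coord_pair i q b"] complex_norm_square[of q]
    by (metis Re_complex_of_real coord_pair_nth(1) less_irrefl mult.commute)
  then have fr: "coord_pair i q b \<in> frontier \<Omega>"
    using pq[of b] b op by (simp add: frontier_def interior_open)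
  define k where "k n = normalized_bergman_kernel \<Omega> (z n)" for n
  note kp = normalized_bergman_kernel_properties[OF op bdd z\<Omega>, folded k_def]
  obtain B\<phi> where B\<phi>: "\<And>w. w \<in> closure \<Omega> \<Longrightarrow> norm (\<phi> w) \<le> B\<phi>"
    using continuous_closure_bounded[OF bdd cont] by metis
  have c\<phi>: "continuous_on \<Omega> \<phi>" using continuous_on_subset[OF cont closure_subset] .
  have m\<phi>: "\<phi> \<in> borel_measurable (lebesgue_on \<Omega>)"
    using c\<phi> op by (intro continuous_imp_measurable_on_sets_lebesgue) auto
  have L2\<phi>: "(\<lambda>w. \<phi> w * k n w) \<in> L2_space \<Omega>" for n
    by (rule L2_bounded_mult[OF bergman_L2[OF kp(1)] m\<phi> B\<phi>]) (use closure_subset in blast)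
  define h where "h n = bergman_projection \<Omega> (\<lambda>w. \<phi> w * k n w)" for n
  have hb: "h n \<in> bergman_space \<Omega>" for n
    unfolding h_def by (rule bergman_projection_orthogonal(1)[OF op L2\<phi>])
  have L2d: "(\<lambda>w. \<phi> w * k n w - h n w) \<in> L2_space \<Omega>" for n
    by (rule L2_diff[OF L2\<phi> bergman_L2[OF hb]])
  define F where "F n = L2_norm \<Omega> (\<lambda>w. \<phi> w * k n w - h n w)" for n
  have Fn: "F n = L2_norm \<Omega> (hankel_operator \<Omega> \<phi> (normalized_bergman_kernel \<Omega> (z n)))" for n
    by (simp add: F_def hankel_operator_def h_def k_def)
  have zlim: "z \<longlonglongrightarrow> coord_pair i q b"
  proof (rule vec_tendstoI)
    have "x \<longlonglongrightarrow> q"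
      by (rule LIM_zero_cancel, rule tendsto_norm_zero_cancel) (use dlim in \<open>simp only: xq(1)\<close>)
    then show "(\<lambda>n. z n $ l) \<longlonglongrightarrow> coord_pair i q b $ l" for l
      by (cases "l = i") (simp_all add: z_def)
  qed
  have Fnn: "0 \<le> F n" for n by (simp add: F_def L2_norm_nonneg)
  have "(\<lambda>n. (F n)\<^sup>2) \<longlonglongrightarrow> 0"
    unfolding Fn by (rule filterlim_compose[OF H0 filterlim_to_boundary[OF z\<Omega> fr zlim]])
  then have Flim: "F \<longlonglongrightarrow> 0"
    using tendsto_real_sqrt[of "\<lambda>n. (F n)\<^sup>2" 0] Fnn by simp
  have kbd: "norm (k n w) \<le> 4 / (d n * \<rho>)" if "norm (w $ i - x n) \<le> d n / 4" "norm (w $ j - b) \<le> 2 * \<rho>" for n w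
    using bergman_value_le_polydisc[OF kp(1)[of n] op _ \<rho> psub[OF that order_refl]] d[of n] kp(2)[of n] by simp
  have klow: "1 / (40 * K) \<le> d n * norm (k n (z n))" for n
  proof -
    \<comment> \<open>The pole is the reflection of \<open>x n\<close> in the supporting line, at distance \<open>2 d n\<close> from \<open>x n\<close> and \<open>d n\<close> from the half plane.\<close>
    define q' where "q' = of_real (1 + d n / r) * q"
    have far: "d n \<le> norm (w $ i - q')" if w: "w \<in> \<Omega>" for w
    proof -
      have "cnj q * q' = of_real ((1 + d n / r) * r\<^sup>2)"
        unfolding q'_def r_def using complex_norm_square[of q] by (simp add: mult_ac)
      then have "Re (cnj q * (q' - w $ i)) = (1 + d n / r) * r\<^sup>2 - Re (cnj q * w $ i)"
        by (simp only: right_diff_distrib minus_complex.sel Re_complex_of_real)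
      also have "(1 + d n / r) * r\<^sup>2 = r\<^sup>2 + d n * r" using r by (simp add: field_simps power2_eq_square)
      finally have "Re (cnj q * (q' - w $ i)) = r\<^sup>2 + d n * r - Re (cnj q * w $ i)" .
      then have "r * d n < Re (cnj q * (q' - w $ i))" using half[OF w] by (simp add: r_def mult.commute)
      also have "\<dots> \<le> norm (cnj q * (q' - w $ i))" by (rule complex_Re_le_cmod)
      also have "\<dots> = r * norm (w $ i - q')" by (simp add: norm_mult r_def norm_minus_commute)
      finally show ?thesis using r by simp
    qed
    define f where "f = (\<lambda>w. if w \<in> \<Omega> then inverse ((w $ i - q')\<^sup>2) else 0)"
    note fp = inverse_square_norm_le[OF op K(2,1) d(1) far, folded f_def]
    have "x n - q' = of_real (- 2 * d n / r) * q" by (simp add: x_def q'_def algebra_simps)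
    then have "norm (x n - q') = 2 * d n" using d(1)[of n] r by (simp only: norm_mult norm_of_real) (simp add: r_def)
    then have "norm (f (z n)) = 1 / (4 * (d n)\<^sup>2)"
      using z\<Omega>[of n] by (simp add: f_def z_def norm_inverse norm_power power_mult_distrib) (simp add: divide_simps)
    then have "1 / (4 * (d n)\<^sup>2) \<le> L2_norm \<Omega> f * norm (k n (z n))" using kp(3)[OF fp(1), of n] by simp
    also have "\<dots> \<le> 10 * K / d n * norm (k n (z n))"
      by (rule mult_right_mono[OF fp(2) norm_ge_zero])
    finally have "1 / (4 * (d n)\<^sup>2) * ((d n)\<^sup>2 / (10 * K)) \<le> 10 * K / d n * norm (k n (z n)) * ((d n)\<^sup>2 / (10 * K))"
      using K d[of n] by (intro mult_right_mono) auto
    then show ?thesis using K d(1)[of n] by (simp add: power2_eq_square field_simps)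
  qed
  define A where "A n \<xi> = of_real (d n) * k n (coord_pair i (x n) \<xi>)" for n \<xi>
  define B where "B n \<xi> = of_real (d n) * h n (coord_pair i (x n) \<xi>)" for n \<xi>
  have cin: "coord_pair i (x n) \<xi> \<in> \<Omega>" if "\<xi> \<in> ball b (2 * \<rho>)" for n \<xi>
    by (rule near[of _ n]) (use that ij d \<rho> in \<open>simp_all add: dist_norm norm_minus_commute\<close>)
  have "uniformly_continuous_on (closure \<Omega>) \<phi>"
    using cont bdd by (intro compact_uniformly_continuous) auto
  note uc = this[unfolded uniformly_continuous_on_def, rule_format]
  have lim: "\<forall>\<^sub>F n in sequentially. \<forall>\<xi>\<in>cball b \<rho>. norm (\<phi> (coord_pair i q \<xi>) * A n \<xi> - B n \<xi>) \<le> e"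
    if e: "e > 0" for e
  proof -
    \<comment> \<open>After multiplication by \<open>d n\<close> the two error terms are \<open>4 \<epsilon> / \<rho>\<close> and \<open>4 F n / \<tau>\<close>.\<close>
    define \<epsilon> where "\<epsilon> = e * \<rho> / 8"
    have \<epsilon>: "\<epsilon> > 0" using e \<rho> by (simp add: \<epsilon>_def)
    obtain \<delta> where \<delta>: "\<delta> > 0" "\<And>u w. u \<in> closure \<Omega> \<Longrightarrow> w \<in> closure \<Omega> \<Longrightarrow> dist w u < \<delta> \<Longrightarrow> dist (\<phi> w) (\<phi> u) < \<epsilon>"
      using uc[OF \<epsilon>] by blast
    define \<tau> where "\<tau> = min \<rho> (\<delta> / 4)"
    have \<tau>: "\<tau> > 0" "\<tau> \<le> \<rho>" "\<tau> \<le> \<delta> / 4" using \<rho> \<delta> by (auto simp: \<tau>_def)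
    have "\<forall>\<^sub>F n in sequentially. d n < \<delta> / 4" by (rule order_tendstoD(2)[OF dlim]) (use \<delta> in simp)
    moreover have "\<forall>\<^sub>F n in sequentially. F n < e * \<tau> / 8" by (rule order_tendstoD(2)[OF Flim]) (use e \<tau> in simp)
    ultimately show ?thesis
    proof eventually_elim
      case (elim n)
      show ?case
      proof
        fix \<xi> assume \<xi>: "\<xi> \<in> cball b \<rho>"
        let ?u = "coord_pair i (x n) \<xi>"
        have u: "norm (?u $ i - x n) \<le> d n / 4" "norm (?u $ j - b) \<le> \<rho>"
          using ij d[of n] \<xi> by (auto simp: dist_norm norm_minus_commute)
        have sub: "(+) ?u ` polydisc i (d n / 4) \<tau> \<subseteq> \<Omega>"
          by (rule psub) (use u \<rho> \<tau> in auto)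
        have "norm (\<phi> (coord_pair i q \<xi>) * k n ?u - h n ?u) \<le> \<epsilon> * (4 / (d n * \<rho>)) + F n / (d n / 4 * \<tau>)"
          unfolding F_def
        proof (rule polydisc_average_difference[OF op kp(1) hb c\<phi> L2d _ \<tau>(1) sub])
          show "d n / 4 > 0" using d[of n] by simp
          fix w assume w: "w \<in> (+) ?u ` polydisc i (d n / 4) \<tau>"
          then obtain v where v: "w = ?u + v" "norm (v $ i) \<le> d n / 4" "norm (v $ j) \<le> \<tau>" using polyw by blast
          have wi: "w $ i - x n = v $ i" "w $ j - \<xi> = v $ j" using v ij by simp_all
          have "norm (w $ i - q) \<le> d n + d n / 4"
            using norm_triangle_ineq[of "v $ i" "x n - q"] v(2) xq(1)[of n] wi(1) by (simp add: algebra_simps)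
          then have "norm (w - coord_pair i q \<xi>) < \<delta>"
            using norm_pair_le[OF ij, of "w - coord_pair i q \<xi>"] v(3) wi(2) ij \<tau>(3) elim(1) d(1)[of n] by simp
          moreover have "w \<in> closure \<Omega>" using sub w closure_subset by blast
          moreover have "coord_pair i q \<xi> \<in> closure \<Omega>"
          proof (rule pq)
            show "norm \<xi> \<le> norm (p $ j)"
              using \<xi> norm_triangle_ineq2[of \<xi> b] \<rho> by (simp add: dist_norm norm_minus_commute \<rho>_def)
          qed
          ultimately show "norm (\<phi> w - \<phi> (coord_pair i q \<xi>)) \<le> \<epsilon>"
            using \<delta>(2)[of "coord_pair i q \<xi>" w] by (simp add: dist_norm)
          show "norm (k n w) \<le> 4 / (d n * \<rho>)"
          proof (rule kbd)
            show "norm (w $ i - x n) \<le> d n / 4" using wi v by simp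
            show "norm (w $ j - b) \<le> 2 * \<rho>"
              using norm_triangle_ineq[of "v $ j" "\<xi> - b"] v(3) wi(2) \<tau>(2) \<xi>
              by (simp add: algebra_simps dist_norm norm_minus_commute)
          qed
        qed
        then have "d n * norm (\<phi> (coord_pair i q \<xi>) * k n ?u - h n ?u)
            \<le> d n * (\<epsilon> * (4 / (d n * \<rho>)) + F n / (d n / 4 * \<tau>))"
          using d(1)[of n] by (intro mult_left_mono) auto
        also have "\<dots> = 4 * \<epsilon> / \<rho> + 4 * F n / \<tau>" using d(1)[of n] \<rho> \<tau> by (simp add: field_simps)
        also have "\<dots> \<le> e / 2 + e / 2"
        proof (rule add_mono)
          show "4 * \<epsilon> / \<rho> \<le> e / 2" using \<rho> by (simp add: \<epsilon>_def)
          show "4 * F n / \<tau> \<le> e / 2" using elim(2) \<tau>(1) by (simp add: field_simps)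
        qed
        finally have "d n * norm (\<phi> (coord_pair i q \<xi>) * k n ?u - h n ?u) \<le> e" by simp
        moreover have "\<phi> (coord_pair i q \<xi>) * A n \<xi> - B n \<xi> = of_real (d n) * (\<phi> (coord_pair i q \<xi>) * k n ?u - h n ?u)"
          by (simp add: A_def B_def algebra_simps)
        ultimately show "norm (\<phi> (coord_pair i q \<xi>) * A n \<xi> - B n \<xi>) \<le> e"
          using d(1)[of n] by (simp add: norm_mult)
      qed
    qed
  qed
  show thesis
  proof (rule holomorphic_quotient_limit[OF \<rho>, of A b B "4 / \<rho>" "1 / (40 * K)" "\<lambda>\<xi>. \<phi> (coord_pair i q \<xi>)"])
    show "A n holomorphic_on ball b (2 * \<rho>)" for n
      unfolding A_def by (intro holomorphic_intros scv_coord_slice_holomorphic[OF bergman_holomorphic[OF kp(1)] cin])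
    show "B n holomorphic_on ball b (2 * \<rho>)" for n
      unfolding B_def by (intro holomorphic_intros scv_coord_slice_holomorphic[OF bergman_holomorphic[OF hb] cin])
    show "norm (A n \<xi>) \<le> 4 / \<rho>" if "\<xi> \<in> ball b (2 * \<rho>)" for n \<xi>
    proof -
      have "norm (k n (coord_pair i (x n) \<xi>)) \<le> 4 / (d n * \<rho>)"
        by (rule kbd) (use that ij d(1)[of n] in \<open>auto simp: dist_norm norm_minus_commute\<close>)
      then have "d n * norm (k n (coord_pair i (x n) \<xi>)) \<le> d n * (4 / (d n * \<rho>))"
        using d(1)[of n] by (intro mult_left_mono) auto
      then show ?thesis using d(1)[of n] by (simp add: A_def norm_mult)
    qed
    show "1 / (40 * K) \<le> norm (A n b)" for n
      using klow[of n] d(1)[of n] by (simp add: A_def z_def norm_mult)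
    show "1 / (40 * K) > 0" using K by simp
  qed (use lim that in auto)
qed

text \<open>A nonconstant holomorphic function is open, so its real part has no interior maximum.\<close>

lemma Re_attains_max_imp_constant:
  assumes hol: "g holomorphic_on ball 0 1" and le: "\<And>\<zeta>. \<zeta> \<in> ball 0 1 \<Longrightarrow> Re (g \<zeta>) \<le> Re (g 0)"
    and \<zeta>: "\<zeta> \<in> ball 0 1"
  shows "g \<zeta> = g 0"
proof -
  have "g constant_on ball 0 1"
  proof (rule ccontr)
    assume nc: "\<not> g constant_on ball 0 1"
    have "open (g ` ball 0 1)"
      by (rule open_mapping_thm[OF hol open_ball connected_ball open_ball order_refl nc])
    then obtain e where e: "e > 0" "cball (g 0) e \<subseteq> g ` ball 0 1"
      by (metis centre_in_ball image_eqI open_contains_cball zero_less_one)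
    have "g 0 + of_real e \<in> cball (g 0) e" using e(1) by (simp add: dist_norm)
    then obtain \<xi> where "\<xi> \<in> ball 0 1" "g \<xi> = g 0 + of_real e" using e(2) by (metis imageE subsetD)
    then show False using le[of \<xi>] e(1) by simp
  qed
  then show ?thesis using \<zeta> unfolding constant_on_def by (metis centre_in_ball zero_less_one)
qed

text \<open>A functional supporting the domain at \<open>f 0\<close> attains its maximum along \<open>f\<close> at the centre, so
  the whole disc lies in one face. A coordinate with nonzero coefficient is then constant, since
  a nonzero multiple of it is real. So either \<open>f\<close> is constant, or one coordinate is a constant
  \<open>q\<close> and the other an open map \<open>u\<close>, and it remains to see that \<open>\<phi>\<close> is holomorphic in that
  coordinate on the image of \<open>u\<close>.\<close>

lemma hankel_zero_imp_holomorphic_on_disc: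
  fixes \<Omega> :: "(complex ^ 2) set" and \<phi> :: "complex ^ 2 \<Rightarrow> complex" and f :: "complex \<Rightarrow> complex ^ 2"
  assumes R: "reinhardt_domain \<Omega>" and bdd: "bounded \<Omega>" and cvx: "convex \<Omega>"
    and cont: "continuous_on (closure \<Omega>) \<phi>"
    and H0: "((\<lambda>z. (L2_norm \<Omega> (hankel_operator \<Omega> \<phi> (normalized_bergman_kernel \<Omega> z)))\<^sup>2) \<longlongrightarrow> 0) (to_boundary \<Omega>)"
    and f: "\<And>i. (\<lambda>\<zeta>. f \<zeta> $ i) holomorphic_on ball 0 1" "f ` ball 0 1 \<subseteq> frontier \<Omega>"
  shows "(\<phi> \<circ> f) holomorphic_on ball 0 1"
proof -
  have op: "open \<Omega>" and ne: "\<Omega> \<noteq> {}" using R by (auto simp: reinhardt_domain_def)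
  have const: "(\<phi> \<circ> f) holomorphic_on ball 0 1" if "\<And>\<zeta> i. \<zeta> \<in> ball 0 1 \<Longrightarrow> f \<zeta> $ i = f 0 $ i"
  proof -
    have "f \<zeta> = f 0" if "\<zeta> \<in> ball 0 1" for \<zeta>
      using \<open>\<And>\<zeta> i. \<zeta> \<in> ball 0 1 \<Longrightarrow> f \<zeta> $ i = f 0 $ i\<close>[OF that] by (simp add: vec_eq_iff)
    then show ?thesis by (intro holomorphic_transform[where g="\<phi> \<circ> f", OF holomorphic_on_const[of "\<phi> (f 0)"]]) (simp only: o_def)
  qed
  have fcl: "f \<zeta> \<in> closure \<Omega>" if "\<zeta> \<in> ball 0 1" for \<zeta>
    using f(2) imageI[OF that, of f] by (auto simp: frontier_def)
  have "f 0 \<in> frontier \<Omega>" using f(2) by auto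
  then obtain a where a: "a \<noteq> 0" "\<And>w. w \<in> closure \<Omega> \<Longrightarrow> a \<bullet> w \<le> a \<bullet> f 0" "\<And>w. w \<in> \<Omega> \<Longrightarrow> a \<bullet> w < a \<bullet> f 0"
    using supporting_functional[OF op cvx ne] by metis
  define c where "c = a \<bullet> f 0"
  note a = a[folded c_def]
  define L where "L \<zeta> = (\<Sum>k\<in>UNIV. cnj (a $ k) * f \<zeta> $ k)" for \<zeta>
  have ReL: "Re (L \<zeta>) = a \<bullet> f \<zeta>" for \<zeta>
    by (simp add: L_def inner_complex_vec del: times_complex.sel)
  have L: "L \<zeta> = L 0" if "\<zeta> \<in> ball 0 1" for \<zeta>
  proof (rule Re_attains_max_imp_constant[OF _ _ that])
    show "L holomorphic_on ball 0 1" unfolding L_def by (intro holomorphic_intros f)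
    show "Re (L \<xi>) \<le> Re (L 0)" if "\<xi> \<in> ball 0 1" for \<xi>
      unfolding ReL using a(2)[OF fcl[OF that]] by (simp add: c_def)
  qed
  have face: "cnj (a $ k) * f \<zeta> $ k = of_real (norm (a $ k) * norm (f \<zeta> $ k))" if "\<zeta> \<in> ball 0 1" for \<zeta> k
  proof (rule reinhardt_face[OF R a(2) fcl[OF that]])
    show "a \<bullet> f \<zeta> = c" using L[OF that] ReL[of \<zeta>] ReL[of 0] by (simp add: c_def)
  qed
  have fixed: "f \<zeta> $ k = f 0 $ k" if "a $ k \<noteq> 0" "\<zeta> \<in> ball 0 1" for \<zeta> k
  proof -
    let ?g = "\<lambda>\<zeta>. \<i> * (cnj (a $ k) * f \<zeta> $ k)"
    have "?g \<zeta> = ?g 0"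
    proof (rule Re_attains_max_imp_constant[OF _ _ that(2)])
      show "?g holomorphic_on ball 0 1" by (intro holomorphic_intros f)
      show "Re (?g \<xi>) \<le> Re (?g 0)" if "\<xi> \<in> ball 0 1" for \<xi>
        using face[OF that, of k] face[of 0 k] by simp
    qed
    then show ?thesis using that(1) by simp
  qed
  obtain i :: 2 where ai: "a $ i \<noteq> 0" using a(1) by (auto simp: vec_eq_iff)
  obtain j :: 2 where ij: "i \<noteq> j" by (metis exhaust_2 zero_neq_one one_neq_zero)
  have cases: "k = i \<or> k = j" for k using UNIV_two[OF ij] by auto
  show ?thesis
  proof (cases "a $ j \<noteq> 0 \<or> (\<lambda>\<zeta>. f \<zeta> $ j) constant_on ball 0 1")
    case True
    have j: "f \<zeta> $ j = f 0 $ j" if \<zeta>: "\<zeta> \<in> ball 0 1" for \<zeta>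
      using True
    proof
      assume "a $ j \<noteq> 0"
      then show ?thesis by (rule fixed[OF _ \<zeta>])
    next
      assume "(\<lambda>\<zeta>. f \<zeta> $ j) constant_on ball 0 1"
      then obtain y where "\<And>\<xi>. \<xi> \<in> ball 0 1 \<Longrightarrow> f \<xi> $ j = y" unfolding constant_on_def by blast
      then show ?thesis using \<zeta> by simp
    qed
    show ?thesis
    proof (rule const)
      show "f \<zeta> $ k = f 0 $ k" if "\<zeta> \<in> ball 0 1" for \<zeta> k
        using cases[of k] fixed[OF ai that] j[OF that] by auto
    qed
  next
    case False
    then have aj: "a $ j = 0" and nc: "\<not> (\<lambda>\<zeta>. f \<zeta> $ j) constant_on ball 0 1" by auto
    define u where "u \<zeta> = f \<zeta> $ j" for \<zeta>
    have hu: "u holomorphic_on ball 0 1" unfolding u_def by (rule f)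
    have ou: "open (u ` ball 0 1)"
      by (rule open_mapping_thm[OF hu open_ball connected_ball open_ball order_refl]) (use nc in \<open>simp add: constant_on_def u_def\<close>)
    define q where "q = f 0 $ i"
    have fq: "f \<zeta> = coord_pair i q (u \<zeta>)" if "\<zeta> \<in> ball 0 1" for \<zeta>
      using fixed[OF ai that] by (intro coord_pair_eqI[OF ij]) (simp_all add: q_def u_def)
    have inner_i: "a \<bullet> w = Re (cnj (a $ i) * w $ i)" for w using inner_coord[OF ij, of a w] aj by simp
    have aq: "cnj (a $ i) * q = of_real c"
    proof -
      have 1: "cnj (a $ i) * q = of_real (norm (a $ i) * norm q)" using face[of 0 i] by (simp add: q_def)
      then show ?thesis using inner_i[of "f 0"] by (simp add: c_def q_def del: times_complex.sel)
    qed
    have c: "c > 0"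
    proof -
      obtain w where w: "w \<in> \<Omega>" using ne by blast
      \<comment> \<open>The domain is symmetric about the origin, so its functionals have positive suprema.\<close>
      have "(\<chi> k. (- 1) * w $ k) \<in> \<Omega>"
        using R w unfolding reinhardt_domain_def
        by (elim conjE ballE[of _ _ w] allE[of _ "\<chi> k. - 1"]) auto
      then have "- w \<in> \<Omega>" by (simp add: vec_eq_iff[symmetric] uminus_vec_def)
      then show ?thesis using a(3)[OF w] a(3)[of "- w"] by simp
    qed
    then have q: "q \<noteq> 0" using aq by auto
    have half: "Re (cnj q * w $ i) < (norm q)\<^sup>2" if "w \<in> \<Omega>" for w
    proof -
      have "cnj (a $ i) = of_real (c / (norm q)\<^sup>2) * cnj q"
      proof -
        have "cnj (a $ i) * q * cnj q = of_real c * cnj q" using aq by simp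
        then have "cnj (a $ i) * of_real ((norm q)\<^sup>2) = of_real c * cnj q"
          unfolding mult.assoc complex_norm_square[symmetric] .
        then show ?thesis using q by (simp add: field_simps)
      qed
      moreover have "Re (of_real t * v) = t * Re v" for t v by simp
      ultimately have "a \<bullet> w = c / (norm q)\<^sup>2 * Re (cnj q * w $ i)"
        unfolding inner_i by (simp only: mult.assoc)
      then have "c / (norm q)\<^sup>2 * Re (cnj q * w $ i) < c" using a(3)[OF that] by simp
      then have "c * Re (cnj q * w $ i) < c * (norm q)\<^sup>2" using q by (simp add: field_simps del: times_complex.sel)
      then show ?thesis using c by (simp del: times_complex.sel)
    qed
    have "(\<lambda>\<xi>. \<phi> (coord_pair i q \<xi>)) field_differentiable (at x within u ` ball 0 1)" if x: "x \<in> u ` ball 0 1" for x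
    proof -
      obtain e where e: "e > 0" "cball x e \<subseteq> u ` ball 0 1" using ou x open_contains_cball by metis
      \<comment> \<open>A point of the image further out than \<open>x\<close> shows that \<open>x\<close> is interior to the flat face.\<close>
      define y where "y = (if x = 0 then of_real e else x + of_real (e / norm x) * x)"
      have "norm x < norm y \<and> y \<in> cball x e"
      proof (cases "x = 0")
        case False
        then have "y = of_real (1 + e / norm x) * x" by (simp add: y_def algebra_simps)
        then have "norm y = (1 + e / norm x) * norm x"
          using e(1) False by (simp only: norm_mult norm_of_real) simp
        then show ?thesis using False e(1) by (simp add: y_def dist_norm norm_mult norm_divide field_simps)
      qed (use e in \<open>simp add: y_def\<close>)
      then obtain \<xi> where \<xi>: "\<xi> \<in> ball 0 1" "norm x < norm (u \<xi>)" using e(2) by (metis imageE subsetD)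
      obtain \<eta> where "\<eta> > 0" "(\<lambda>\<xi>. \<phi> (coord_pair i q \<xi>)) holomorphic_on ball x \<eta>"
      proof (rule hankel_zero_imp_holomorphic_slice[OF R bdd cvx cont H0 ij fcl[OF \<xi>(1)] _ q half])
        show "f \<xi> $ i = q" using fq[OF \<xi>(1)] by simp
        show "norm x < norm (f \<xi> $ j)" using \<xi>(2) by (simp add: u_def)
      qed
      then have "(\<lambda>\<xi>. \<phi> (coord_pair i q \<xi>)) field_differentiable (at x)"
        by (meson centre_in_ball holomorphic_on_imp_differentiable_at open_ball)
      then show ?thesis by (rule field_differentiable_at_within)
    qed
    then have "(\<lambda>\<xi>. \<phi> (coord_pair i q \<xi>)) holomorphic_on u ` ball 0 1" by (simp add: holomorphic_on_def)
    from holomorphic_on_compose[OF hu this]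
    have "(\<lambda>\<zeta>. \<phi> (coord_pair i q (u \<zeta>))) holomorphic_on ball 0 1" by (simp add: o_def)
    then show ?thesis by (rule holomorphic_transform) (simp add: fq)
  qed
qed

theorem theorem1p2:
  fixes \<Omega> :: "(complex ^ 2) set" and \<phi> :: "complex ^ 2 \<Rightarrow> complex"
  assumes "reinhardt_domain \<Omega>" and "bounded \<Omega>" and "convex \<Omega>"
    and "continuous_on (closure \<Omega>) \<phi>"
  shows "((\<lambda>z. (L2_norm \<Omega> (hankel_operator \<Omega> \<phi> (normalized_bergman_kernel \<Omega> z)))\<^sup>2) \<longlongrightarrow> 0)
           (to_boundary \<Omega>)
     \<longleftrightarrow> (\<forall>f :: complex \<Rightarrow> complex ^ 2.
            (\<forall>i. (\<lambda>\<zeta>. f \<zeta> $ i) holomorphic_on ball 0 1) \<and> f ` ball 0 1 \<subseteq> frontier \<Omega>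
              \<longrightarrow> (\<phi> \<circ> f) holomorphic_on ball 0 1)"
proof
  assume "((\<lambda>z. (L2_norm \<Omega> (hankel_operator \<Omega> \<phi> (normalized_bergman_kernel \<Omega> z)))\<^sup>2) \<longlongrightarrow> 0) (to_boundary \<Omega>)"
  then show "\<forall>f :: complex \<Rightarrow> complex ^ 2.
            (\<forall>i. (\<lambda>\<zeta>. f \<zeta> $ i) holomorphic_on ball 0 1) \<and> f ` ball 0 1 \<subseteq> frontier \<Omega>
              \<longrightarrow> (\<phi> \<circ> f) holomorphic_on ball 0 1"
    using hankel_zero_imp_holomorphic_on_disc[OF assms] by blast
next
  assume "\<forall>f :: complex \<Rightarrow> complex ^ 2.
            (\<forall>i. (\<lambda>\<zeta>. f \<zeta> $ i) holomorphic_on ball 0 1) \<and> f ` ball 0 1 \<subseteq> frontier \<Omega>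
              \<longrightarrow> (\<phi> \<circ> f) holomorphic_on ball 0 1"
  then have discs: "(\<phi> \<circ> f) holomorphic_on ball 0 1"
    if "\<And>i. (\<lambda>\<zeta>. f \<zeta> $ i) holomorphic_on ball 0 1" "f ` ball 0 1 \<subseteq> frontier \<Omega>" for f :: "complex \<Rightarrow> complex ^ 2"
    using that by blast
  show "((\<lambda>z. (L2_norm \<Omega> (hankel_operator \<Omega> \<phi> (normalized_bergman_kernel \<Omega> z)))\<^sup>2) \<longlongrightarrow> 0) (to_boundary \<Omega>)"
  proof (rule tendsto_to_boundary_zeroI)
    fix p :: "complex ^ 2" and e :: real
    assume pe: "p \<in> frontier \<Omega>" "e > 0"
    show "\<exists>U. open U \<and> p \<in> U \<and> (\<forall>z\<in>U \<inter> \<Omega>.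
        (L2_norm \<Omega> (hankel_operator \<Omega> \<phi> (normalized_bergman_kernel \<Omega> z)))\<^sup>2 < e)"
      by (rule hankel_small_near_boundary_point[OF assms _ pe]) (rule discs)
  qed (use assms in \<open>auto simp: reinhardt_domain_def\<close>)
qed

end
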